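(* Let $\lambda_0\in U$ be a parameter value for which $X_{\lambda_0}$ has a period annulus, and let $E_{\lambda_0}\subset\mathbb P^{N-1}$ be the fibre over $\lambda_0$ of the blowup of $\mathbb C^n$ with center the Bautin ideal ${\bf B}=(v_1,\dots,v_N)$. Then the projectivized set of bifurcation functions associated to one-parameter analytic deformations $X_{\lambda(\varepsilon)}$, $\lambda(0)=\lambda_0$, of the vector field $X_{\lambda_0}$ is in bijective correspondence with the points of $E_{\lambda_0}$, via $$M_k\mapsto [v_1^{(k)}:v_2^{(k)}:\dots:v_N^{(k)}]\in E_{\lambda_0},$$ where $v_j(\lambda(\varepsilon))=\sum_{r\ge 0}v_j^{(r)}\varepsilon^r$ and $k$ is the order of the bifurcation function. Moreover this correspondence is a linear isomorphism.
   Context: Blowup. For an ideal $I=(v_1,\dots,v_N)\subset\mathbb C[\lambda_1,\dots,\lambda_n]$ with zero set $Z=Z(I)\subset\mathbb C^n$, the blowup $B_I\mathbb C^n\subset\mathbb C^n\times\mathbb P^{N-1}$ is the Zariski closure of the graph of $\mathbb C^n\setminus Z\to\mathbb P^{N-1}$, $\lambda\mapsto[v_1(\lambda):\dots:v_N(\lambda)]$, with projection $\pi:B_I\mathbb C^n\to\mathbb C^n$. For $\lambda\in Z$, $E_\lambda=\pi^{-1}(\lambda)$ is regarded as a subset of $\mathbb P^{N-1}$. Bautin ideal. $X_\lambda$, $\lambda\in\mathbb C^n$, is the family of polynomial planar vector fields of degree at most $d$, parameterized by its coefficients. Let $X_{\lambda_0}$ have an open period annulus $\Pi$ (a union of periodic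 orbits homeomorphic to $S^1\times(0,1)$), let $\Sigma$ be a cross-section with coordinate $h$ and let $h_0$ be the coordinate of a point of $\Sigma$. For $\lambda$ near $\lambda_0$ the displacement function is $F(h,\lambda)=\mathcal P_\lambda(h)-h$, with $\mathcal P_\lambda$ the first return map; it is analytic near $(h_0,\lambda_0)$, and $F_k(\lambda)$ denote the coefficients of its Taylor expansion in powers of $h-h_0$. The Bautin ideal germ $\mathcal B_{\lambda_0}$ is the ideal of the ring $\mathcal O_{\lambda_0}$ of germs of analytic functions at $\lambda_0$ generated by all the $F_k$. Standing assumptions: there is an open set $U\subset\mathbb C^n$ containing $\lambda_0$ on which the coefficients $F_k$ define an ideal sheaf with germs $\mathcal B_\lambda$, and there are finitely many polynomials $v_1,\dots,v_N\in\mathbb C[\lambda_1,\dots,\lambda_n]$ generating $\mathcal B_\lambda$ for every $\lambda\in U$; the polynomial ideal ${\bf B}=(v_1,\dots,v_N)$ is called the Bautin ideal. Thus near $(h_0,\lambda_0)$ one can write $F(h,\lambda)=\sum_{j=1}^N v_j(\lambda)\Phi_j(h,\lambda)$ with $\Phi_j$ analytic. Bifurcation function. For an analytic arc $\varepsilon\mapsto\lambda(\varepsilon)$ with $\lambda(0)=\lambda_0$ and $F(h,\lambda(\varepsilon))\not\equiv0$, write $F(h,\lambda(\varepsilon))=\varepsilon^kM_k(h)+O(\varepsilon^{k+1})$ with $M_k\not\equiv 0$. $M_k$ is the bifurcation function (of order $k$) associated to the deformation $X_{\lambda(\varepsilon)}$. The projectivized set of bifurcation functions is the set of classes of the functions $M_k$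 (as analytic functions near $h_0$) up to multiplication by a nonzero constant. "Linear isomorphism" means that the bijection and its inverse are induced by linear maps between the vector subspace of $\mathbb C^N$ spanned by (the lines represented by) $E_{\lambda_0}$ and the vector space spanned by the bifurcation functions. *)

theory Defs
  imports
    "HOL-Complex_Analysis.Complex_Analysis"
    "HOL-Library.Poly_Mapping"
begin

no_notation fps_nth (infixl \<open>$\<close> 75)

section \<open>Polynomials and the blowup\<close>

text \<open>Polynomials over the complex numbers in variables indexed by a type: finitely supported
  families of coefficients, indexed by finitely supported exponent vectors.\<close>

type_synonym 'i cpoly = "('i \<Rightarrow>\<^sub>0 nat) \<Rightarrow>\<^sub>0 complex"

definition peval :: "'i cpoly \<Rightarrow> ('i \<Rightarrow> complex) \<Rightarrow> complex" where
  "peval p x = (\<Sum>m\<in>Poly_Mapping.keys p. Poly_Mapping.lookup p m *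
     (\<Prod>i\<in>Poly_Mapping.keys m. x i ^ Poly_Mapping.lookup m i))"

abbreviation vpeval :: "'n::finite cpoly \<Rightarrow> complex^'n \<Rightarrow> complex" where
  "vpeval p \<mu> \<equiv> peval p (\<lambda>i. \<mu> $ i)"

text \<open>A point of projective space is a one-dimensional subspace of the coordinate space, so
  \<open>[w\<^sub>1 : \<dots> : w\<^sub>N]\<close> is \<^term>\<open>vec.span {w}\<close>.\<close>

definition projective_space :: "(complex^'m::finite) set set" where
  "projective_space = {vec.span {w} | w. w \<noteq> 0}"

text \<open>Polynomials in the affine variables (left summand) and the projective variables (right
  summand), homogeneous with respect to the latter.\<close>

definition homogeneous_right :: "('n + 'm::finite) cpoly \<Rightarrow> bool" where
  "homogeneous_right p \<longleftrightarrow>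
     (\<exists>e. \<forall>m\<in>Poly_Mapping.keys p. (\<Sum>j\<in>UNIV. Poly_Mapping.lookup m (Inr j)) = e)"

definition zariski_closed :: "((complex^'n::finite) \<times> (complex^'m::finite) set) set \<Rightarrow> bool" where
  "zariski_closed Y \<longleftrightarrow> (\<exists>S :: ('n + 'm) cpoly set. (\<forall>p\<in>S. homogeneous_right p) \<and>
     Y = {(\<mu>, l). l \<in> projective_space \<and>
            (\<forall>p\<in>S. \<forall>w\<in>l. peval p (case_sum (\<lambda>i. \<mu> $ i) (\<lambda>j. w $ j)) = 0)})"

definition zero_set :: "('m \<Rightarrow> 'n::finite cpoly) \<Rightarrow> (complex^'n) set" where
  "zero_set v = {\<mu>. \<forall>j. vpeval (v j) \<mu> = 0}"

definition blowup :: "('m::finite \<Rightarrow> 'n::finite cpoly) \<Rightarrow> ((complex^'n) \<times> (complex^'m) set) set" where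
  "blowup v = zariski_closed hull {(\<mu>, vec.span {\<chi> j. vpeval (v j) \<mu>}) | \<mu>. \<mu> \<notin> zero_set v}"

definition blowup_fibre ::
    "('m::finite \<Rightarrow> 'n::finite cpoly) \<Rightarrow> complex^'n \<Rightarrow> (complex^'m) set set" where
  "blowup_fibre v \<mu> = {l. (\<mu>, l) \<in> blowup v}"


section \<open>Analytic functions of several complex variables and their germs\<close>

text \<open>Analyticity on an open set is complex differentiability, as for \<^const>\<open>analytic_on\<close> in one
  variable. The first argument is the complex scalar multiplication of the domain.\<close>

definition cdifferentiable_on ::
    "(complex \<Rightarrow> 'a \<Rightarrow> 'a) \<Rightarrow> ('a::real_normed_vector \<Rightarrow> complex) \<Rightarrow> 'a set \<Rightarrow> bool" where
  "cdifferentiable_on s f S \<longleftrightarrow>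
     (\<forall>x\<in>S. \<exists>f'. (f has_derivative f') (at x) \<and> (\<forall>c y. f' (s c y) = c * f' y))"

abbreviation pair_scale :: "complex \<Rightarrow> complex \<times> (complex^'n) \<Rightarrow> complex \<times> (complex^'n::finite)" where
  "pair_scale c x \<equiv> (c * fst x, c *s snd x)"

text \<open>Germs at the origin of complex-valued functions; the germ of \<open>f\<close> at \<open>x\<close> is represented by the
  germ at the origin of \<open>z \<mapsto> f (x + z)\<close>.\<close>

definition germ_eq :: "('a::real_normed_vector \<Rightarrow> complex) \<Rightarrow> ('a \<Rightarrow> complex) \<Rightarrow> bool" where
  "germ_eq f g \<longleftrightarrow> (\<forall>\<^sub>F z in nhds 0. f z = g z)"

lemma germ_eq_equivp: "equivp germ_eq"
proof (rule equivpI)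
  show "reflp germ_eq"
    by (auto simp: reflp_def germ_eq_def)
  show "symp germ_eq"
    by (auto simp: symp_def germ_eq_def eq_commute)
  show "transp germ_eq"
    unfolding transp_def germ_eq_def by (auto elim: eventually_elim2)
qed

quotient_type (overloaded) 'a germ = "'a::real_normed_vector \<Rightarrow> complex" / germ_eq
  by (rule germ_eq_equivp)

instantiation germ :: (real_normed_vector) comm_ring_1
begin

lift_definition zero_germ :: "'a germ" is "\<lambda>_. 0" .
lift_definition one_germ :: "'a germ" is "\<lambda>_. 1" .
lift_definition plus_germ :: "'a germ \<Rightarrow> 'a germ \<Rightarrow> 'a germ" is "\<lambda>f g z. f z + g z"
  unfolding germ_eq_def by (auto elim: eventually_elim2)
lift_definition minus_germ :: "'a germ \<Rightarrow> 'a germ \<Rightarrow> 'a germ" is "\<lambda>f g z. f z - g z"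
  unfolding germ_eq_def by (auto elim: eventually_elim2)
lift_definition uminus_germ :: "'a germ \<Rightarrow> 'a germ" is "\<lambda>f z. - f z"
  unfolding germ_eq_def by (auto elim: eventually_mono)
lift_definition times_germ :: "'a germ \<Rightarrow> 'a germ \<Rightarrow> 'a germ" is "\<lambda>f g z. f z * g z"
  unfolding germ_eq_def by (auto elim: eventually_elim2)

instance
proof
  show "(0 :: 'a germ) \<noteq> 1"
    by transfer (simp add: germ_eq_def)
qed (transfer; simp add: germ_eq_def algebra_simps)+

end

lift_definition germ_scale :: "complex \<Rightarrow> 'a::real_normed_vector germ \<Rightarrow> 'a germ"
  is "\<lambda>c f z. c * f z"
  unfolding germ_eq_def by (auto elim: eventually_mono)

interpretation germ: vector_space "germ_scale :: complex \<Rightarrow> 'a::real_normed_vector germ \<Rightarrow> 'a germ"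
  by unfold_locales (transfer; simp add: germ_eq_def algebra_simps)+

definition germ_at :: "'a::real_normed_vector \<Rightarrow> ('a \<Rightarrow> complex) \<Rightarrow> 'a germ" where
  "germ_at x f = abs_germ (\<lambda>z. f (x + z))"

text \<open>By the convention for \<^const>\<open>germ_at\<close>, this set represents the ring of germs of analytic
  functions at any given point.\<close>

definition analytic_germs :: "(complex^'n::finite) germ set" where
  "analytic_germs = {germ_at 0 f | f S. open S \<and> 0 \<in> S \<and> cdifferentiable_on (*s) f S}"

definition germ_ideal :: "(complex^'n::finite) germ set \<Rightarrow> (complex^'n) germ set" where
  "germ_ideal G = {\<Sum>g\<in>T. a g * g | T a. finite T \<and> T \<subseteq> G \<and> (\<forall>g\<in>T. a g \<in> analytic_germs)}"


section \<open>Planar polynomial vector fields, period annuli and return maps\<close>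

text \<open>The parameter is the vector of all coefficients; \<open>\<iota> (b, i, j)\<close> is the position of the
  coefficient of \<open>x\<^sup>i y\<^sup>j\<close> in the first (\<open>b\<close> false) or second (\<open>b\<close> true) component.\<close>

definition coefficient_labels :: "nat \<Rightarrow> (bool \<times> nat \<times> nat) set" where
  "coefficient_labels d = {(b, i, j). i + j \<le> d}"

definition poly_vector_field :: "nat \<Rightarrow> (bool \<times> nat \<times> nat \<Rightarrow> 'n::finite) \<Rightarrow> complex^'n
    \<Rightarrow> complex \<times> complex \<Rightarrow> complex \<times> complex" where
  "poly_vector_field d \<iota> \<mu> = (\<lambda>(x, y).
     (\<Sum>(i, j)\<in>{(i, j). i + j \<le> d}. \<mu> $ \<iota> (False, i, j) * x ^ i * y ^ j,
      \<Sum>(i, j)\<in>{(i, j). i + j \<le> d}. \<mu> $ \<iota> (True, i, j) * x ^ i * y ^ j))"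

definition trajectory ::
    "(complex \<times> complex \<Rightarrow> complex \<times> complex) \<Rightarrow> (real \<Rightarrow> complex \<times> complex) \<Rightarrow> bool" where
  "trajectory X x \<longleftrightarrow> (\<forall>t. (x has_vector_derivative X (x t)) (at t))"

definition periodic_orbit ::
    "(complex \<times> complex \<Rightarrow> complex \<times> complex) \<Rightarrow> (complex \<times> complex) set \<Rightarrow> bool" where
  "periodic_orbit X C \<longleftrightarrow> (\<exists>x T. trajectory X x \<and> T > 0 \<and> (\<forall>t. x (t + T) = x t) \<and>
     (\<exists>t. x t \<noteq> x 0) \<and> C = range x)"

text \<open>The phase plane is the complex plane with two coordinates because the parameter is complex;
  for a real vector field the annulus is a subset of the invariant real plane.\<close>

definition period_annulus ::
    "(complex \<times> complex \<Rightarrow> complex \<times> complex) \<Rightarrow> (complex \<times> complex) set \<Rightarrow> bool" where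
  "period_annulus X A \<longleftrightarrow> (\<exists>\<C>. (\<forall>C\<in>\<C>. periodic_orbit X C) \<and> A = \<Union>\<C>) \<and>
     A homeomorphic (sphere 0 1 :: complex set) \<times> {0<..<1::real}"

text \<open>A cross-section \<open>\<sigma> ` of_real ` J\<close> of the annulus, parametrised by its real coordinate, together
  with an injective analytic extension \<open>\<sigma>\<close> of the parametrisation to a complex neighbourhood \<open>D\<close>
  of the interval \<open>J\<close>. The determinant condition is transversality.\<close>

definition cross_section :: "(complex \<times> complex \<Rightarrow> complex \<times> complex) \<Rightarrow> (complex \<times> complex) set
    \<Rightarrow> real set \<Rightarrow> complex set \<Rightarrow> (complex \<Rightarrow> complex \<times> complex) \<Rightarrow> bool" where
  "cross_section X A J D \<sigma> \<longleftrightarrow>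
     (\<exists>a b. a < b \<and> J = {a<..<b}) \<and> open D \<and> of_real ` J \<subseteq> D \<and> \<sigma> ` of_real ` J \<subseteq> A \<and>
     (\<lambda>h. fst (\<sigma> h)) holomorphic_on D \<and> (\<lambda>h. snd (\<sigma> h)) holomorphic_on D \<and> inj_on \<sigma> D \<and>
     (\<forall>h\<in>D. deriv (\<lambda>h. fst (\<sigma> h)) h * snd (X (\<sigma> h)) - deriv (\<lambda>h. snd (\<sigma> h)) h * fst (X (\<sigma> h)) \<noteq> 0)"

text \<open>The flow of \<open>X\<close> carries \<open>p\<close> to \<open>q\<close> in complex time \<open>\<tau>\<close>, along the segment from \<open>0\<close> to \<open>\<tau>\<close>
  (reparametrised by the unit interval). For real \<open>\<tau>\<close> this is the usual flow.\<close>

definition flows_to :: "(complex \<times> complex \<Rightarrow> complex \<times> complex) \<Rightarrow> complex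
    \<Rightarrow> complex \<times> complex \<Rightarrow> complex \<times> complex \<Rightarrow> bool" where
  "flows_to X \<tau> p q \<longleftrightarrow> (\<exists>x. x 0 = p \<and> x 1 = q \<and>
     (\<forall>u\<in>{0..1::real}. (x has_vector_derivative (\<tau> * fst (X (x u)), \<tau> * snd (X (x u))))
        (at u within {0..1})))"

definition first_return_time :: "(complex \<times> complex \<Rightarrow> complex \<times> complex) \<Rightarrow> (complex \<times> complex) set
    \<Rightarrow> complex \<times> complex \<Rightarrow> real \<Rightarrow> bool" where
  "first_return_time X \<Sigma> p T \<longleftrightarrow> T > 0 \<and> (\<exists>x. trajectory X x \<and> x 0 = p \<and> x T \<in> \<Sigma> \<and>
     (\<forall>t\<in>{0<..<T}. x t \<notin> \<Sigma>))"

text \<open>The first return map of the family \<open>X\<close> on \<open>\<Omega>\<close>: the flow for an analytic (complex) time \<open>\<tau>\<close>,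
  equal at \<open>(h\<^sub>0, \<mu>\<^sub>0)\<close> to the first return time of the periodic orbit through \<open>\<sigma> h\<^sub>0\<close>, carries the
  point with coordinate \<open>h\<close> to the point with coordinate \<open>P (h, \<mu>)\<close>. By transversality this
  determines \<open>P\<close> near \<open>(h\<^sub>0, \<mu>\<^sub>0)\<close>.\<close>

definition first_return_map :: "(complex^'n::finite \<Rightarrow> complex \<times> complex \<Rightarrow> complex \<times> complex)
    \<Rightarrow> real set \<Rightarrow> complex set \<Rightarrow> (complex \<Rightarrow> complex \<times> complex) \<Rightarrow> complex \<Rightarrow> complex^'n
    \<Rightarrow> (complex \<times> (complex^'n)) set \<Rightarrow> (complex \<times> (complex^'n) \<Rightarrow> complex) \<Rightarrow> bool" where
  "first_return_map X J D \<sigma> h\<^sub>0 \<mu>\<^sub>0 \<Omega> P \<longleftrightarrow> open \<Omega> \<and> (h\<^sub>0, \<mu>\<^sub>0) \<in> \<Omega> \<and> cdifferentiable_on pair_scale P \<Omega> \<and>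
     (\<exists>\<tau>. cdifferentiable_on pair_scale \<tau> \<Omega> \<and>
        (\<exists>T. first_return_time (X \<mu>\<^sub>0) (\<sigma> ` of_real ` J) (\<sigma> h\<^sub>0) T \<and> \<tau> (h\<^sub>0, \<mu>\<^sub>0) = of_real T) \<and>
        (\<forall>(h, \<mu>)\<in>\<Omega>. h \<in> D \<and> P (h, \<mu>) \<in> D \<and> flows_to (X \<mu>) (\<tau> (h, \<mu>)) (\<sigma> h) (\<sigma> (P (h, \<mu>)))))"

definition displacement :: "(complex \<times> 'p \<Rightarrow> complex) \<Rightarrow> complex \<times> 'p \<Rightarrow> complex" where
  "displacement P = (\<lambda>(h, \<mu>). P (h, \<mu>) - h)"


section \<open>Bautin ideal and bifurcation functions\<close>

definition displacement_coeff :: "(complex \<times> 'p \<Rightarrow> complex) \<Rightarrow> complex \<Rightarrow> nat \<Rightarrow> 'p \<Rightarrow> complex" where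
  "displacement_coeff F h\<^sub>0 k \<mu> = fps_nth (fps_expansion (\<lambda>h. F (h, \<mu>)) h\<^sub>0) k"

definition bautin_ideal :: "(complex \<times> (complex^'n::finite) \<Rightarrow> complex) \<Rightarrow> complex \<Rightarrow> complex^'n
    \<Rightarrow> (complex^'n) germ set" where
  "bautin_ideal F h\<^sub>0 \<mu> = germ_ideal (range (\<lambda>k. germ_at \<mu> (displacement_coeff F h\<^sub>0 k)))"

definition analytic_arc :: "complex^'n::finite \<Rightarrow> (complex \<Rightarrow> complex^'n) \<Rightarrow> bool" where
  "analytic_arc \<mu>\<^sub>0 c \<longleftrightarrow> (\<forall>i. (\<lambda>\<epsilon>. c \<epsilon> $ i) analytic_on {0}) \<and> c 0 = \<mu>\<^sub>0"

definition bifurcation_function :: "(complex \<times> 'p \<Rightarrow> complex) \<Rightarrow> complex \<Rightarrow> (complex \<Rightarrow> 'p)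
    \<Rightarrow> nat \<Rightarrow> (complex \<Rightarrow> complex) \<Rightarrow> bool" where
  "bifurcation_function F h\<^sub>0 c k M \<longleftrightarrow>
     M analytic_on {h\<^sub>0} \<and> \<not> (\<forall>\<^sub>F h in nhds h\<^sub>0. M h = 0) \<and>
     (\<exists>C. \<forall>\<^sub>F (h, \<epsilon>) in nhds (h\<^sub>0, 0). norm (F (h, c \<epsilon>) - \<epsilon> ^ k * M h) \<le> C * norm \<epsilon> ^ Suc k)"

definition bifurcation_germs :: "(complex \<times> (complex^'n::finite) \<Rightarrow> complex) \<Rightarrow> complex \<Rightarrow> complex^'n
    \<Rightarrow> complex germ set" where
  "bifurcation_germs F h\<^sub>0 \<mu>\<^sub>0 =
     {germ_at h\<^sub>0 M | c k M. analytic_arc \<mu>\<^sub>0 c \<and> bifurcation_function F h\<^sub>0 c k M}"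

text \<open>As in \<^const>\<open>projective_space\<close>, the class of a nonzero germ is the line it spans.\<close>

definition projectivized_bifurcation_germs ::
    "(complex \<times> (complex^'n::finite) \<Rightarrow> complex) \<Rightarrow> complex \<Rightarrow> complex^'n \<Rightarrow> complex germ set set" where
  "projectivized_bifurcation_germs F h\<^sub>0 \<mu>\<^sub>0 = (\<lambda>g. germ.span {g}) ` bifurcation_germs F h\<^sub>0 \<mu>\<^sub>0"

definition arc_coeff_vector :: "('m::finite \<Rightarrow> 'n::finite cpoly) \<Rightarrow> (complex \<Rightarrow> complex^'n) \<Rightarrow> nat
    \<Rightarrow> complex^'m" where
  "arc_coeff_vector v c r = (\<chi> j. fps_nth (fps_expansion (\<lambda>\<epsilon>. vpeval (v j) (c \<epsilon>)) 0) r)"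

end

theory Submission
  imports Defs
    "HOL-Computational_Algebra.Fundamental_Theorem_Algebra"
    "HOL-Computational_Algebra.Field_as_Ring"
    "HOL-Computational_Algebra.Polynomial_Factorial"
begin

text \<open>Near the parameter of the period annulus, the Taylor coefficients \<open>F\<^sub>k\<close> of the displacement function
  and the generators \<open>v\<^sub>j\<close> are linear combinations of each other with analytic coefficients. Along an
  arc, therefore, the lowest order terms of the \<open>F\<^sub>k\<close> and of the \<open>v\<^sub>j\<close> have the same order and determine
  each other linearly, through the values of these coefficients at the base point. This gives the
  linear isomorphism, provided that every point of the fibre is a limit of \<open>[v\<^sub>1 : \<dots> : v\<^sub>N]\<close> along an
  analytic arc.

  The latter is a curve selection statement: a point in the Zariski closure of an irreducible set is
  reached by an analytic curve that avoids a given hypersurface outside the point. It is proved by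
  induction on the number of coordinates. A generic linear projection along a coordinate is finite and
  separates the given point from the rest of its fibre, so curves in the image lift through Puiseux
  series of a minimal relation for the last coordinate. If the image is dense, the set is a
  hypersurface and Puiseux's theorem applies over a line.\<close>

section \<open>Families of polynomials with coefficients in an algebra of functions\<close>

text \<open>The leading coefficient of a minimal relation may vanish at the given point, where its
  roots then say nothing about the fibre. Over an affine space Gauss's lemma divides the leading
  coefficient out, so a Puiseux root can be started at the prescribed last coordinate. Over a
  smaller image, which need not be normal, this division can fail. There the root is chosen blindly,
  boundedness of the lift gives it a limit, and the projection is arranged beforehand so that only
  one limit is possible. The freedom for this arrangement comes from a second monic relation, which
  exists because the image is not dense. A second obstacle is that the hypersurface
  \<open>g = 0\<close> is not pulled back from the base. A norm-like multiple of \<open>g\<close>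
  that depends only on the base coordinates takes its place. Coordinate rings and their fraction
  fields are replaced by functions on a set: a domain becomes a set on which two functions that do
  not vanish identically have a common point of nonvanishing, and division in a fraction field
  becomes pseudo-division.\<close>

locale function_algebra =
  fixes R :: "('p \<Rightarrow> complex) set"
  assumes const [intro, simp]: "(\<lambda>x. c) \<in> R"
    and add [intro]: "f \<in> R \<Longrightarrow> g \<in> R \<Longrightarrow> (\<lambda>x. f x + g x) \<in> R"
    and mult [intro]: "f \<in> R \<Longrightarrow> g \<in> R \<Longrightarrow> (\<lambda>x. f x * g x) \<in> R"
begin

lemma uminus [intro]: "f \<in> R \<Longrightarrow> (\<lambda>x. - f x) \<in> R"
  using mult[of "\<lambda>x. -1" f] by simp

lemma diff [intro]: "f \<in> R \<Longrightarrow> g \<in> R \<Longrightarrow> (\<lambda>x. f x - g x) \<in> R"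
  using add[of f "\<lambda>x. - g x"] uminus[of g] by simp

lemma sum [intro]: "(\<And>i. i \<in> I \<Longrightarrow> f i \<in> R) \<Longrightarrow> (\<lambda>x. \<Sum>i\<in>I. f i x) \<in> R"
  by (induction I rule: infinite_finite_induct) auto

lemma power [intro]: "f \<in> R \<Longrightarrow> (\<lambda>x. f x ^ k) \<in> R"
  by (induction k) auto

text \<open>The number \<open>n\<close> is a formal degree: the coefficient of degree
  \<open>n\<close> may vanish at some or all parameters. Divisions and Newton polygons below work
  with formal degrees, uniformly in the parameter.\<close>

definition fam :: "nat \<Rightarrow> ('p \<Rightarrow> complex poly) set" where
  "fam n = {A. (\<forall>k. (\<lambda>x. coeff (A x) k) \<in> R) \<and> (\<forall>x. degree (A x) \<le> n)}"

lemma famI: "(\<And>k. (\<lambda>x. coeff (A x) k) \<in> R) \<Longrightarrow> (\<And>x. degree (A x) \<le> n) \<Longrightarrow> A \<in> fam n"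
  by (auto simp: fam_def)

lemma fam_coeff: "A \<in> fam n \<Longrightarrow> (\<lambda>x. coeff (A x) k) \<in> R"
  by (auto simp: fam_def)

lemma fam_degree: "A \<in> fam n \<Longrightarrow> degree (A x) \<le> n"
  by (auto simp: fam_def)

lemma fam_mono: "A \<in> fam n \<Longrightarrow> n \<le> m \<Longrightarrow> A \<in> fam m"
  by (auto simp: fam_def intro: order_trans)

lemma fam_pCons: "f \<in> R \<Longrightarrow> A \<in> fam n \<Longrightarrow> (\<lambda>x. pCons (f x) (A x)) \<in> fam (Suc n)"
  
proof (rule famI)
  fix k assume "f \<in> R" "A \<in> fam n"
  thus "(\<lambda>x. coeff (pCons (f x) (A x)) k) \<in> R"
    by (cases k) (auto intro: fam_coeff)
qed (auto simp: fam_def degree_pCons_eq_if)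

lemma fam_0 [simp]: "(\<lambda>x. 0) \<in> fam n"
  by (auto simp: fam_def)

lemma fam_const: "f \<in> R \<Longrightarrow> (\<lambda>x. [:f x:]) \<in> fam n"
  
proof (rule famI)
  fix k assume "f \<in> R"
  thus "(\<lambda>x. coeff [:f x:] k) \<in> R"
    by (cases k) auto
qed auto

lemma fam_linear: "f \<in> R \<Longrightarrow> g \<in> R \<Longrightarrow> (\<lambda>x. [:f x, g x:]) \<in> fam 1"
  using fam_pCons[OF _ fam_const, of f g 0] by simp

lemma fam_add: "A \<in> fam n \<Longrightarrow> B \<in> fam n \<Longrightarrow> (\<lambda>x. A x + B x) \<in> fam n"
  by (auto simp: fam_def intro: degree_add_le)

lemma fam_diff: "A \<in> fam n \<Longrightarrow> B \<in> fam n \<Longrightarrow> (\<lambda>x. A x - B x) \<in> fam n"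
  by (auto simp: fam_def intro: degree_diff_le)

lemma fam_smult: "f \<in> R \<Longrightarrow> A \<in> fam n \<Longrightarrow> (\<lambda>x. smult (f x) (A x)) \<in> fam n"
  by (auto simp: fam_def intro: order_trans[OF degree_smult_le])

lemma fam_sum: "(\<And>i. i \<in> I \<Longrightarrow> A i \<in> fam n) \<Longrightarrow> (\<lambda>x. \<Sum>i\<in>I. A i x) \<in> fam n"
  by (induction I rule: infinite_finite_induct) (auto intro: fam_add)

lemma fam_mult: "A \<in> fam n \<Longrightarrow> B \<in> fam m \<Longrightarrow> (\<lambda>x. A x * B x) \<in> fam (n + m)"
proof (rule famI)
  fix k assume "A \<in> fam n" "B \<in> fam m"
  thus "(\<lambda>x. coeff (A x * B x) k) \<in> R"
    unfolding coeff_mult by (intro sum mult fam_coeff)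
qed (auto intro: order_trans[OF degree_mult_le] add_mono fam_degree)

lemma fam_power: "A \<in> fam n \<Longrightarrow> (\<lambda>x. A x ^ k) \<in> fam (k * n)"
  by (induction k) (auto intro: fam_mult[simplified] fam_const[of "\<lambda>x. 1", simplified one_pCons[symmetric]])

lemma fam_monom: "f \<in> R \<Longrightarrow> (\<lambda>x. monom (f x) k) \<in> fam k"
  
proof (rule famI)
  fix i assume "f \<in> R"
  thus "(\<lambda>x. coeff (monom (f x) k) i) \<in> R"
    by (cases "i = k") (auto simp: coeff_monom)
qed (auto simp: degree_monom_le)

lemma poly_bounded_degree:
  fixes p :: "'a::comm_semiring_1 poly"
  assumes "degree p \<le> n"
  shows "poly p x = (\<Sum>i\<le>n. coeff p i * x ^ i)"
proof -
  have "(\<Sum>i\<le>n. coeff p i * x ^ i) = (\<Sum>i\<le>degree p. coeff p i * x ^ i)"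
    using assms by (intro sum.mono_neutral_right) (auto simp: coeff_eq_0)
  thus ?thesis by (simp add: poly_altdef)
qed

lemma fam_eval: "A \<in> fam n \<Longrightarrow> t \<in> R \<Longrightarrow> (\<lambda>x. poly (A x) (t x)) \<in> R"
  by (subst poly_bounded_degree[where n=n]) (auto intro!: sum mult power intro: fam_degree fam_coeff)

lemma pcompose_bounded_degree:
  fixes p q :: "complex poly"
  assumes "degree p \<le> n"
  shows "pcompose p q = (\<Sum>i\<le>n. smult (coeff p i) (q ^ i))"
proof -
  have "poly (pcompose p q) = poly (\<Sum>i\<le>n. smult (coeff p i) (q ^ i))"
    by (rule ext) (simp add: poly_pcompose poly_bounded_degree[OF assms] poly_sum)
  thus ?thesis using poly_eq_poly_eq_iff by blast
qed

lemma fam_pcompose: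
  assumes "A \<in> fam n" "B \<in> fam m"
  shows "(\<lambda>x. pcompose (A x) (B x)) \<in> fam (n * m)"
proof -
  have "(\<lambda>x. \<Sum>i\<le>n. smult (coeff (A x) i) (B x ^ i)) \<in> fam (n * m)"
  proof (intro fam_sum fam_smult fam_coeff[OF assms(1)])
    fix i assume "i \<in> {..n}"
    thus "(\<lambda>x. B x ^ i) \<in> fam (n * m)"
      by (intro fam_mono[OF fam_power[OF assms(2)]]) auto
  qed
  thus ?thesis by (simp add: pcompose_bounded_degree[OF fam_degree[OF assms(1)]])
qed

lemma fam_degree_drop:
  assumes "A \<in> fam n" "\<And>x. coeff (A x) n = 0" "0 < n"
  shows "A \<in> fam (n - 1)"
proof (rule famI)
  show "degree (A x) \<le> n - 1" for x
    by (rule degree_le) (metis assms fam_degree Suc_pred' coeff_eq_0 less_antisym linorder_neqE_nat not_less_eq order_le_less_trans)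
qed (use assms in \<open>auto intro: fam_coeff\<close>)

text \<open>The leading coefficient of \<open>E\<close> is in general not invertible in
  \<open>R\<close>, so a power of it multiplies the dividend. Each reduction step cancels the
  coefficient of formal degree \<open>n\<close> even at parameters where the leading coefficient of
  \<open>E\<close> is 0; hence one exponent \<open>r\<close> serves for all
  \<open>x\<close>.\<close>

lemma fam_pseudo_division:
  assumes E: "E \<in> fam k" "0 < k"
  shows "H \<in> fam n \<Longrightarrow> \<exists>r q S. q \<in> fam (n - k) \<and> S \<in> fam (k - 1) \<and>
           (\<forall>x. smult (coeff (E x) k ^ r) (H x) = E x * q x + S x)"
proof (induction n arbitrary: H rule: less_induct)
  case (less n)
  show ?case
  proof (cases "n < k")
    case True
    hence "H \<in> fam (k - 1)"
      using less.prems by (auto intro: fam_mono)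
    thus ?thesis
      by (intro exI[of _ 0] exI[of _ "\<lambda>x. 0"] exI[of _ H]) auto
  next
    case False
    define e where "e = (\<lambda>x. coeff (E x) k)"
    define h where "h = (\<lambda>x. coeff (H x) n)"
    have eh: "e \<in> R" "h \<in> R"
      unfolding e_def h_def using E less.prems by (auto intro: fam_coeff)
    define H' where "H' = (\<lambda>x. smult (e x) (H x) - monom (h x) (n - k) * E x)"
    have "H' \<in> fam n"
      unfolding H'_def using False
      by (intro fam_diff fam_smult eh less.prems fam_mono[OF fam_mult[OF fam_monom E(1)]]) (auto simp: eh)
    moreover have "coeff (H' x) n = 0" for x
      using False by (simp add: H'_def coeff_monom_mult e_def h_def)
    ultimately have "H' \<in> fam (n - 1)"
      using E False by (intro fam_degree_drop) auto
    from less.IH[OF _ this] obtain r q S where IH: "q \<in> fam (n - 1 - k)" "S \<in> fam (k - 1)"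
      "\<And>x. smult (e x ^ r) (H' x) = E x * q x + S x"
      using E False unfolding e_def by force
    define q' where "q' = (\<lambda>x. q x + monom (e x ^ r * h x) (n - k))"
    have "q' \<in> fam (n - k)"
      unfolding q'_def using eh by (intro fam_add fam_mono[OF IH(1)] fam_monom) auto
    moreover have "smult (e x ^ Suc r) (H x) = E x * q' x + S x" for x
    proof -
      have "smult (e x ^ Suc r) (H x) = smult (e x ^ r) (H' x) + smult (e x ^ r) (monom (h x) (n - k) * E x)"
        by (simp add: H'_def smult_diff_right mult.commute)
      also have "smult (e x ^ r) (monom (h x) (n - k) * E x) = E x * monom (e x ^ r * h x) (n - k)"
        by (metis mult.commute mult_smult_left smult_monom)
      finally show ?thesis by (simp add: IH(3) q'_def algebra_simps)
    qed
    ultimately show ?thesis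
      using IH(2) False unfolding e_def by blast
  qed
qed

end

section \<open>Puiseux series solutions\<close>

interpretation germs: function_algebra "{f. f analytic_on {0::complex}}"
  by unfold_locales (auto intro: analytic_intros)

section \<open>Functions analytic at the origin: ramification and order of vanishing\<close>

lemma analytic_compose_power:
  assumes "f analytic_on {0::complex}" "0 < q"
  shows "(\<lambda>\<eta>. f (\<eta> ^ q)) analytic_on {0}"
proof -
  have "(f \<circ> (\<lambda>\<eta>. \<eta> ^ q)) analytic_on {0}"
    using assms by (intro analytic_on_compose analytic_intros) (auto simp: zero_power)
  thus ?thesis by (simp add: o_def)
qed

lemma eventually_compose_power:
  assumes "\<forall>\<^sub>F \<epsilon> in nhds (0::complex). P \<epsilon>" "0 < q"
  shows "\<forall>\<^sub>F \<eta> in nhds 0. P (\<eta> ^ q)"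
proof -
  have "((\<lambda>\<eta>::complex. \<eta> ^ q) \<longlongrightarrow> 0) (nhds 0)"
    using assms(2) tendsto_power[OF filterlim_ident[of "nhds (0::complex)"], of q]
    by (simp add: zero_power)
  thus ?thesis
    using assms(1) by (auto simp: filterlim_iff)
qed

lemma analytic_ball_common:
  assumes "finite I" "\<And>i. i \<in> I \<Longrightarrow> f i analytic_on {0::complex}"
  obtains r where "0 < r" "\<And>i. i \<in> I \<Longrightarrow> f i holomorphic_on ball 0 r"
proof -
  have "\<exists>r>0. \<forall>i\<in>I. f i holomorphic_on ball 0 r"
    using assms
  proof (induction I)
    case empty
    show ?case by (auto intro: exI[of _ 1])
  next
    case (insert i I)
    then obtain r where r: "0 < r" "\<forall>i\<in>I. f i holomorphic_on ball 0 r"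
      by auto
    from insert.prems[of i] obtain s where s: "0 < s" "f i holomorphic_on ball 0 s"
      by (auto simp: analytic_at_ball)
    show ?case
      using r s by (intro exI[of _ "min r s"]) (auto intro: holomorphic_on_subset)
  qed
  thus ?thesis using that by blast
qed

lemma analytic_tendsto:
  "f analytic_on {0::complex} \<Longrightarrow> (f \<longlongrightarrow> f 0) (nhds 0)"
  using analytic_at_imp_isCont[of f 0] by (simp add: isCont_def tendsto_nhds_iff)

lemma analytic_order:
  assumes f: "f analytic_on {0::complex}" and nz: "\<not> (\<forall>\<^sub>F z in nhds 0. f z = 0)"
  obtains k g where "g analytic_on {0}" "g 0 \<noteq> 0" "\<forall>\<^sub>F z in nhds 0. f z = z ^ k * g z"
proof (cases "f 0 = 0")
  case False
  show ?thesis by (rule that[of f 0]) (use f False in auto)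
next
  case True
  obtain r where r: "0 < r" "f holomorphic_on ball 0 r"
    using f by (auto simp: analytic_at_ball)
  have nonconst: "\<not> f constant_on ball 0 r"
  proof
    assume "f constant_on ball 0 r"
    then obtain c where c: "\<And>z. z \<in> ball 0 r \<Longrightarrow> f z = c"
      by (auto simp: constant_on_def)
    with c[of 0] True r have "\<forall>z\<in>ball 0 r. f z = 0" by auto
    hence "\<forall>\<^sub>F z in nhds 0. f z = 0"
      using r by (auto simp: eventually_nhds intro!: exI[of _ "ball 0 r"])
    with nz show False ..
  qed
  have "0 \<in> ball (0::complex) r" using r by simp
  obtain g s n where g: "0 < n" "0 < s" "ball (0::complex) s \<subseteq> ball 0 r" "g holomorphic_on ball 0 s"
    "\<And>w. w \<in> ball 0 s \<Longrightarrow> f w = (w - 0) ^ n * g w" "\<And>w. w \<in> ball 0 s \<Longrightarrow> g w \<noteq> 0"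
    by (rule holomorphic_factor_zero_nonconstant[OF r(2) open_ball connected_ball \<open>0 \<in> _\<close> True nonconst]) blast
  show ?thesis
  proof (rule that)
    show "g analytic_on {0}"
      using g by (auto simp: analytic_at_ball)
    show "g 0 \<noteq> 0" using g by auto
    show "\<forall>\<^sub>F z in nhds 0. f z = z ^ n * g z"
      using g by (auto simp: eventually_nhds intro!: exI[of _ "ball 0 s"])
  qed
qed

section \<open>Simple roots of analytic families of polynomials\<close>

lemma fam_eval_tendsto:
  assumes "A \<in> germs.fam n"
  shows "((\<lambda>(\<epsilon>, T). poly (A \<epsilon>) T) \<longlongrightarrow> poly (A 0) T0) (nhds 0 \<times>\<^sub>F nhds T0)"
proof -
  have 1: "((\<lambda>p. coeff (A (fst p)) i * snd p ^ i) \<longlongrightarrow> coeff (A 0) i * T0 ^ i) (nhds 0 \<times>\<^sub>F nhds T0)" for i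
  proof (intro tendsto_intros)
    have "((\<lambda>\<epsilon>. coeff (A \<epsilon>) i) \<longlongrightarrow> coeff (A 0) i) (nhds 0)"
      using germs.fam_coeff[OF assms, of i] by (intro analytic_tendsto) auto
    thus "((\<lambda>p. coeff (A (fst p)) i) \<longlongrightarrow> coeff (A 0) i) (nhds 0 \<times>\<^sub>F nhds T0)"
      using filterlim_compose filterlim_fst by blast
    show "(snd \<longlongrightarrow> T0) (nhds 0 \<times>\<^sub>F nhds T0)"
      by (rule filterlim_snd)
  qed
  have "((\<lambda>p. \<Sum>i\<le>n. coeff (A (fst p)) i * snd p ^ i) \<longlongrightarrow> (\<Sum>i\<le>n. coeff (A 0) i * T0 ^ i)) (nhds 0 \<times>\<^sub>F nhds T0)"
    by (intro tendsto_sum 1)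
  thus ?thesis
    by (simp add: case_prod_unfold germs.poly_bounded_degree[OF germs.fam_degree[OF assms]])
qed

text \<open>The implicit function theorem at a simple root, by Banach's fixed point theorem on a
  disc that does not depend on \<epsilon>.\<close>

lemma implicit_root:
  assumes A: "A \<in> germs.fam n" and root: "coeff (A 0) 0 = 0" and simple: "coeff (A 0) 1 \<noteq> 0"
  obtains \<tau> where "\<tau> analytic_on {0}" "\<tau> 0 = 0" "\<forall>\<^sub>F \<epsilon> in nhds 0. poly (A \<epsilon>) (\<tau> \<epsilon>) = 0"
proof -
  define \<alpha> where "\<alpha> = coeff (A 0) 1"
  \<comment> \<open>Newton's map with the derivative frozen at its value \<alpha> at the origin. Its
    fixed points are the roots, and its derivative is small near the origin.\<close>
  define \<Phi> where "\<Phi> = (\<lambda>\<epsilon> T. T - poly (A \<epsilon>) T / \<alpha>)"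
  have "(\<lambda>\<epsilon>. pderiv (A \<epsilon>)) \<in> germs.fam n"
  proof (rule germs.famI)
    show "(\<lambda>\<epsilon>. coeff (pderiv (A \<epsilon>)) k) \<in> {f. f analytic_on {0}}" for k
      unfolding coeff_pderiv using germs.mult[OF germs.const germs.fam_coeff[OF A]] .
    show "degree (pderiv (A \<epsilon>)) \<le> n" for \<epsilon>
      using germs.fam_degree[OF A, of \<epsilon>] by (simp add: degree_pderiv)
  qed
  hence "((\<lambda>(\<epsilon>, T). poly (pderiv (A \<epsilon>)) T) \<longlongrightarrow> poly (pderiv (A 0)) 0) (nhds 0 \<times>\<^sub>F nhds 0)"
    by (rule fam_eval_tendsto)
  hence "((\<lambda>(\<epsilon>, T). poly (pderiv (A \<epsilon>)) T) \<longlongrightarrow> \<alpha>) (nhds 0 \<times>\<^sub>F nhds 0)"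
    by (simp add: poly_0_coeff_0 coeff_pderiv \<alpha>_def)
  hence "\<forall>\<^sub>F p in nhds 0 \<times>\<^sub>F nhds 0. dist (poly (pderiv (A (fst p))) (snd p)) \<alpha> < norm \<alpha> / 2"
    using tendstoD[of _ \<alpha> _ "norm \<alpha> / 2"] simple by (auto simp: case_prod_unfold \<alpha>_def)
  then obtain r1 \<rho>' where r1: "0 < r1" "0 < \<rho>'"
    "\<And>\<epsilon> T. norm \<epsilon> < r1 \<Longrightarrow> norm T < \<rho>' \<Longrightarrow> dist (poly (pderiv (A \<epsilon>)) T) \<alpha> < norm \<alpha> / 2"
    unfolding eventually_prod_filter eventually_nhds_metric by (auto simp: dist_norm)
  define \<rho> where "\<rho> = \<rho>' / 2"
  have \<rho>: "0 < \<rho>" "\<rho> < \<rho>'" using r1 by (auto simp: \<rho>_def)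
  \<comment> \<open>The bound to be obtained puts \<open>\<Phi> \<epsilon> 0\<close> within \<rho>/2
    of 0. Together with the contraction factor 1/2 this keeps the closed disc of radius \<rho>
    invariant.\<close>
  have "((\<lambda>\<epsilon>. coeff (A \<epsilon>) 0) \<longlongrightarrow> coeff (A 0) 0) (nhds 0)"
    using germs.fam_coeff[OF A, of 0] by (intro analytic_tendsto) auto
  hence "\<forall>\<^sub>F \<epsilon> in nhds 0. dist (coeff (A \<epsilon>) 0) 0 < norm \<alpha> * \<rho> / 2"
    using \<rho> simple by (intro tendstoD) (auto simp: root \<alpha>_def)
  then obtain r2 where r2: "0 < r2" "\<And>\<epsilon>. norm \<epsilon> < r2 \<Longrightarrow> norm (coeff (A \<epsilon>) 0) < norm \<alpha> * \<rho> / 2"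
    unfolding eventually_nhds_metric by (auto simp: dist_norm)
  obtain r3 where r3: "0 < r3" "\<And>i. i \<in> {..n} \<Longrightarrow> (\<lambda>\<epsilon>. coeff (A \<epsilon>) i) holomorphic_on ball 0 r3"
    using analytic_ball_common[of "{..n}" "\<lambda>i \<epsilon>. coeff (A \<epsilon>) i"] germs.fam_coeff[OF A] by auto
  define r where "r = min r1 (min r2 r3)"
  have r: "0 < r" "r \<le> r1" "r \<le> r2" "r \<le> r3" using r1 r2 r3 by (auto simp: r_def)
  have \<alpha>: "\<alpha> \<noteq> 0" using simple by (simp add: \<alpha>_def)
  have deriv: "(\<Phi> \<epsilon> has_field_derivative (1 - poly (pderiv (A \<epsilon>)) T / \<alpha>)) (at T within S)" for \<epsilon> T S
    unfolding \<Phi>_def using \<alpha> by (auto intro!: derivative_eq_intros)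
  have contr: "norm (\<Phi> \<epsilon> T - \<Phi> \<epsilon> S) \<le> 1 / 2 * norm (T - S)"
    if "norm \<epsilon> < r" "T \<in> cball 0 \<rho>" "S \<in> cball 0 \<rho>" for \<epsilon> T S
  proof (rule field_differentiable_bound[of "cball (0::complex) \<rho>"])
    fix Z :: complex assume Z: "Z \<in> cball 0 \<rho>"
    show "(\<Phi> \<epsilon> has_field_derivative (1 - poly (pderiv (A \<epsilon>)) Z / \<alpha>)) (at Z within cball 0 \<rho>)"
      by (rule deriv)
    have "norm (\<alpha> - poly (pderiv (A \<epsilon>)) Z) < norm \<alpha> / 2"
      using r1(3)[of \<epsilon> Z] that r Z \<rho> by (auto simp: dist_norm norm_minus_commute)
    moreover have "norm (1 - poly (pderiv (A \<epsilon>)) Z / \<alpha>) = norm (\<alpha> - poly (pderiv (A \<epsilon>)) Z) / norm \<alpha>"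
      using \<alpha> by (simp add: norm_divide[symmetric] diff_divide_distrib)
    moreover have "0 < norm \<alpha>" using \<alpha> by simp
    ultimately show "norm (1 - poly (pderiv (A \<epsilon>)) Z / \<alpha>) \<le> 1 / 2"
      by (simp only: pos_divide_le_eq)
  qed (use that in auto)
  have maps: "\<Phi> \<epsilon> T \<in> cball 0 \<rho>" if "norm \<epsilon> < r" "T \<in> cball 0 \<rho>" for \<epsilon> T
  proof -
    have "norm (\<Phi> \<epsilon> 0) \<le> \<rho> / 2"
      using r2(2)[of \<epsilon>] that r \<alpha> by (simp add: \<Phi>_def poly_0_coeff_0 norm_divide field_simps)
    moreover have "norm (\<Phi> \<epsilon> T - \<Phi> \<epsilon> 0) \<le> 1 / 2 * norm (T - 0)"
      using that \<rho> by (intro contr) auto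
    moreover have "norm (\<Phi> \<epsilon> T) \<le> norm (\<Phi> \<epsilon> T - \<Phi> \<epsilon> 0) + norm (\<Phi> \<epsilon> 0)"
      by (metis diff_add_cancel norm_triangle_ineq)
    ultimately show ?thesis using that by auto
  qed
  have "\<exists>\<tau>. \<tau> \<in> cball 0 \<rho> \<and> \<Phi> \<epsilon> \<tau> = \<tau>" if "norm \<epsilon> < r" for \<epsilon>
    proof -
    have "\<exists>!\<tau>\<in>cball 0 \<rho>. \<Phi> \<epsilon> \<tau> = \<tau>"
    proof (rule Banach_fix[where c = "1/2"])
      show "complete (cball (0::complex) \<rho>)"
        by (simp add: complete_eq_closed)
    qed (use contr[OF that] maps[OF that] \<rho> in \<open>auto simp: dist_norm\<close>)
    thus ?thesis by blast
  qed
  then obtain \<tau> where \<tau>: "\<And>\<epsilon>. norm \<epsilon> < r \<Longrightarrow> \<tau> \<epsilon> \<in> cball 0 \<rho> \<and> \<Phi> \<epsilon> (\<tau> \<epsilon>) = \<tau> \<epsilon>"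
    by metis
  \<comment> \<open>The fixed points are found separately for each \<epsilon>. Analyticity comes
    from the iterates, which are holomorphic in \<epsilon> and converge at a geometric rate that
    does not depend on \<epsilon>.\<close>
  define T where "T = (\<lambda>j \<epsilon>. (\<Phi> \<epsilon> ^^ j) 0)"
  have T_Suc: "T (Suc j) = (\<lambda>\<epsilon>. \<Phi> \<epsilon> (T j \<epsilon>))" and T_0: "T 0 = (\<lambda>_. 0)" for j
    by (auto simp: T_def)
  have T_cball: "T j \<epsilon> \<in> cball 0 \<rho>" if "norm \<epsilon> < r" for j \<epsilon>
    using maps[OF that] \<rho> by (induction j) (auto simp: T_Suc T_0)
  have T_dist: "norm (T j \<epsilon> - \<tau> \<epsilon>) \<le> (1 / 2) ^ j * \<rho>" if "norm \<epsilon> < r" for j \<epsilon>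
  proof (induction j)
    case 0
    show ?case using \<tau>[OF that] by (auto simp: T_0)
  next
    case (Suc j)
    have "norm (T (Suc j) \<epsilon> - \<tau> \<epsilon>) = norm (\<Phi> \<epsilon> (T j \<epsilon>) - \<Phi> \<epsilon> (\<tau> \<epsilon>))"
      using \<tau>[OF that] by (simp add: T_Suc)
    also have "\<dots> \<le> 1 / 2 * norm (T j \<epsilon> - \<tau> \<epsilon>)"
      using \<tau>[OF that] T_cball[OF that] by (intro contr that) auto
    finally show ?case using Suc by simp
  qed
  have T_holo: "T j holomorphic_on ball 0 r" for j
  proof (induction j)
    case (Suc j)
    have "(\<lambda>\<epsilon>. \<Sum>i\<le>n. coeff (A \<epsilon>) i * T j \<epsilon> ^ i) holomorphic_on ball 0 r"
      using r by (intro holomorphic_intros Suc holomorphic_on_subset[OF r3(2)]) auto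
    hence "(\<lambda>\<epsilon>. poly (A \<epsilon>) (T j \<epsilon>)) holomorphic_on ball 0 r"
      by (simp add: germs.poly_bounded_degree[OF germs.fam_degree[OF A]])
    thus ?case
      unfolding T_Suc \<Phi>_def using Suc \<alpha> by (intro holomorphic_intros) auto
  qed (auto simp: T_0)
  have "\<tau> holomorphic_on ball 0 r"
  proof (rule holomorphic_uniform_sequence[OF open_ball T_holo])
    fix x :: complex assume "x \<in> ball 0 r"
    then obtain d where d: "0 < d" "cball x d \<subseteq> ball 0 r"
      using open_contains_cball open_ball by blast
    have "uniform_limit (cball x d) T \<tau> sequentially"
    proof (rule uniform_limitI)
      fix e :: real assume "0 < e"
      have "(\<lambda>j. (1 / 2) ^ j * \<rho>) \<longlonglongrightarrow> 0"
        by (intro tendsto_mult_left_zero LIMSEQ_power_zero) auto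
      hence "\<forall>\<^sub>F j in sequentially. (1 / 2) ^ j * \<rho> < e"
        using \<open>0 < e\<close> by (rule order_tendstoD)
      thus "\<forall>\<^sub>F j in sequentially. \<forall>y\<in>cball x d. dist (T j y) (\<tau> y) < e"
        using d by (elim eventually_mono) (fastforce simp: dist_norm intro: order_le_less_trans[OF T_dist])
    qed
    with d show "\<exists>d>0. cball x d \<subseteq> ball 0 r \<and> uniform_limit (cball x d) T \<tau> sequentially"
      by blast
  qed
  moreover have "poly (A \<epsilon>) (\<tau> \<epsilon>) = 0" if "norm \<epsilon> < r" for \<epsilon>
    using \<tau>[OF that] \<alpha> by (simp add: \<Phi>_def)
  moreover have "\<tau> 0 = 0"
  proof -
    have "norm (\<Phi> 0 (\<tau> 0) - \<Phi> 0 0) \<le> 1 / 2 * norm (\<tau> 0 - 0)"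
      using r \<tau>[of 0] \<rho> by (intro contr) auto
    moreover have "\<Phi> 0 0 = 0" using root by (simp add: \<Phi>_def poly_0_coeff_0)
    ultimately show ?thesis using \<tau>[of 0] r by simp
  qed
  ultimately show ?thesis
    using r by (intro that[of \<tau>]) (auto simp: analytic_at_ball eventually_nhds_metric dist_norm)
qed


section \<open>Newton polygons and Puiseux's theorem\<close>

lemma coeff_pcompose_shift_order:
  fixes p :: "complex poly"
  assumes "p \<noteq> 0"
  shows "k < order a p \<Longrightarrow> coeff (pcompose p [:a, 1:]) k = 0"
    and "coeff (pcompose p [:a, 1:]) (order a p) \<noteq> 0"
proof -
  obtain q where q: "p = [:- a, 1:] ^ order a p * q" "\<not> [:- a, 1:] dvd q"
    using order_decomp[OF assms] by blast
  define m where "m = order a p"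
  have "pcompose p [:a, 1:] = pcompose ([:- a, 1:] ^ m) [:a, 1:] * pcompose q [:a, 1:]"
    by (subst q(1)) (simp add: pcompose_mult m_def)
  also have "pcompose ([:- a, 1:] ^ m) [:a, 1:] = monom 1 m"
  proof -
    have "pcompose [:- a, 1:] [:a, 1:] = [:0, 1:]"
      by (simp add: pcompose_pCons)
    moreover have "pcompose (p ^ k) [:a, 1:] = pcompose p [:a, 1:] ^ k" for k and p :: "complex poly"
      by (induction k) (simp_all add: pcompose_mult pcompose_1)
    ultimately show ?thesis by (simp add: monom_altdef)
  qed
  finally have eq: "pcompose p [:a, 1:] = monom 1 m * pcompose q [:a, 1:]" .
  show "k < order a p \<Longrightarrow> coeff (pcompose p [:a, 1:]) k = 0"
    by (simp add: eq coeff_monom_mult m_def)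
  have "poly q a \<noteq> 0" using q(2) by (simp add: poly_eq_0_iff_dvd)
  thus "coeff (pcompose p [:a, 1:]) (order a p) \<noteq> 0"
    by (simp add: eq coeff_monom_mult m_def poly_0_coeff_0[symmetric] poly_pcompose)
qed

text \<open>A root \<open>a\<close> of full multiplicity n makes \<open>p\<close> a constant
  multiple of (T - a)^n. Its coefficient of degree n - 1 is proportional to \<open>a\<close>, so
  \<open>a = 0\<close> and all lower coefficients vanish. This strict drop of the multiplicity makes
  the Puiseux recursion terminate.\<close>

lemma order_less_degree:
  fixes p :: "complex poly"
  assumes "0 < degree p" "coeff p (degree p - 1) = 0" "k < degree p" "coeff p k \<noteq> 0"
  shows "order a p < degree p"
proof (rule ccontr)
  assume "\<not> order a p < degree p"
  moreover have "p \<noteq> 0" using assms by auto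
  ultimately have m: "order a p = degree p"
    using order_degree[of p a] by auto
  obtain q where q: "p = [:- a, 1:] ^ degree p * q"
    using order_1[of a p] unfolding m by (auto elim: dvdE)
  have "q \<noteq> 0" using q \<open>p \<noteq> 0\<close> by auto
  have "degree p = degree ([:- a, 1:] ^ degree p) + degree q"
    using \<open>q \<noteq> 0\<close> by (subst q, subst degree_mult_eq) auto
  hence "degree q = 0" by (simp add: degree_linear_power)
  then obtain c where c: "q = [:c:]" by (auto elim: degree_eq_zeroE)
  have "c \<noteq> 0" using \<open>q \<noteq> 0\<close> c by auto
  have p: "p = smult c ([:- a, 1:] ^ degree p)" by (subst q) (simp add: c)
  have co: "coeff p i = c * (of_nat (degree p choose i) * (- a) ^ (degree p - i))" if "i \<le> degree p" for i
    by (subst p) (simp add: coeff_linear_poly_power that)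
  have "a = 0"
    using co[of "degree p - 1"] assms(1,2) \<open>c \<noteq> 0\<close>
    by (simp add: binomial_symmetric[symmetric])
  thus False
    using co[of k] assms by simp
qed

text \<open>With v i the order of the coefficient of degree i, the substitution \<epsilon> =
  \<eta>^q, T = \<eta>^r T' turns it into order q v i + r i. For i < m this is at least r m when r/q
  is at most v i / (m - i). The least such slope is taken, so a coefficient of index
  \<open>k\<close> survives at \<eta> = 0.\<close>

lemma newton_polygon:
  assumes B: "B \<in> germs.fam n" and m: "0 < m" "m \<le> n"
    and low: "\<And>k. k < m \<Longrightarrow> coeff (B 0) k = 0" and top: "coeff (B 0) m \<noteq> 0"
    and nz: "j < m" "\<not> (\<forall>\<^sub>F \<epsilon> in nhds 0. coeff (B \<epsilon>) j = 0)"
  obtains q r C k where "0 < q" "0 < r" "C \<in> germs.fam n" "degree (C 0) = m"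
    "\<forall>\<^sub>F \<eta> in nhds 0. \<forall>T. poly (B (\<eta> ^ q)) (\<eta> ^ r * T) = \<eta> ^ (r * m) * poly (C \<eta>) T"
    "\<And>i. i < m \<Longrightarrow> (\<forall>\<^sub>F \<epsilon> in nhds 0. coeff (B \<epsilon>) i = 0) \<Longrightarrow> coeff (C 0) i = 0"
    "k < m" "coeff (C 0) k \<noteq> 0"
proof -
  define I where "I = {k. k < m \<and> \<not> (\<forall>\<^sub>F \<epsilon> in nhds 0. coeff (B \<epsilon>) k = 0)}"
  have analytic: "(\<lambda>\<epsilon>. coeff (B \<epsilon>) k) analytic_on {0}" for k
    using germs.fam_coeff[OF B, of k] by simp
  have "\<exists>v g. k \<in> I \<longrightarrow> g analytic_on {0} \<and> g 0 \<noteq> 0 \<and> (\<forall>\<^sub>F \<epsilon> in nhds 0. coeff (B \<epsilon>) k = \<epsilon> ^ v * g \<epsilon>)" for k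
    using analytic_order[OF analytic[of k]] unfolding I_def by blast
  then obtain v g where vg: "\<And>k. k \<in> I \<Longrightarrow> g k analytic_on {0}" "\<And>k. k \<in> I \<Longrightarrow> g k 0 \<noteq> 0"
    "\<And>k. k \<in> I \<Longrightarrow> \<forall>\<^sub>F \<epsilon> in nhds 0. coeff (B \<epsilon>) k = \<epsilon> ^ v k * g k \<epsilon>"
    by metis
  \<comment> \<open>Positive orders make \<open>r\<close> positive. This kills the coefficients of
    degree above \<open>m\<close> at \<eta> = 0, so that \<open>C 0\<close> has degree exactly
    \<open>m\<close>.\<close>
  have v_pos: "0 < v k" if "k \<in> I" for k
  proof (rule ccontr)
    assume "\<not> 0 < v k"
    hence "coeff (B 0) k = g k 0"
      using eventually_nhds_x_imp_x[OF vg(3)[OF that]] by simp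
    with vg(2)[OF that] low[of k] that show False by (auto simp: I_def)
  qed
  have "finite I" "I \<noteq> {}" using nz by (auto simp: I_def)
  then obtain k where k: "k \<in> I" "\<And>i. i \<in> I \<Longrightarrow> real (v k) / real (m - k) \<le> real (v i) / real (m - i)"
    using arg_min_if_finite[of I "\<lambda>k. real (v k) / real (m - k)"] by (meson not_less)
  define q where "q = m - k"
  define r where "r = v k"
  have km: "k < m" using k by (auto simp: I_def)
  have q: "0 < q" and r: "0 < r" using km v_pos[OF k(1)] by (auto simp: q_def r_def)
  have le: "r * (m - i) \<le> v i * q" if "i \<in> I" for i
  proof -
    have "i < m" using that by (auto simp: I_def)
    hence "real (v k) * real (m - i) \<le> real (v i) * real (m - k)"
      using k(2)[OF that] km by (simp add: field_simps of_nat_diff)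
    hence "real (v k * (m - i)) \<le> real (v i * (m - k))"
      by simp
    thus ?thesis unfolding q_def r_def of_nat_le_iff .
  qed
  \<comment> \<open>The truncated subtraction in the exponent is exact by \<open>le\<close>. A
    coefficient below \<open>m\<close> that vanishes near 0 has no order and is replaced by
    0.\<close>
  define c where "c = (\<lambda>i \<eta>. if i < m then if i \<in> I then \<eta> ^ (v i * q - r * (m - i)) * g i (\<eta> ^ q) else 0
                    else \<eta> ^ (r * (i - m)) * coeff (B (\<eta> ^ q)) i)"
  have c: "c i analytic_on {0}" for i
    unfolding c_def using analytic_compose_power[OF vg(1) q] analytic_compose_power[OF analytic q]
    by (cases "i < m"; cases "i \<in> I") (auto intro!: analytic_intros)
  define C where "C = (\<lambda>\<eta>. \<Sum>i\<le>n. monom (c i \<eta>) i)"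
  have C: "C \<in> germs.fam n"
    unfolding C_def using c by (intro germs.fam_sum germs.fam_mono[OF germs.fam_monom]) auto
  have coeff_C: "coeff (C \<eta>) i = (if i \<le> n then c i \<eta> else 0)" for i \<eta>
    by (simp add: C_def coeff_sum coeff_monom)
  have scale: "\<forall>\<^sub>F \<eta> in nhds 0. coeff (B (\<eta> ^ q)) i * \<eta> ^ (r * i) = \<eta> ^ (r * m) * c i \<eta>" for i
  proof (cases "i < m")
    case True
    show ?thesis
    proof (cases "i \<in> I")
      case True
      have "r * m + (v i * q - r * (m - i)) = q * v i + r * i"
        using le[OF True] \<open>i < m\<close> by (simp add: diff_mult_distrib2 mult.commute)
      hence "\<eta> ^ (r * m) * (\<eta> ^ (v i * q - r * (m - i)) * g i (\<eta> ^ q)) = (\<eta> ^ q) ^ v i * g i (\<eta> ^ q) * \<eta> ^ (r * i)" for \<eta>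
        by (metis (no_types, lifting) mult.assoc mult.commute power_add power_mult)
      note eq = this
      show ?thesis
        using eventually_compose_power[OF vg(3)[OF True] q]
        by (rule eventually_mono) (use \<open>i < m\<close> True in \<open>simp only: c_def if_True eq\<close>)
    next
      case False
      with \<open>i < m\<close> have "\<forall>\<^sub>F \<epsilon> in nhds 0. coeff (B \<epsilon>) i = 0" by (auto simp: I_def)
      from eventually_compose_power[OF this q] show ?thesis
        using False \<open>i < m\<close> by (auto simp: c_def elim!: eventually_mono)
    qed
  next
    case False
    hence "r * i = r * m + r * (i - m)" by (simp add: diff_mult_distrib2)
    with False show ?thesis by (simp add: c_def power_add)
  qed
  show ?thesis
  proof (rule that[OF q r C])
    have c0: "c i 0 = 0" if "m < i" for i
      using that r by (simp add: c_def zero_power)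
    have cm: "c m 0 = coeff (B 0) m"
      using q by (simp add: c_def zero_power)
    show "degree (C 0) = m"
      using c0 cm top m by (intro antisym degree_le le_degree) (auto simp: coeff_C)
    have "\<forall>\<^sub>F \<eta> in nhds 0. \<forall>i\<in>{..n}. coeff (B (\<eta> ^ q)) i * \<eta> ^ (r * i) = \<eta> ^ (r * m) * c i \<eta>"
      using scale by (intro eventually_ball_finite) auto
    thus "\<forall>\<^sub>F \<eta> in nhds 0. \<forall>T. poly (B (\<eta> ^ q)) (\<eta> ^ r * T) = \<eta> ^ (r * m) * poly (C \<eta>) T"
    proof (rule eventually_mono, intro allI)
      fix \<eta> T assume *: "\<forall>i\<in>{..n}. coeff (B (\<eta> ^ q)) i * \<eta> ^ (r * i) = \<eta> ^ (r * m) * c i \<eta>"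
      have "poly (B (\<eta> ^ q)) (\<eta> ^ r * T) = (\<Sum>i\<le>n. (coeff (B (\<eta> ^ q)) i * \<eta> ^ (r * i)) * T ^ i)"
        by (subst germs.poly_bounded_degree[OF germs.fam_degree[OF B]])
           (simp add: power_mult_distrib power_mult mult.assoc)
      also have "\<dots> = (\<Sum>i\<le>n. \<eta> ^ (r * m) * c i \<eta> * T ^ i)"
        using * by (intro sum.cong) auto
      also have "\<dots> = \<eta> ^ (r * m) * poly (C \<eta>) T"
        by (subst germs.poly_bounded_degree[OF germs.fam_degree[OF C]])
           (simp add: coeff_C sum_distrib_left mult.assoc)
      finally show "poly (B (\<eta> ^ q)) (\<eta> ^ r * T) = \<eta> ^ (r * m) * poly (C \<eta>) T" .
    qed
    show "coeff (C 0) i = 0" if "i < m" "\<forall>\<^sub>F \<epsilon> in nhds 0. coeff (B \<epsilon>) i = 0" for i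
      using that by (auto simp: coeff_C c_def I_def)
    show "k < m" by (rule km)
    have "v k * q - r * (m - k) = 0" by (simp add: q_def r_def)
    thus "coeff (C 0) k \<noteq> 0"
      using km m k(1) vg(2) q by (simp add: coeff_C c_def zero_power)
  qed
qed

text \<open>Shifting by an analytic root of the derivative of order \<open>m - 1\<close>, where \<open>m\<close> is the multiplicity
  of the root \<open>a\<close>, removes the coefficient of degree \<open>m - 1\<close>. Hence after rescaling along an
  edge of the Newton polygon all roots have multiplicity less than \<open>m\<close>.\<close>

theorem puiseux_root:
  assumes "A \<in> germs.fam n" "A 0 \<noteq> 0" "poly (A 0) a = 0"
  shows "\<exists>q \<tau>. 0 < q \<and> \<tau> analytic_on {0} \<and> \<tau> 0 = a \<and> (\<forall>\<^sub>F \<epsilon> in nhds 0. poly (A (\<epsilon> ^ q)) (\<tau> \<epsilon>) = 0)"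
  using assms
proof (induction "order a (A 0)" arbitrary: A a n rule: less_induct)
  case less
  define m where "m = order a (A 0)"
  have m: "0 < m" using less.prems by (simp add: m_def order_root)
  define A' where "A' = (\<lambda>\<epsilon>. pcompose (A \<epsilon>) [:a, 1:])"
  have A': "A' \<in> germs.fam n"
    unfolding A'_def
    using germs.fam_pcompose[OF less.prems(1) germs.fam_linear[of "\<lambda>_. a" "\<lambda>_. 1"]] by simp
  have A'_low: "coeff (A' 0) k = 0" if "k < m" for k
    using coeff_pcompose_shift_order(1)[OF less.prems(2)] that by (simp add: A'_def m_def)
  have A'_top: "coeff (A' 0) m \<noteq> 0"
    using coeff_pcompose_shift_order(2)[OF less.prems(2)] by (simp add: A'_def m_def)
  have "m \<le> n"
    using A'_top germs.fam_degree[OF A', of 0] le_degree[of "A' 0" m] by linarith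
  \<comment> \<open>Since \<open>A' 0\<close> has a zero of order exactly \<open>m\<close> at 0, its
    derivative of order \<open>m - 1\<close> has a simple one. The shift \<beta> is therefore
    analytic in \<epsilon> itself, without ramification.\<close>
  define G where "G = (\<lambda>\<epsilon>. (pderiv ^^ (m - 1)) (A' \<epsilon>))"
  have coeff_G: "coeff (G \<epsilon>) k = pochhammer (of_nat (Suc k)) (m - 1) * coeff (A' \<epsilon>) (k + (m - 1))" for \<epsilon> k
    unfolding G_def by (simp add: coeff_higher_pderiv)
  have "G \<in> germs.fam n"
  proof (rule germs.famI)
    show "(\<lambda>\<epsilon>. coeff (G \<epsilon>) k) \<in> {f. f analytic_on {0}}" for k
      unfolding coeff_G by (intro germs.mult germs.const germs.fam_coeff[OF A'])
    show "degree (G \<epsilon>) \<le> n" for \<epsilon>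
      using germs.fam_degree[OF A', of \<epsilon>] unfolding G_def by (simp add: degree_higher_pderiv)
  qed
  moreover have "coeff (G 0) 0 = 0"
    using A'_low[of "m - 1"] m by (simp add: coeff_G)
  moreover have "coeff (G 0) 1 \<noteq> 0"
  proof -
    have "pochhammer (of_nat (Suc 1) :: complex) (m - 1) \<noteq> 0"
      unfolding pochhammer_of_nat of_nat_eq_0_iff using pochhammer_pos[of "Suc 1" "m - 1"] by linarith
    thus ?thesis using A'_top m by (simp add: coeff_G)
  qed
  ultimately obtain \<beta> where \<beta>: "\<beta> analytic_on {0}" "\<beta> 0 = 0" "\<forall>\<^sub>F \<epsilon> in nhds 0. poly (G \<epsilon>) (\<beta> \<epsilon>) = 0"
    using implicit_root by metis
  define B where "B = (\<lambda>\<epsilon>. pcompose (A' \<epsilon>) [:\<beta> \<epsilon>, 1:])"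
  have B: "B \<in> germs.fam n"
    unfolding B_def
    using germs.fam_pcompose[OF A' germs.fam_linear[of \<beta> "\<lambda>_. 1"]] \<beta> by simp
  have B0: "B 0 = A' 0" by (simp add: B_def \<beta> pcompose_idR[unfolded one_pCons[symmetric]] pcompose_pCons)
  have poly_B: "poly (B \<epsilon>) T = poly (A \<epsilon>) (a + (\<beta> \<epsilon> + T))" for \<epsilon> T
    by (simp add: B_def A'_def poly_pcompose)
  have B_sub: "\<forall>\<^sub>F \<epsilon> in nhds 0. coeff (B \<epsilon>) (m - 1) = 0"
    using \<beta>(3)
  proof (rule eventually_mono)
    fix \<epsilon> assume "poly (G \<epsilon>) (\<beta> \<epsilon>) = 0"
    have "(pderiv ^^ k) (pcompose p [:b, 1:]) = pcompose ((pderiv ^^ k) p) [:b, 1:]" for k b and p :: "complex poly"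
      by (induction k) (simp_all add: pderiv_pcompose pderiv_pCons)
    hence "poly ((pderiv ^^ (m - 1)) (B \<epsilon>)) 0 = poly (G \<epsilon>) (\<beta> \<epsilon>)"
      by (simp add: B_def G_def poly_pcompose)
    hence "pochhammer 1 (m - 1) * coeff (B \<epsilon>) (m - 1) = 0"
      using \<open>poly (G \<epsilon>) (\<beta> \<epsilon>) = 0\<close> by (simp add: poly_0_coeff_0 coeff_higher_pderiv)
    thus "coeff (B \<epsilon>) (m - 1) = 0" by (simp add: pochhammer_fact[symmetric])
  qed
  show ?case
  proof (cases "\<forall>\<^sub>F \<epsilon> in nhds 0. coeff (B \<epsilon>) 0 = 0")
    case True
    hence "\<forall>\<^sub>F \<epsilon> in nhds 0. poly (A (\<epsilon> ^ 1)) (a + \<beta> \<epsilon>) = 0"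
      by (rule eventually_mono) (use poly_B[of _ 0] in \<open>simp add: poly_0_coeff_0\<close>)
    with \<beta> show ?thesis
      by (intro exI[of _ 1] exI[of _ "\<lambda>\<epsilon>. a + \<beta> \<epsilon>"]) (auto intro!: analytic_intros)
  next
    case False
    \<comment> \<open>The constant coefficient does not vanish identically and so supplies index 0
      for the Newton polygon. If it did, \<open>a + \<beta>\<close> would already be a root.\<close>
    obtain q r C k where C: "0 < q" "0 < r" "C \<in> germs.fam n" "degree (C 0) = m"
      "\<forall>\<^sub>F \<eta> in nhds 0. \<forall>T. poly (B (\<eta> ^ q)) (\<eta> ^ r * T) = \<eta> ^ (r * m) * poly (C \<eta>) T"
      "\<And>i. i < m \<Longrightarrow> (\<forall>\<^sub>F \<epsilon> in nhds 0. coeff (B \<epsilon>) i = 0) \<Longrightarrow> coeff (C 0) i = 0"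
      "k < m" "coeff (C 0) k \<noteq> 0"
      using newton_polygon[OF B m \<open>m \<le> n\<close> _ _ m False] A'_low A'_top unfolding B0 by blast
    have "coeff (C 0) (m - 1) = 0" using C(6) B_sub m by simp
    obtain b where b: "poly (C 0) b = 0"
      using C(4) m Fundamental_Theorem_Algebra.fundamental_theorem_of_algebra[of "C 0"] by (auto simp: constant_degree)
    have "order b (C 0) < order a (A 0)"
      using order_less_degree[of "C 0" k b] C(4,7,8) m \<open>coeff (C 0) (m - 1) = 0\<close> by (simp add: m_def)
    moreover have "C 0 \<noteq> 0" using C(8) by auto
    ultimately obtain s \<tau> where \<tau>: "0 < s" "\<tau> analytic_on {0}" "\<tau> 0 = b"
      "\<forall>\<^sub>F \<epsilon> in nhds 0. poly (C (\<epsilon> ^ s)) (\<tau> \<epsilon>) = 0"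
      using less.hyps[OF _ C(3) _ b] by blast
    \<comment> \<open>This undoes the substitutions from the inside out: the recursive root lives
      over \<eta> = \<epsilon>^s, is rescaled by \<eta>^r, and the shift is evaluated at
      \<eta>^q.\<close>
    define \<tau>' where "\<tau>' = (\<lambda>\<epsilon>. a + (\<beta> (\<epsilon> ^ (s * q)) + (\<epsilon> ^ s) ^ r * \<tau> \<epsilon>))"
    have "\<tau>' analytic_on {0}"
      unfolding \<tau>'_def using \<beta> \<tau> C(1) by (auto intro!: analytic_intros analytic_compose_power)
    moreover have "\<tau>' 0 = a"
      using C(1,2) \<tau>(1) by (simp add: \<tau>'_def zero_power \<beta>)
    moreover have "\<forall>\<^sub>F \<epsilon> in nhds 0. poly (A (\<epsilon> ^ (s * q))) (\<tau>' \<epsilon>) = 0"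
      using eventually_compose_power[OF C(5) \<tau>(1)] \<tau>(4)
    proof eventually_elim
      case (elim \<epsilon>)
      have "poly (A (\<epsilon> ^ (s * q))) (\<tau>' \<epsilon>) = poly (B ((\<epsilon> ^ s) ^ q)) ((\<epsilon> ^ s) ^ r * \<tau> \<epsilon>)"
        by (simp add: poly_B \<tau>'_def power_mult)
      with elim show ?case by simp
    qed
    ultimately show ?thesis
      using C(1) \<tau>(1) by (intro exI[of _ "s * q"] exI[of _ \<tau>']) auto
  qed
qed

section \<open>Polynomial functions and their leading forms\<close>

text \<open>Points have infinitely many coordinates for every \<open>M\<close>. Dropping the last
  coordinate thus needs no projection map, only a smaller set of functions.\<close>

inductive_set polyfuns :: "nat \<Rightarrow> ((nat \<Rightarrow> complex) \<Rightarrow> complex) set" for M where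
  const: "(\<lambda>x. c) \<in> polyfuns M"
| coord: "i < M \<Longrightarrow> (\<lambda>x. x i) \<in> polyfuns M"
| add: "f \<in> polyfuns M \<Longrightarrow> g \<in> polyfuns M \<Longrightarrow> (\<lambda>x. f x + g x) \<in> polyfuns M"
| mult: "f \<in> polyfuns M \<Longrightarrow> g \<in> polyfuns M \<Longrightarrow> (\<lambda>x. f x * g x) \<in> polyfuns M"

interpretation PF: function_algebra "polyfuns M" for M
  by unfold_locales (rule polyfuns.intros; assumption)+

abbreviation "pfam M \<equiv> function_algebra.fam (polyfuns M)"

lemma polyfuns_cong: "f \<in> polyfuns M \<Longrightarrow> (\<And>i. i < M \<Longrightarrow> x i = y i) \<Longrightarrow> f x = f y"
  by (induction rule: polyfuns.induct) auto

lemma polyfuns_mono: "f \<in> polyfuns M \<Longrightarrow> M \<le> M' \<Longrightarrow> f \<in> polyfuns M'"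
  by (induction rule: polyfuns.induct) (auto intro: polyfuns.intros)

lemma pfam_cong:
  assumes "A \<in> pfam M n" "\<And>i. i < M \<Longrightarrow> x i = y i"
  shows "A x = A y"
  by (rule poly_eqI) (rule polyfuns_cong[OF PF.fam_coeff[OF assms(1)] assms(2)])

context function_algebra
begin

lemma polyfuns_substitute:
  assumes "f \<in> polyfuns M" "\<And>i. i < M \<Longrightarrow> (\<lambda>x. \<theta> x i) \<in> R"
  shows "(\<lambda>x. f (\<theta> x)) \<in> R"
  using assms by (induction rule: polyfuns.induct) auto

lemma polyfuns_substitute_fam:
  assumes "f \<in> polyfuns M" "\<And>i. i < M \<Longrightarrow> \<exists>n. \<Theta> i \<in> fam n"
  shows "\<exists>n A. A \<in> fam n \<and> (\<forall>x t. poly (A x) t = f (\<lambda>i. poly (\<Theta> i x) t))"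
  using assms
proof (induction rule: polyfuns.induct)
  case (const c)
  show ?case
    using fam_const[OF function_algebra.const[OF function_algebra_axioms, of c]]
    by (intro exI[of _ 0] exI[of _ "\<lambda>_. [:c:]"]) auto
next
  case (add f g)
  then obtain n m A B where "A \<in> fam n" "\<forall>x t. poly (A x) t = f (\<lambda>i. poly (\<Theta> i x) t)"
    "B \<in> fam m" "\<forall>x t. poly (B x) t = g (\<lambda>i. poly (\<Theta> i x) t)"
    by blast
  thus ?case
    by (intro exI[of _ "max n m"] exI[of _ "\<lambda>x. A x + B x"]) (auto intro!: fam_add intro: fam_mono)
next
  case (mult f g)
  then obtain n m A B where "A \<in> fam n" "\<forall>x t. poly (A x) t = f (\<lambda>i. poly (\<Theta> i x) t)"
    "B \<in> fam m" "\<forall>x t. poly (B x) t = g (\<lambda>i. poly (\<Theta> i x) t)"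
    by blast
  thus ?case
    by (intro exI[of _ "n + m"] exI[of _ "\<lambda>x. A x * B x"]) (auto intro!: fam_mult)
qed blast

end

lemma polyfuns_last_variable:
  assumes "f \<in> polyfuns (Suc M)"
  obtains n A where "A \<in> pfam M n" "\<And>x. f x = poly (A x) (x M)"
proof -
  define \<Theta> where "\<Theta> = (\<lambda>i (x :: nat \<Rightarrow> complex). if i < M then [:x i:] else [:0, 1:])"
  have "\<exists>n. \<Theta> i \<in> pfam M n" if "i < Suc M" for i
    using that PF.fam_const[of "\<lambda>x. x i" M 0] PF.fam_linear[of "\<lambda>_. 0" M "\<lambda>_. 1"]
    by (cases "i < M") (auto simp: \<Theta>_def intro: polyfuns.coord)
  from PF.polyfuns_substitute_fam[OF assms, of \<Theta>] this obtain n A where A: "A \<in> pfam M n"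
    "\<And>x t. poly (A x) t = f (\<lambda>i. poly (\<Theta> i x) t)"
    by blast
  have "f x = poly (A x) (x M)" for x
    unfolding A(2) by (intro polyfuns_cong[OF assms]) (auto simp: \<Theta>_def less_Suc_eq)
  with A(1) show ?thesis by (intro that[of A n])
qed

lemma pfam_last_variable:
  assumes "A \<in> pfam M n"
  shows "(\<lambda>x. poly (A x) (x M)) \<in> polyfuns (Suc M)"
proof -
  have "A \<in> pfam (Suc M) n"
    using assms polyfuns_mono[of _ M "Suc M"] by (auto simp: PF.fam_def)
  thus ?thesis
    by (intro PF.fam_eval polyfuns.coord) auto
qed

lemma polyfuns_line:
  assumes "f \<in> polyfuns M"
  shows "\<exists>n. \<exists>A\<in>pfam M n. \<forall>x t. poly (A x) t = f (\<lambda>i. a i + t * (c * x i + b i))"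
proof -
  have "(\<lambda>x. [:a i, c * x i + b i:]) \<in> pfam M 1" if "i < M" for i
    using that by (intro PF.fam_linear) (auto intro!: polyfuns.intros)
  from PF.polyfuns_substitute_fam[OF assms, of "\<lambda>i x. [:a i, c * x i + b i:]"] this
  obtain n A where A: "A \<in> pfam M n" "\<forall>x t. poly (A x) t = f (\<lambda>i. poly [:a i, c * x i + b i:] t)"
    by blast
  thus ?thesis
    by (intro exI[of _ n] bexI[of _ A]) simp_all
qed

lemma polyfuns_line_poly:
  assumes "f \<in> polyfuns M"
  shows "\<exists>p. \<forall>t. poly p t = f (\<lambda>i. a i + t * b i)"
proof -
  obtain n A where A: "\<forall>x t. poly (A x) t = f (\<lambda>i. a i + t * (0 * x i + b i))"
    using polyfuns_line[OF assms, of a 0 b] by (elim exE bexE) 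
  show ?thesis
    by (rule exI[of _ "A (\<lambda>_. 0)"]) (simp add: A)
qed

text \<open>On the line through \<open>a\<close> and \<open>b\<close> both functions become nonzero
  polynomials in one variable, and their product has a non-root.\<close>

lemma polyfuns_no_zero_divisors:
  assumes fg: "f \<in> polyfuns M" "g \<in> polyfuns M" and nz: "f a \<noteq> 0" "g b \<noteq> 0"
  obtains x where "f x \<noteq> 0" "g x \<noteq> 0"
proof -
  obtain p where p: "\<forall>t. poly p t = f (\<lambda>i. a i + t * (b i - a i))"
    using polyfuns_line_poly[OF fg(1), of a "\<lambda>i. b i - a i"] by (elim exE)
  obtain q where q: "\<forall>t. poly q t = g (\<lambda>i. a i + t * (b i - a i))"
    using polyfuns_line_poly[OF fg(2), of a "\<lambda>i. b i - a i"] by (elim exE)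
  have "p \<noteq> 0" using spec[OF p, of 0] nz by auto
  moreover have "q \<noteq> 0" using spec[OF q, of 1] nz by auto
  ultimately have "p * q \<noteq> 0" by simp
  then obtain t where "poly (p * q) t \<noteq> 0"
    using poly_all_0_iff_0 by blast
  thus ?thesis using p q that by auto
qed

text \<open>Here \<open>h\<close> is the homogeneous component of \<open>f\<close> of top degree
  \<open>e\<close>, read off from f(t x) as a polynomial in t. On a line in direction
  \<open>c\<close> the coefficient of t^e depends on \<open>c\<close> alone. This is what makes
  polynomials monic in a suitable direction.\<close>

lemma leading_form:
  assumes f: "f \<in> polyfuns M" and nz: "f a \<noteq> 0"
  shows "\<exists>e. \<exists>h\<in>polyfuns M. (\<exists>z. h z \<noteq> 0) \<and> (\<forall>x t. h (\<lambda>i. t * x i) = t ^ e * h x) \<and>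
    (\<forall>c. \<exists>\<Delta>\<in>pfam M e. \<forall>x. coeff (\<Delta> x) e = h c \<and> (\<forall>t. poly (\<Delta> x) t = f (\<lambda>i. x i + t * c i)))"
proof -
  obtain n \<Phi> where "\<Phi> \<in> pfam M n" "\<forall>x t. poly (\<Phi> x) t = f (\<lambda>i. 0 + t * (1 * x i + 0))"
    using polyfuns_line[OF f, of "\<lambda>_. 0" 1 "\<lambda>_. 0"] by (elim exE bexE)
  hence \<Phi>: "\<Phi> \<in> pfam M n" "\<And>x t. poly (\<Phi> x) t = f (\<lambda>i. t * x i)"
    by simp_all
  define e where "e = Max (range (\<lambda>x. degree (\<Phi> x)))"
  have fin: "finite (range (\<lambda>x. degree (\<Phi> x)))"
    by (rule finite_subset[of _ "{..n}"]) (use PF.fam_degree[OF \<Phi>(1)] in auto)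
  have le_e: "degree (\<Phi> x) \<le> e" for x
    unfolding e_def using fin by (intro Max_ge) auto
  obtain z where z: "degree (\<Phi> z) = e" "\<Phi> z \<noteq> 0"
  proof -
    have "e \<in> range (\<lambda>x. degree (\<Phi> x))"
      unfolding e_def using fin by (intro Max_in) auto
    then obtain z where z: "e = degree (\<Phi> z)" by auto
    have "\<Phi> a \<noteq> 0" using \<Phi>(2)[of a 1] nz by auto
    show ?thesis
    proof (cases "\<Phi> z = 0")
      case True
      \<comment> \<open>The zero polynomial has degree 0 by convention, so here e = 0 and the point
        \<open>a\<close> serves instead.\<close>
      hence "degree (\<Phi> a) = e" using z le_e[of a] by simp
      with \<open>\<Phi> a \<noteq> 0\<close> show ?thesis by (intro that[of a])
    qed (use z in \<open>auto intro: that\<close>)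
  qed
  have \<Phi>e: "\<Phi> \<in> pfam M e"
    using \<Phi>(1) le_e by (auto simp: PF.fam_def)
  define h where "h = (\<lambda>x. coeff (\<Phi> x) e)"
  have \<Phi>_scale: "\<Phi> (\<lambda>i. t * x i) = pcompose (\<Phi> x) [:0, t:]" for t x
  proof -
    have "poly (\<Phi> (\<lambda>i. t * x i)) = poly (pcompose (\<Phi> x) [:0, t:])"
      by (rule ext) (simp add: \<Phi>(2) poly_pcompose mult.assoc mult.left_commute)
    thus ?thesis by (simp add: poly_eq_poly_eq_iff)
  qed
  have line: "\<exists>\<Delta>\<in>pfam M e. \<forall>x. coeff (\<Delta> x) e = h c \<and> (\<forall>t. poly (\<Delta> x) t = f (\<lambda>i. x i + t * c i))" for c
  proof -
    have "(\<lambda>x. [:x i, c i:]) \<in> pfam M 1" if "i < M" for i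
      using that by (intro PF.fam_linear) (auto intro!: polyfuns.intros)
    from PF.polyfuns_substitute_fam[OF f, of "\<lambda>i x. [:x i, c i:]"] this
    obtain m \<Delta> where "\<Delta> \<in> pfam M m" "\<forall>x t. poly (\<Delta> x) t = f (\<lambda>i. poly [:x i, c i:] t)"
      by blast
    hence \<Delta>: "\<Delta> \<in> pfam M m" "\<And>x t. poly (\<Delta> x) t = f (\<lambda>i. x i + t * c i)"
      by simp_all
    have co: "coeff (\<Delta> x) i = (if e < i then 0 else h c)" if True: "e \<le> i" for x i
    proof -
      \<comment> \<open>Multiplication by s^N clears every power of 1/s that occurs, and index
        \<open>i\<close> stays within range.\<close>
      define N where "N = max m i"
      have "\<exists>p. \<forall>s. poly p s = coeff (\<Phi> (\<lambda>i. c i + s * x i)) k" for k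
        by (rule polyfuns_line_poly[OF PF.fam_coeff[OF \<Phi>(1), of k], of c x])
      hence "\<forall>k. \<exists>p. \<forall>s. poly p s = coeff (\<Phi> (\<lambda>i. c i + s * x i)) k" ..
      from choice[OF this] obtain \<psi> where \<psi>: "\<And>k s. poly (\<psi> k) s = coeff (\<Phi> (\<lambda>i. c i + s * x i)) k"
        by blast
      define S where "S = (\<Sum>k\<le>e. \<psi> k * monom 1 (e - k))"
      define Q where "Q = (\<Sum>j\<le>N. monom (coeff (\<Delta> x) j) (N - j))"
      txt \<open>With \<open>t = 1 / s\<close>, the behaviour of \<open>f\<close> at infinity on the line becomes the behaviour of its
        homogeneous components at \<open>s = 0\<close>.\<close>
      have "poly (Q - monom 1 (N - e) * S) s = 0" if "s \<noteq> 0" for s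
      proof -
        have pow: "s ^ n * (1 / s) ^ k = s ^ (n - k)" if "k \<le> n" for n k
        proof -
          have "s ^ n = s ^ (n - k) * s ^ k" using that by (simp add: power_add[symmetric])
          moreover have "s ^ k * (1 / s) ^ k = 1"
            using \<open>s \<noteq> 0\<close> by (simp add: power_mult_distrib[symmetric])
          ultimately show ?thesis by (simp add: mult.assoc)
        qed
        have "poly Q s = (\<Sum>j\<le>N. coeff (\<Delta> x) j * s ^ (N - j))"
          by (simp add: Q_def poly_sum poly_monom)
        also have "\<dots> = (\<Sum>j\<le>N. s ^ N * (coeff (\<Delta> x) j * (1 / s) ^ j))"
          by (intro sum.cong) (auto simp: pow mult.left_commute[of "s ^ N"])
        also have "\<dots> = s ^ N * poly (\<Delta> x) (1 / s)"
          using PF.fam_degree[OF \<Delta>(1), of x]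
          by (subst PF.poly_bounded_degree[where n = N]) (auto simp: N_def sum_distrib_left)
        also have "poly (\<Delta> x) (1 / s) = f (\<lambda>i. (1 / s) * (c i + s * x i))"
        proof -
          have "(\<lambda>i. x i + 1 / s * c i) = (\<lambda>i. (1 / s) * (c i + s * x i))"
            using that by (auto simp: distrib_left)
          thus ?thesis by (simp only: \<Delta>(2))
        qed
        also have "\<dots> = (\<Sum>k\<le>e. coeff (\<Phi> (\<lambda>i. c i + s * x i)) k * (1 / s) ^ k)"
          by (simp only: \<Phi>(2)[symmetric] PF.poly_bounded_degree[OF le_e])
        also have "s ^ N * \<dots> = s ^ (N - e) * (\<Sum>k\<le>e. poly (\<psi> k) s * s ^ (e - k))"
        proof -
          have eq: "s ^ N * (b * (1 / s) ^ k) = s ^ (N - e) * (b * s ^ (e - k))" if "k \<le> e" for k b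
            using that True pow[of k N] by (simp add: mult.left_commute[of _ b] N_def power_add[symmetric])
          show ?thesis
            unfolding \<psi> sum_distrib_left by (intro sum.cong refl eq) simp
        qed
        also have "\<dots> = poly (monom 1 (N - e) * S) s"
          by (simp add: S_def poly_sum poly_monom)
        finally show ?thesis by simp
      qed
      \<comment> \<open>The extra factor s covers s = 0, where t = 1/s makes no sense.\<close>
      hence "[:0, 1:] * (Q - monom 1 (N - e) * S) = 0"
        by (intro poly_eq_poly_eq_iff[THEN iffD1] ext) auto
      hence "Q = monom 1 (N - e) * S" by simp
      moreover have "coeff Q (N - i) = coeff (\<Delta> x) i"
      proof -
        have "coeff Q (N - i) = (\<Sum>j\<le>N. if j = i then coeff (\<Delta> x) j else 0)"
          unfolding Q_def coeff_sum coeff_monom by (intro sum.cong) (auto simp: N_def)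
        thus ?thesis by (simp add: N_def)
      qed
      moreover have "coeff (monom 1 (N - e) * S) (N - i) = (if e < i then 0 else poly S 0)"
        using True by (auto simp: coeff_monom_mult N_def poly_0_coeff_0)
      moreover have "poly S 0 = h c"
      proof -
        have "poly S 0 = (\<Sum>k\<le>e. if k = e then poly (\<psi> k) 0 else 0)"
          unfolding S_def poly_sum by (intro sum.cong) (auto simp: poly_monom)
        thus ?thesis by (simp add: \<psi> h_def)
      qed
      ultimately show ?thesis using True by auto
    qed
    hence "coeff (\<Delta> x) e = h c" for x
      by simp
    moreover have "\<Delta> \<in> pfam M e"
      using co by (intro PF.famI PF.fam_coeff[OF \<Delta>(1)] degree_le) auto
    ultimately show ?thesis using \<Delta>(2) by blast
  qed
  show ?thesis
  proof (intro exI[of _ e] bexI[of _ h] conjI allI)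
    show "h \<in> polyfuns M" unfolding h_def by (rule PF.fam_coeff[OF \<Phi>(1)])
    show "\<exists>z. h z \<noteq> 0" using z by (intro exI[of _ z]) (auto simp: h_def leading_coeff_neq_0)
    show "h (\<lambda>i. t * x i) = t ^ e * h x" for x t
      by (simp add: h_def \<Phi>_scale coeff_pcompose_linear)
  qed (rule line)
qed

text \<open>By homogeneity a direction with nonzero top form can be rescaled to have last coordinate
  1, as long as that coordinate is nonzero; a vector with both properties exists because polynomial
  functions have no zero divisors.\<close>

lemma monic_direction:
  assumes f: "f \<in> polyfuns (Suc M)" and nz: "f a \<noteq> 0"
  shows "\<exists>c e \<gamma>. \<exists>\<Delta>\<in>pfam (Suc M) e. c M = 1 \<and> \<gamma> \<noteq> 0 \<and>
    (\<forall>x. coeff (\<Delta> x) e = \<gamma>) \<and> (\<forall>x t. poly (\<Delta> x) t = f (\<lambda>i. x i + t * c i))"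
proof -
  show ?thesis
    using leading_form[OF f nz]
  proof (elim exE bexE conjE)
    fix e h z
    assume h: "h \<in> polyfuns (Suc M)" "\<forall>x t. h (\<lambda>i. t * x i) = t ^ e * h x"
      "\<forall>c. \<exists>\<Delta>\<in>pfam (Suc M) e. \<forall>x. coeff (\<Delta> x) e = h c \<and> (\<forall>t. poly (\<Delta> x) t = f (\<lambda>i. x i + t * c i))"
      and z: "h z \<noteq> 0"
    obtain x where x: "h x \<noteq> 0" "x M \<noteq> 0"
      by (rule polyfuns_no_zero_divisors[OF h(1) polyfuns.coord[of M "Suc M"] z, of "\<lambda>_. 1"]) auto
    define c where "c = (\<lambda>i. inverse (x M) * x i)"
    have "h c \<noteq> 0" "c M = 1" using x h(2) by (simp_all add: c_def)
    obtain \<Delta> where \<Delta>: "\<Delta> \<in> pfam (Suc M) e"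
      "\<forall>x. coeff (\<Delta> x) e = h c \<and> (\<forall>t. poly (\<Delta> x) t = f (\<lambda>i. x i + t * c i))"
      using spec[OF h(3), of c] by (rule bexE)
    show ?thesis
      by (intro exI[of _ c] exI[of _ e] exI[of _ "h c"] bexI[of _ \<Delta>] conjI)
         (use \<Delta> \<open>c M = 1\<close> \<open>h c \<noteq> 0\<close> in simp_all)
  qed
qed

section \<open>Divisibility of polynomial functions\<close>

lemma (in function_algebra) fam_division_const_lead:
  assumes "\<Delta> \<in> fam e" "\<And>x. coeff (\<Delta> x) e = \<gamma>" "\<gamma> \<noteq> 0" "\<beta> \<in> fam n"
  shows "\<exists>m. \<exists>q\<in>fam m. \<forall>x. \<beta> x - \<Delta> x * q x = 0 \<or> degree (\<beta> x - \<Delta> x * q x) < e"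
proof (cases "e = 0")
  case True
  have "\<Delta> x = [:\<gamma>:]" for x
    using fam_degree[OF assms(1), of x] assms(2)[of x] True by (auto elim!: degree_eq_zeroE)
  thus ?thesis
    using assms(3,4)
    by (intro exI[of _ n] bexI[of _ "\<lambda>x. smult (inverse \<gamma>) (\<beta> x)"]) (auto intro: fam_smult)
next
  case False
  then obtain r q S where *: "q \<in> fam (n - e)" "S \<in> fam (e - 1)" "\<forall>x. smult (\<gamma> ^ r) (\<beta> x) = \<Delta> x * q x + S x"
    using fam_pseudo_division[OF assms(1) _ assms(4)] assms(2) by auto
  define q' where "q' = (\<lambda>x. smult (inverse (\<gamma> ^ r)) (q x))"
  have "\<beta> x - \<Delta> x * q' x = smult (inverse (\<gamma> ^ r)) (S x)" for x
  proof -
    have "\<beta> x = smult (inverse (\<gamma> ^ r)) (smult (\<gamma> ^ r) (\<beta> x))"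
      using assms(3) by simp
    also have "\<dots> = \<Delta> x * q' x + smult (inverse (\<gamma> ^ r)) (S x)"
      by (simp only: * smult_add_right q'_def mult_smult_right)
    finally show ?thesis by simp
  qed
  moreover have "degree (smult (inverse (\<gamma> ^ r)) (S x)) < e" for x
    using fam_degree[OF *(2), of x] False assms(3) by simp
  moreover have "q' \<in> fam (n - e)"
    unfolding q'_def by (intro fam_smult *) auto
  ultimately show ?thesis
    by (intro exI[of _ "n - e"] bexI[of _ q']) simp_all
qed

text \<open>Since \<open>F\<close> has content 1, multiplicativity of contents makes content D times
  content q associated to the product of the leading coefficients of \<open>D\<close> and
  \<open>q\<close>. Each leading coefficient is a multiple of its content, so the cofactors are
  units. Hence the leading coefficient of \<open>D\<close> divides its content.\<close>

lemma lead_coeff_dvd_of_monic_multiple: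
  fixes D F q :: "complex poly poly"
  assumes eq: "smult (lead_coeff D ^ r) F = D * q" and monic: "lead_coeff F = 1" and "D \<noteq> 0"
  shows "lead_coeff D dvd coeff D k"
proof -
  define \<delta> where "\<delta> = lead_coeff D"
  have \<delta>: "\<delta> \<noteq> 0" using assms by (simp add: \<delta>_def)
  have "content F dvd 1"
    using content_dvd_coeff[of F "degree F"] monic by simp
  hence "content F = 1"
    by (simp only: is_unit_content_iff)
  hence cont: "content D * content q = normalize (\<delta> ^ r)"
    using arg_cong[OF eq, of content] by (simp add: content_mult \<delta>_def)
  have lead: "\<delta> * lead_coeff q = \<delta> ^ r"
    using arg_cong[OF eq, of lead_coeff] monic \<open>D \<noteq> 0\<close> by (simp add: lead_coeff_mult \<delta>_def)
  obtain u where u: "\<delta> = content D * u"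
    using content_dvd_coeff[of D "degree D"] unfolding \<delta>_def by (elim dvdE)
  obtain w where w: "lead_coeff q = content q * w"
    using content_dvd_coeff[of q "degree q"] by (elim dvdE)
  have "normalize (\<delta> ^ r) * (u * w) = \<delta> ^ r"
    using lead u w cont by (metis mult.assoc mult.left_commute)
  also have "\<delta> ^ r = normalize (\<delta> ^ r) * unit_factor (\<delta> ^ r)"
    by simp
  finally have "u * w = unit_factor (\<delta> ^ r)"
    using \<delta> by (subst (asm) mult_cancel_left) auto
  hence "is_unit (u * w)"
    using \<delta> by (simp only: unit_factor_is_unit power_not_zero not_False_eq_True)
  hence "is_unit u" using dvd_mult_left by blast
  hence "\<delta> dvd content D" using u by (simp add: mult_unit_dvd_iff)
  also have "content D dvd coeff D k" by (rule content_dvd_coeff)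
  finally show ?thesis by (simp add: \<delta>_def)
qed

text \<open>Divisibility on all lines suffices. In a direction where the top form of
  \<open>d\<close> is nonzero, the restrictions of \<open>d\<close> have a constant leading
  coefficient, so division with remainder is polynomial in the base point. The remainder is a
  multiple of \<open>d\<close> of too small a degree, hence 0, and the quotient at t = 0 is the one
  sought.\<close>

lemma polyfuns_divide:
  assumes d: "d \<in> polyfuns M" "d a \<noteq> 0" and b: "b \<in> polyfuns M"
    and dvd: "\<And>x c p q. p \<noteq> 0 \<Longrightarrow> (\<forall>t. poly p t = d (\<lambda>i. x i + t * c i)) \<Longrightarrow>
                (\<forall>t. poly q t = b (\<lambda>i. x i + t * c i)) \<Longrightarrow> p dvd q"
  shows "\<exists>q\<in>polyfuns M. \<forall>x. b x = d x * q x"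
  using leading_form[OF d]
proof (elim exE bexE conjE)
  fix e h z
  assume h: "\<forall>c. \<exists>\<Delta>\<in>pfam M e. \<forall>x. coeff (\<Delta> x) e = h c \<and> (\<forall>t. poly (\<Delta> x) t = d (\<lambda>i. x i + t * c i))"
    and z: "h z \<noteq> 0"
  obtain \<Delta> where \<Delta>: "\<Delta> \<in> pfam M e" "\<forall>x. coeff (\<Delta> x) e = h z \<and> (\<forall>t. poly (\<Delta> x) t = d (\<lambda>i. x i + t * z i))"
    using spec[OF h, of z] by (rule bexE)
  have "(\<lambda>x. [:x i, z i:]) \<in> pfam M 1" if "i < M" for i
    using that by (intro PF.fam_linear) (auto intro!: polyfuns.intros)
  from PF.polyfuns_substitute_fam[OF b, of "\<lambda>i x. [:x i, z i:]"] this
  obtain n \<beta> where \<beta>: "\<beta> \<in> pfam M n" "\<forall>x t. poly (\<beta> x) t = b (\<lambda>i. poly [:x i, z i:] t)"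
    by blast
  have "\<And>x. coeff (\<Delta> x) e = h z" using \<Delta>(2) by simp
  then obtain m q where q: "q \<in> pfam M m"
    "\<forall>x. \<beta> x - \<Delta> x * q x = 0 \<or> degree (\<beta> x - \<Delta> x * q x) < e"
    using PF.fam_division_const_lead[OF \<Delta>(1) _ z \<beta>(1)] by metis
  have "\<beta> x = \<Delta> x * q x" for x
  proof (rule ccontr)
    assume neq: "\<beta> x \<noteq> \<Delta> x * q x"
    have "\<Delta> x \<noteq> 0"
      using spec[OF \<Delta>(2), of x] z by (metis coeff_0)
    hence "\<Delta> x dvd \<beta> x"
      by (rule dvd[of _ x z]) (use \<Delta>(2) \<beta>(2) in auto)
    hence "\<Delta> x dvd \<beta> x - \<Delta> x * q x" by (intro dvd_diff) auto
    hence "degree (\<Delta> x) \<le> degree (\<beta> x - \<Delta> x * q x)"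
      using neq by (intro dvd_imp_degree_le) auto
    moreover have "e \<le> degree (\<Delta> x)"
      using \<Delta>(2) z by (intro le_degree) auto
    ultimately show False using q(2) neq by (metis eq_iff_diff_eq_0 leD order_trans)
  qed
  hence "b x = d x * poly (q x) 0" for x
    using \<beta>(2)[rule_format, of x 0] \<Delta>(2) by (simp del: poly_0_coeff_0)
  moreover have "(\<lambda>x. poly (q x) 0) \<in> polyfuns M"
    by (intro PF.fam_eval[OF q(1)]) auto
  ultimately show ?thesis by (intro bexI[of _ "\<lambda>x. poly (q x) 0"]) auto
qed

section \<open>Minimal relations for the last coordinate\<close>

text \<open>Equivalently, the functions vanishing on \<open>W\<close> form a prime ideal, or all
  functions if \<open>W\<close> is empty. The set need not be closed.\<close>

definition irreducible_set :: "nat \<Rightarrow> (nat \<Rightarrow> complex) set \<Rightarrow> bool" where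
  "irreducible_set M W \<longleftrightarrow> (\<forall>f\<in>polyfuns M. \<forall>g\<in>polyfuns M.
     (\<exists>x\<in>W. f x \<noteq> 0) \<longrightarrow> (\<exists>x\<in>W. g x \<noteq> 0) \<longrightarrow> (\<exists>x\<in>W. f x \<noteq> 0 \<and> g x \<noteq> 0))"

text \<open>The coordinates from \<open>M\<close> on stay free: this is the cylinder over the
  Zariski closure of the projection of \<open>W\<close> to the first \<open>M\<close>
  coordinates.\<close>

definition zariski_hull :: "nat \<Rightarrow> (nat \<Rightarrow> complex) set \<Rightarrow> (nat \<Rightarrow> complex) set" where
  "zariski_hull M W = {p. \<forall>f\<in>polyfuns M. (\<forall>x\<in>W. f x = 0) \<longrightarrow> f p = 0}"

lemma irreducible_setD:
  "irreducible_set M W \<Longrightarrow> f \<in> polyfuns M \<Longrightarrow> g \<in> polyfuns M \<Longrightarrow> x \<in> W \<Longrightarrow> f x \<noteq> 0 \<Longrightarrow> y \<in> W \<Longrightarrow> g y \<noteq> 0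
     \<Longrightarrow> \<exists>x\<in>W. f x \<noteq> 0 \<and> g x \<noteq> 0"
  unfolding irreducible_set_def by blast

lemma zariski_hullD: "p \<in> zariski_hull M W \<Longrightarrow> f \<in> polyfuns M \<Longrightarrow> (\<And>x. x \<in> W \<Longrightarrow> f x = 0) \<Longrightarrow> f p = 0"
  by (auto simp: zariski_hull_def)

lemma zariski_hull_mono: "M \<le> M' \<Longrightarrow> zariski_hull M' W \<subseteq> zariski_hull M W"
  unfolding zariski_hull_def using polyfuns_mono by blast

lemma irreducible_set_mono: "irreducible_set M' W \<Longrightarrow> M \<le> M' \<Longrightarrow> irreducible_set M W"
  unfolding irreducible_set_def using polyfuns_mono by blast

lemma pfam_truncate:
  assumes "A \<in> pfam M n" "0 < n" "\<forall>x\<in>W. coeff (A x) n = 0"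
  obtains B where "B \<in> pfam M (n - 1)" "\<And>x. x \<in> W \<Longrightarrow> B x = A x"
proof (rule that[of "\<lambda>x. A x - monom (coeff (A x) n) n"])
  show "(\<lambda>x. A x - monom (coeff (A x) n) n) \<in> pfam M (n - 1)"
    using assms(1,2) by (intro PF.fam_degree_drop PF.fam_diff PF.fam_monom PF.fam_coeff[OF assms(1)]) auto
qed (use assms in auto)

text \<open>For irreducible \<open>W\<close> this is, up to denominators, the minimal polynomial of
  the coordinate \<open>x M\<close> over the fraction field of the functions of the first
  \<open>M\<close> coordinates on \<open>W\<close>.\<close>

definition minimal_relation :: "nat \<Rightarrow> (nat \<Rightarrow> complex) set \<Rightarrow> nat \<Rightarrow> ((nat \<Rightarrow> complex) \<Rightarrow> complex poly) \<Rightarrow> bool" where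
  "minimal_relation M W m D \<longleftrightarrow> 0 < m \<and> D \<in> pfam M m \<and> (\<forall>x\<in>W. poly (D x) (x M) = 0) \<and>
     (\<exists>x\<in>W. coeff (D x) m \<noteq> 0) \<and>
     (\<forall>A\<in>pfam M (m - 1). (\<forall>x\<in>W. poly (A x) (x M) = 0) \<longrightarrow> (\<forall>x\<in>W. A x = 0))"

lemma minimal_relation_exists:
  assumes "F \<in> pfam M n" "\<forall>x\<in>W. poly (F x) (x M) = 0" "a \<in> W" "F a \<noteq> 0"
  shows "\<exists>m D. minimal_relation M W m D"
proof -
  define P where "P = (\<lambda>m. \<exists>D\<in>pfam M m. (\<forall>x\<in>W. poly (D x) (x M) = 0) \<and> (\<exists>x\<in>W. D x \<noteq> 0))"
  define m where "m = (LEAST m. P m)"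
  have "P n" using assms unfolding P_def by blast
  hence "P m" unfolding m_def by (rule LeastI)
  then obtain D b where D: "D \<in> pfam M m" "\<forall>x\<in>W. poly (D x) (x M) = 0" "b \<in> W" "D b \<noteq> 0"
    by (auto simp: P_def)
  have min: "\<not> P k" if "k < m" for k
    using that unfolding m_def by (rule not_less_Least)
  have m: "0 < m"
  proof (rule ccontr)
    assume "\<not> 0 < m"
    hence "degree (D b) = 0" using PF.fam_degree[OF D(1), of b] by simp
    then obtain c where "D b = [:c:]" by (auto elim: degree_eq_zeroE)
    with D show False by force
  qed
  have "\<exists>x\<in>W. coeff (D x) m \<noteq> 0"
  proof (rule ccontr)
    assume "\<not> (\<exists>x\<in>W. coeff (D x) m \<noteq> 0)"
    then obtain B where "B \<in> pfam M (m - 1)" "\<And>x. x \<in> W \<Longrightarrow> B x = D x"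
      using pfam_truncate[OF D(1) m] by metis
    hence "P (m - 1)" unfolding P_def using D by (intro bexI[of _ B]) auto
    with min[of "m - 1"] m show False by simp
  qed
  moreover have "\<forall>x\<in>W. A x = 0" if "A \<in> pfam M (m - 1)" "\<forall>x\<in>W. poly (A x) (x M) = 0" for A
    using min[of "m - 1"] m that unfolding P_def by auto
  ultimately show ?thesis
    using m D unfolding minimal_relation_def by blast
qed

text \<open>A substitute for the norm of \<open>g\<close> in the extension generated by the last
  coordinate: on \<open>W\<close> some multiple of \<open>g\<close> depends on the base coordinates
  only, without vanishing identically. It comes from Euclid's algorithm: if S is the remainder of
  \<open>D\<close> modulo E, then S = -E q on \<open>W\<close>, so multiples of S are multiples of
  E, and the degree drops until the last coordinate has disappeared.\<close>

lemma minimal_relation_norm: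
  assumes W: "irreducible_set (Suc M) W" and D: "minimal_relation M W m D"
    and g: "g \<in> polyfuns (Suc M)" "b \<in> W" "g b \<noteq> 0"
  shows "\<exists>s\<in>polyfuns M. \<exists>a\<in>polyfuns (Suc M). (\<exists>x\<in>W. s x \<noteq> 0) \<and> (\<forall>x\<in>W. s x = g x * a x)"
proof -
  have Dm: "D \<in> pfam M m" "0 < m" and D0: "\<And>x. x \<in> W \<Longrightarrow> poly (D x) (x M) = 0"
    and min: "\<And>A x. A \<in> pfam M (m - 1) \<Longrightarrow> \<forall>x\<in>W. poly (A x) (x M) = 0 \<Longrightarrow> x \<in> W \<Longrightarrow> A x = 0"
    using D unfolding minimal_relation_def by blast+
  obtain c where c: "c \<in> W" "coeff (D c) m \<noteq> 0"
    using D unfolding minimal_relation_def by blast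
  have coeff_Suc: "(\<lambda>x. coeff (A x) k) \<in> polyfuns (Suc M)" if "A \<in> pfam M n" for A n k
    by (rule polyfuns_mono[OF PF.fam_coeff[OF that]]) simp
  have low: "\<exists>s\<in>polyfuns M. \<exists>a\<in>polyfuns (Suc M). (\<exists>x\<in>W. s x \<noteq> 0) \<and> (\<forall>x\<in>W. s x = poly (E x) (x M) * a x)"
    if "k < m" "E \<in> pfam M k" "y \<in> W" "poly (E y) (y M) \<noteq> 0" for k E y
    using that
  proof (induction k arbitrary: E y rule: less_induct)
    case (less k)
    show ?case
    proof (cases "k = 0")
      case True
      have "E x = [:coeff (E x) 0:]" for x
        using PF.fam_degree[OF less.prems(2), of x] True by (auto elim!: degree_eq_zeroE)
      hence "poly (E x) (x M) = coeff (E x) 0" for x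
        by (metis poly_const_conv)
      thus ?thesis
        using less.prems PF.fam_coeff[OF less.prems(2), of 0]
        by (intro bexI[of _ "\<lambda>x. coeff (E x) 0"] bexI[of _ "\<lambda>x. 1"]) auto
    next
      case k: False
      show ?thesis
      proof (cases "\<forall>x\<in>W. coeff (E x) k = 0")
        case True
        then obtain B where B: "B \<in> pfam M (k - 1)" "\<And>x. x \<in> W \<Longrightarrow> B x = E x"
          using pfam_truncate[OF less.prems(2)] k by blast
        show ?thesis
          using less.IH[of "k - 1" B y] less.prems k B by auto
      next
        case False
        then obtain z where z: "z \<in> W" "coeff (E z) k \<noteq> 0" by blast
        obtain r q S where q: "q \<in> pfam M (m - k)" and S: "S \<in> pfam M (k - 1)"
          and div: "\<forall>x. smult (coeff (E x) k ^ r) (D x) = E x * q x + S x"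
          using PF.fam_pseudo_division[OF less.prems(2) _ Dm(1)] k by blast
        have div0: "poly (S x) (x M) = - (poly (E x) (x M) * poly (q x) (x M))" if "x \<in> W" for x
        proof -
          have "poly (E x * q x + S x) (x M) = 0"
            unfolding div[rule_format, symmetric] using D0[OF that] by simp
          thus ?thesis by (simp add: eq_neg_iff_add_eq_0 add.commute)
        qed
        have qS: "(\<lambda>x. poly (q x) (x M)) \<in> polyfuns (Suc M)"
          by (rule pfam_last_variable[OF q])
        show ?thesis
        proof (cases "\<exists>x\<in>W. poly (S x) (x M) \<noteq> 0")
          case True
          then obtain x where x: "x \<in> W" "poly (S x) (x M) \<noteq> 0" by blast
          have "k - 1 < k" "k - 1 < m" using k less.prems by auto
          from less.IH[OF this S x] obtain s a where sa: "s \<in> polyfuns M" "a \<in> polyfuns (Suc M)" "\<exists>x\<in>W. s x \<noteq> 0"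
            "\<forall>x\<in>W. s x = poly (S x) (x M) * a x"
            by blast
          show ?thesis
          proof (rule bexI[of _ s], rule bexI[of _ "\<lambda>x. - (poly (q x) (x M) * a x)"], intro conjI ballI)
            show "(\<lambda>x. - (poly (q x) (x M) * a x)) \<in> polyfuns (Suc M)"
              by (intro PF.uminus PF.mult qS sa)
            show "s x = poly (E x) (x M) * - (poly (q x) (x M) * a x)" if "x \<in> W" for x
              using sa(4) that div0[OF that] by (simp add: mult.assoc)
          qed (use sa in auto)
        next
          case False
          \<comment> \<open>If the remainder vanishes on \<open>W\<close>, so does E q, and
            irreducibility passes this to q. Both q and S have formal degree below \<open>m\<close>,
            so by minimality their coefficients vanish on \<open>W\<close>. Then a power of the
            leading coefficient of E times \<open>D\<close> vanishes on \<open>W\<close>, which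
            irreducibility forbids.\<close>
          have "poly (q x) (x M) = 0" if x: "x \<in> W" for x
          proof (rule ccontr)
            assume nz: "poly (q x) (x M) \<noteq> 0"
            obtain w where "w \<in> W" "poly (E w) (w M) \<noteq> 0" "poly (q w) (w M) \<noteq> 0"
              using irreducible_setD[OF W pfam_last_variable[OF less.prems(2)] qS less.prems(3,4) x nz] by blast
            with div0[of w] False show False by auto
          qed
          hence "q x = 0" if "x \<in> W" for x
            using that less.prems(1) k by (intro min[of q] PF.fam_mono[OF q]) auto
          moreover have "S x = 0" if "x \<in> W" for x
            using that less.prems(1) k False by (intro min[of S] PF.fam_mono[OF S]) auto
          ultimately have *: "smult (coeff (E x) k ^ r) (D x) = 0" if "x \<in> W" for x
            using that div by simp
          obtain w where "w \<in> W" "coeff (E w) k \<noteq> 0" "coeff (D w) m \<noteq> 0"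
            using irreducible_setD[OF W coeff_Suc[OF less.prems(2)] coeff_Suc[OF Dm(1)] z c] by blast
          with *[of w] show ?thesis by auto
        qed
      qed
    qed
  qed
  obtain n G where G: "G \<in> pfam M n" "\<And>x. g x = poly (G x) (x M)"
    using polyfuns_last_variable[OF g(1)] by blast
  \<comment> \<open>Reduction of \<open>g\<close> modulo \<open>D\<close> brings its degree in the
    last coordinate below \<open>m\<close>, where \<open>low\<close> applies; the price is a power
    of the leading coefficient.\<close>
  obtain r q S where "q \<in> pfam M (n - m)" and S: "S \<in> pfam M (m - 1)"
    and div: "\<forall>x. smult (coeff (D x) m ^ r) (G x) = D x * q x + S x"
    using PF.fam_pseudo_division[OF Dm G(1)] by blast
  have S_eq: "poly (S x) (x M) = coeff (D x) m ^ r * g x" if "x \<in> W" for x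
    using arg_cong[OF div[rule_format, of x], of "\<lambda>p. poly p (x M)"] D0[OF that] G(2) by simp
  obtain y where y: "y \<in> W" "coeff (D y) m \<noteq> 0" "g y \<noteq> 0"
    using irreducible_setD[OF W coeff_Suc[OF Dm(1)] g(1) c g(2,3)] by blast
  obtain s a where sa: "s \<in> polyfuns M" "a \<in> polyfuns (Suc M)" "\<exists>x\<in>W. s x \<noteq> 0"
    "\<forall>x\<in>W. s x = poly (S x) (x M) * a x"
  proof -
    have "m - 1 < m" "poly (S y) (y M) \<noteq> 0"
      using Dm(2) S_eq[OF y(1)] y by auto
    from low[OF this(1) S y(1) this(2)] show ?thesis using that by blast
  qed
  show ?thesis
  proof (rule bexI[of _ s], rule bexI[of _ "\<lambda>x. coeff (D x) m ^ r * a x"], intro conjI ballI)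
    show "(\<lambda>x. coeff (D x) m ^ r * a x) \<in> polyfuns (Suc M)"
      by (intro PF.mult PF.power coeff_Suc[OF Dm(1)] sa)
    show "s x = g x * (coeff (D x) m ^ r * a x)" if "x \<in> W" for x
      using sa(4) S_eq that by simp
  qed (use sa in auto)
qed

lemma minimal_relation_divides:
  assumes D: "minimal_relation M W m D" and H: "H \<in> pfam M n" "\<forall>x\<in>W. poly (H x) (x M) = 0"
  obtains r q S k where "q \<in> pfam M k" "S \<in> pfam M (m - 1)" "\<And>x. x \<in> W \<Longrightarrow> S x = 0"
    "\<And>x. smult (coeff (D x) m ^ r) (H x) = D x * q x + S x"
proof -
  have Dm: "D \<in> pfam M m" "0 < m" and D0: "\<And>x. x \<in> W \<Longrightarrow> poly (D x) (x M) = 0"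
    and min: "\<And>A x. A \<in> pfam M (m - 1) \<Longrightarrow> \<forall>x\<in>W. poly (A x) (x M) = 0 \<Longrightarrow> x \<in> W \<Longrightarrow> A x = 0"
    using D unfolding minimal_relation_def by blast+
  obtain r q S where q: "q \<in> pfam M (n - m)" and S: "S \<in> pfam M (m - 1)"
    and div: "\<forall>x. smult (coeff (D x) m ^ r) (H x) = D x * q x + S x"
    using PF.fam_pseudo_division[OF Dm H(1)] by blast
  have "poly (S x) (x M) = 0" if "x \<in> W" for x
    using arg_cong[OF div[rule_format, of x], of "\<lambda>p. poly p (x M)"] D0[OF that] H(2) that by simp
  hence "S x = 0" if "x \<in> W" for x
    using min[OF S _ that] by blast
  with q S div show ?thesis by (intro that[of q "n - m" S r]) auto
qed

text \<open>Every equation valid on \<open>W\<close> is, up to a power of the leading coefficient of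
  \<open>D\<close> and terms vanishing on the hull, a multiple of \<open>D\<close>. Where that
  coefficient is nonzero, a root of \<open>D y\<close> therefore satisfies all equations of
  \<open>W\<close>.\<close>

lemma minimal_relation_lift:
  assumes D: "minimal_relation M W m D" and y: "y \<in> zariski_hull M W" "coeff (D y) m \<noteq> 0" "poly (D y) t = 0"
  shows "y(M := t) \<in> zariski_hull (Suc M) W"
  unfolding zariski_hull_def
proof (intro CollectI ballI impI)
  fix f assume f: "f \<in> polyfuns (Suc M)" "\<forall>x\<in>W. f x = 0"
  obtain n H where H: "H \<in> pfam M n" "\<And>x. f x = poly (H x) (x M)"
    using polyfuns_last_variable[OF f(1)] by blast
  have "\<forall>x\<in>W. poly (H x) (x M) = 0" using f(2) H(2) by simp
  then obtain r q S k where S: "S \<in> pfam M (m - 1)" "\<And>x. x \<in> W \<Longrightarrow> S x = 0"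
    and div: "\<And>x. smult (coeff (D x) m ^ r) (H x) = D x * q x + S x"
    using minimal_relation_divides[OF D H(1)] by metis
  have "coeff (S y) i = 0" for i
    by (rule zariski_hullD[OF y(1) PF.fam_coeff[OF S(1)]]) (simp add: S(2))
  hence "S y = 0" by (intro poly_eqI) simp
  hence "poly (H y) t = 0"
    using arg_cong[OF div[of y], of "\<lambda>p. poly p t"] y(2,3) by simp
  moreover have "H (y(M := t)) = H y"
    by (rule pfam_cong[OF H(1)]) simp
  ultimately show "f (y(M := t)) = 0" by (simp add: H(2))
qed

section \<open>Curve selection\<close>

text \<open>The parameter 0 is excluded from the last condition because \<open>g\<close> may vanish
  at \<open>p\<close>. The curve may leave \<open>W\<close> within its hull: equations of
  \<open>W\<close> still hold on it, and this suffices for the blowup.\<close>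

definition analytic_curve_to ::
    "nat \<Rightarrow> (nat \<Rightarrow> complex) set \<Rightarrow> (nat \<Rightarrow> complex) \<Rightarrow> ((nat \<Rightarrow> complex) \<Rightarrow> complex) \<Rightarrow> bool" where
  "analytic_curve_to M W p g \<longleftrightarrow> (\<exists>c. (\<forall>i<M. (\<lambda>\<epsilon>. c \<epsilon> i) analytic_on {0::complex}) \<and> (\<forall>i<M. c 0 i = p i) \<and>
     (\<forall>\<^sub>F \<epsilon> in at 0. c \<epsilon> \<in> zariski_hull M W \<and> g (c \<epsilon>) \<noteq> 0))"

lemma analytic_along_curve:
  assumes "\<And>i. i < M \<Longrightarrow> (\<lambda>\<epsilon>. c \<epsilon> i) analytic_on {0::complex}"
  shows "f \<in> polyfuns M \<Longrightarrow> (\<lambda>\<epsilon>. f (c \<epsilon>)) analytic_on {0}"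
    and "A \<in> pfam M n \<Longrightarrow> (\<lambda>\<epsilon>. A (c \<epsilon>)) \<in> germs.fam n"
proof -
  have *: "(\<lambda>\<epsilon>. f (c \<epsilon>)) \<in> {f. f analytic_on {0}}" if "f \<in> polyfuns M" for f
    by (rule germs.polyfuns_substitute[OF that]) (use assms in simp)
  show "f \<in> polyfuns M \<Longrightarrow> (\<lambda>\<epsilon>. f (c \<epsilon>)) analytic_on {0}"
    using * by simp
  show "(\<lambda>\<epsilon>. A (c \<epsilon>)) \<in> germs.fam n" if A: "A \<in> pfam M n"
    by (intro germs.famI *[OF PF.fam_coeff[OF A]] PF.fam_degree[OF A])
qed

lemma curve_limit_in_zariski_hull:
  assumes c: "\<And>i. i < M \<Longrightarrow> (\<lambda>\<epsilon>. c \<epsilon> i) analytic_on {0::complex}"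
    and hull: "\<forall>\<^sub>F \<epsilon> in at 0. c \<epsilon> \<in> zariski_hull M W"
  shows "c 0 \<in> zariski_hull M W"
  unfolding zariski_hull_def
proof (intro CollectI ballI impI)
  fix f assume f: "f \<in> polyfuns M" "\<forall>x\<in>W. f x = 0"
  have "((\<lambda>\<epsilon>. f (c \<epsilon>)) \<longlongrightarrow> f (c 0)) (at 0)"
    using analytic_tendsto[OF analytic_along_curve(1)[OF c f(1)]] by (simp add: tendsto_nhds_iff)
  moreover have "\<forall>\<^sub>F \<epsilon> in at 0. f (c \<epsilon>) = 0"
    using hull by (rule eventually_mono) (use f in \<open>simp add: zariski_hull_def\<close>)
  ultimately show "f (c 0) = 0"
    by (intro tendsto_unique[OF _ _ tendsto_eventually, of "at (0::complex)" "\<lambda>\<epsilon>. f (c \<epsilon>)"]) simp_all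
qed

lemma eventually_nhds_imp_at: "eventually P (nhds a) \<Longrightarrow> eventually P (at a)"
  using at_within_le_nhds filter_leD by blast

lemma eventually_at_compose_power:
  assumes "\<forall>\<^sub>F \<epsilon> in at (0::complex). P \<epsilon>" "0 < q"
  shows "\<forall>\<^sub>F \<eta> in at 0. P (\<eta> ^ q)"
proof -
  have "\<forall>\<^sub>F \<epsilon> in nhds 0. \<epsilon> \<noteq> 0 \<longrightarrow> P \<epsilon>"
    using assms(1) by (simp add: eventually_at_filter)
  from eventually_compose_power[OF this assms(2)] assms(2) show ?thesis
    by (simp add: eventually_at_filter)
qed

lemma poly_eventually_nonzero:
  assumes "p \<noteq> (0 :: complex poly)"
  shows "\<forall>\<^sub>F t in at 0. poly p t \<noteq> 0"
proof -
  have "open (- ({t. poly p t = 0} - {0}))"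
    using poly_roots_finite[OF assms] by (intro open_Compl finite_imp_closed) auto
  thus ?thesis
    unfolding eventually_at_topological by (intro exI[of _ "- ({t. poly p t = 0} - {0})"]) auto
qed

lemma polyfuns_line_nonzero:
  assumes "f \<in> polyfuns M" "f b \<noteq> 0"
  shows "\<forall>\<^sub>F t in at 0. f (\<lambda>i. a i + t * (b i - a i)) \<noteq> 0"
proof -
  obtain p where p: "\<forall>t. poly p t = f (\<lambda>i. a i + t * (b i - a i))"
    using polyfuns_line_poly[OF assms(1), of a "\<lambda>i. b i - a i"] by (elim exE)
  have "p \<noteq> 0" using spec[OF p, of 1] assms(2) by auto
  from poly_eventually_nonzero[OF this] show ?thesis using p by simp
qed

text \<open>A form of Cauchy's root bound. It depends continuously on the coefficients and so bounds
  roots along a curve.\<close>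

lemma monic_root_bound:
  fixes p :: "complex poly"
  assumes deg: "degree p \<le> n" and monic: "coeff p n = 1" and root: "poly p z = 0"
  shows "norm z \<le> 1 + (\<Sum>k<n. norm (coeff p k))"
proof (cases "norm z \<le> 1")
  case True
  thus ?thesis by (smt (verit) norm_ge_zero sum_nonneg)
next
  case False
  have n: "0 < n"
  proof (rule ccontr)
    assume "\<not> 0 < n"
    hence "p = [:1:]" using deg monic by (auto elim!: degree_eq_zeroE)
    thus False using root by simp
  qed
  have "z ^ n = - (\<Sum>k<n. coeff p k * z ^ k)"
  proof -
    have "(\<Sum>k\<le>n. coeff p k * z ^ k) = (\<Sum>k<n. coeff p k * z ^ k) + z ^ n"
      using monic by (simp add: lessThan_Suc_atMost[symmetric])
    thus ?thesis using root PF.poly_bounded_degree[OF deg, of z] by (simp add: eq_neg_iff_add_eq_0 add.commute)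
  qed
  hence "norm z ^ n = norm (\<Sum>k<n. coeff p k * z ^ k)"
    by (metis norm_minus_cancel norm_power)
  also have "\<dots> \<le> (\<Sum>k<n. norm (coeff p k) * norm z ^ k)"
    by (rule order_trans[OF norm_sum]) (simp add: norm_mult norm_power)
  also have "\<dots> \<le> (\<Sum>k<n. norm (coeff p k) * norm z ^ (n - 1))"
    using False by (intro sum_mono mult_left_mono power_increasing) auto
  also have "\<dots> = (\<Sum>k<n. norm (coeff p k)) * norm z ^ (n - 1)"
    by (simp add: sum_distrib_right)
  finally have "norm z * norm z ^ (n - 1) \<le> (\<Sum>k<n. norm (coeff p k)) * norm z ^ (n - 1)"
    using n by (simp add: power_eq_if)
  hence "norm z \<le> (\<Sum>k<n. norm (coeff p k))"
  proof (subst (asm) mult_le_cancel_right_pos)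
    show "0 < norm z ^ (n - 1)" using False by (intro zero_less_power) linarith
  qed
  thus ?thesis by simp
qed

text \<open>Irreducibility, hulls and analytic curves are compatible with polynomial changes of
  coordinates, so coordinates may be put in general position.\<close>

lemma curve_transport:
  assumes \<theta>: "\<And>i. i < M \<Longrightarrow> (\<lambda>x. \<theta> x i) \<in> polyfuns M" "\<And>i. i < M \<Longrightarrow> (\<lambda>x. \<theta>' x i) \<in> polyfuns M"
    and inv: "\<And>x. \<theta>' (\<theta> x) = x"
    and W: "irreducible_set M W" "p \<in> zariski_hull M W" "g \<in> polyfuns M"
    and main: "irreducible_set M (\<theta> ` W) \<Longrightarrow> \<theta> p \<in> zariski_hull M (\<theta> ` W) \<Longrightarrow> (\<lambda>x. g (\<theta>' x)) \<in> polyfuns M \<Longrightarrow>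
      analytic_curve_to M (\<theta> ` W) (\<theta> p) (\<lambda>x. g (\<theta>' x))"
  shows "analytic_curve_to M W p g"
proof -
  have subst: "(\<lambda>x. f (\<theta> x)) \<in> polyfuns M" "(\<lambda>x. f (\<theta>' x)) \<in> polyfuns M" if "f \<in> polyfuns M" for f
    using that \<theta> by (auto intro: PF.polyfuns_substitute)
  have "irreducible_set M (\<theta> ` W)"
    unfolding irreducible_set_def
  proof (intro ballI impI)
    fix f g assume fg: "f \<in> polyfuns M" "g \<in> polyfuns M" "\<exists>x\<in>\<theta> ` W. f x \<noteq> 0" "\<exists>x\<in>\<theta> ` W. g x \<noteq> 0"
    from fg(3,4) obtain x y where "x \<in> W" "f (\<theta> x) \<noteq> 0" "y \<in> W" "g (\<theta> y) \<noteq> 0" by auto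
    from irreducible_setD[OF W(1) subst(1)[OF fg(1)] subst(1)[OF fg(2)] this]
    show "\<exists>x\<in>\<theta> ` W. f x \<noteq> 0 \<and> g x \<noteq> 0" by auto
  qed
  moreover have "\<theta> p \<in> zariski_hull M (\<theta> ` W)"
    unfolding zariski_hull_def
  proof (intro CollectI ballI impI)
    fix f assume f: "f \<in> polyfuns M" "\<forall>x\<in>\<theta> ` W. f x = 0"
    show "f (\<theta> p) = 0"
      by (rule zariski_hullD[OF W(2) subst(1)[OF f(1)]]) (use f(2) in auto)
  qed
  ultimately obtain c where c: "\<forall>i<M. (\<lambda>\<epsilon>. c \<epsilon> i) analytic_on {0::complex}" "\<forall>i<M. c 0 i = \<theta> p i"
    "\<forall>\<^sub>F \<epsilon> in at 0. c \<epsilon> \<in> zariski_hull M (\<theta> ` W) \<and> g (\<theta>' (c \<epsilon>)) \<noteq> 0"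
    using main[OF _ _ subst(2)[OF W(3)]] unfolding analytic_curve_to_def by blast
  show ?thesis
    unfolding analytic_curve_to_def
  proof (intro exI[of _ "\<lambda>\<epsilon>. \<theta>' (c \<epsilon>)"] conjI allI impI)
    fix i assume i: "i < M"
    show "(\<lambda>\<epsilon>. \<theta>' (c \<epsilon>) i) analytic_on {0}"
      by (rule analytic_along_curve(1)[OF _ \<theta>(2)[OF i]]) (use c in auto)
    show "\<theta>' (c 0) i = p i"
      using polyfuns_cong[OF \<theta>(2)[OF i], of "c 0" "\<theta> p"] c(2) inv by simp
  next
    show "\<forall>\<^sub>F \<epsilon> in at 0. \<theta>' (c \<epsilon>) \<in> zariski_hull M W \<and> g (\<theta>' (c \<epsilon>)) \<noteq> 0"
      using c(3)
    proof (rule eventually_mono)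
      fix \<epsilon> assume *: "c \<epsilon> \<in> zariski_hull M (\<theta> ` W) \<and> g (\<theta>' (c \<epsilon>)) \<noteq> 0"
      have "\<theta>' (c \<epsilon>) \<in> zariski_hull M W"
        unfolding zariski_hull_def
      proof (intro CollectI ballI impI)
        fix f assume f: "f \<in> polyfuns M" "\<forall>x\<in>W. f x = 0"
        show "f (\<theta>' (c \<epsilon>)) = 0"
          by (rule zariski_hullD[OF conjunct1[OF *] subst(2)[OF f(1)]]) (use f(2) inv in auto)
      qed
      with * show "\<theta>' (c \<epsilon>) \<in> zariski_hull M W \<and> g (\<theta>' (c \<epsilon>)) \<noteq> 0" by simp
    qed
  qed
qed

text \<open>The identity s = g a is an equation of \<open>W\<close> and persists on the hull, so
  there the hypersurface g = 0 can be avoided by controlling the base point alone.\<close>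

lemma norm_nonzero_in_zariski_hull:
  assumes s: "s \<in> polyfuns M" "a \<in> polyfuns (Suc M)" "\<And>x. x \<in> W \<Longrightarrow> s x = g x * a x"
    and g: "g \<in> polyfuns (Suc M)" and y: "y(M := t) \<in> zariski_hull (Suc M) W" "s y \<noteq> 0"
  shows "g (y(M := t)) \<noteq> 0"
proof -
  have "s (y(M := t)) - g (y(M := t)) * a (y(M := t)) = 0"
  proof (rule zariski_hullD[OF y(1), of "\<lambda>x. s x - g x * a x"])
    show "(\<lambda>x. s x - g x * a x) \<in> polyfuns (Suc M)"
      using s g polyfuns_mono[OF s(1), of "Suc M"] by (intro PF.diff PF.mult) auto
  qed (simp add: s)
  moreover have "s (y(M := t)) = s y"
    by (rule polyfuns_cong[OF s(1)]) simp
  ultimately show ?thesis using y(2) by auto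
qed

lemma poly_coeffs_eq:
  assumes "\<And>k t. poly (coeff A k) t = poly (coeff B k) t"
  shows "(A :: complex poly poly) = B"
  by (rule poly_eqI) (use assms poly_eq_poly_eq_iff in blast)

lemma pfam_along_line:
  assumes "A \<in> pfam M n"
  shows "\<exists>A'. degree A' \<le> n \<and> (\<forall>k t. poly (coeff A' k) t = coeff (A (\<lambda>i. x i + t * c i)) k)"
proof -
  have "\<forall>k. \<exists>p. \<forall>t. poly p t = coeff (A (\<lambda>i. x i + t * c i)) k"
    using polyfuns_line_poly[OF PF.fam_coeff[OF assms], of x c] by simp
  from choice[OF this] obtain P where P: "\<forall>k t. poly (P k) t = coeff (A (\<lambda>i. x i + t * c i)) k"
    by (elim exE)
  have "P k = 0" if "n < k" for k
  proof -
    have "poly (P k) t = 0" for t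
      using P PF.fam_degree[OF assms, of "\<lambda>i. x i + t * c i"] that by (simp add: coeff_eq_0)
    thus ?thesis using poly_all_0_iff_0 by blast
  qed
  hence "coeff (\<Sum>k\<le>n. monom (P k) k) k = P k" for k
    by (cases "k \<le> n") (simp_all add: coeff_sum)
  moreover have "degree (\<Sum>k\<le>n. monom (P k) k) \<le> n"
    by (intro degree_sum_le) (auto intro: order_trans[OF degree_monom_le])
  ultimately show ?thesis
    using P by (intro exI[of _ "\<Sum>k\<le>n. monom (P k) k"]) simp
qed

text \<open>Gauss's lemma on every line shows that the leading coefficient of the minimal relation divides
  the other ones.\<close>

lemma minimal_relation_monic:
  assumes D: "minimal_relation M W m D" and dense: "\<forall>f\<in>polyfuns M. (\<forall>x\<in>W. f x = 0) \<longrightarrow> (\<forall>x. f x = 0)"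
    and F: "F \<in> pfam M n" "\<And>x. coeff (F x) n = 1" "\<forall>x\<in>W. poly (F x) (x M) = 0"
  shows "\<exists>Q\<in>pfam M m. (\<forall>x. coeff (Q x) m = 1) \<and> (\<forall>x. D x = smult (coeff (D x) m) (Q x))"
proof -
  define d where "d = (\<lambda>x. coeff (D x) m)"
  have Dm: "D \<in> pfam M m" using D by (simp add: minimal_relation_def)
  obtain w where w: "d w \<noteq> 0" using D by (auto simp: minimal_relation_def d_def)
  obtain r q S l where q: "q \<in> pfam M l" and S: "S \<in> pfam M (m - 1)" "\<And>x. x \<in> W \<Longrightarrow> S x = 0"
    and div: "\<And>x. smult (d x ^ r) (F x) = D x * q x + S x"
    unfolding d_def using minimal_relation_divides[OF D F(1,3)] by metis
  \<comment> \<open>Density turns vanishing on \<open>W\<close> into vanishing everywhere, so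
    \<open>D\<close> divides a multiple of \<open>F\<close> identically, and this can be restricted
    to any line.\<close>
  have "coeff (S x) k = 0" for x k
    using bspec[OF dense PF.fam_coeff[OF S(1), of k]] S(2) by simp
  hence "S x = 0" for x by (intro poly_eqI) simp
  with div have div: "smult (d x ^ r) (F x) = D x * q x" for x by simp
  have "\<exists>Q\<in>polyfuns M. \<forall>x. coeff (D x) k = d x * Q x" for k
  proof (rule polyfuns_divide[where a = w])
    fix x c :: "nat \<Rightarrow> complex" and p b
    assume p: "p \<noteq> 0" "\<forall>t. poly p t = d (\<lambda>i. x i + t * c i)"
      and b: "\<forall>t. poly b t = coeff (D (\<lambda>i. x i + t * c i)) k"
    obtain D' where D': "degree D' \<le> m" "\<And>k t. poly (coeff D' k) t = coeff (D (\<lambda>i. x i + t * c i)) k"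
      using pfam_along_line[OF Dm, of x c] by blast
    obtain F' where F': "degree F' \<le> n" "\<And>k t. poly (coeff F' k) t = coeff (F (\<lambda>i. x i + t * c i)) k"
      using pfam_along_line[OF F(1), of x c] by blast
    obtain q' where q': "\<And>k t. poly (coeff q' k) t = coeff (q (\<lambda>i. x i + t * c i)) k"
      using pfam_along_line[OF q, of x c] by blast
    have "p = coeff D' m"
      by (rule poly_eq_poly_eq_iff[THEN iffD1], rule ext) (simp add: p D' d_def)
    with p(1) D'(1) have lead: "lead_coeff D' = p" "D' \<noteq> 0"
      using le_degree[of D' m] by auto
    have "coeff F' n = 1"
      by (rule poly_eq_poly_eq_iff[THEN iffD1], rule ext) (simp add: F' F(2))
    hence "lead_coeff F' = 1"
      using F'(1) le_degree[of F' n] by auto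
    moreover have "smult (p ^ r) F' = D' * q'"
    proof (rule poly_coeffs_eq)
      fix k t
      have "poly (coeff (smult (p ^ r) F') k) t =
        coeff (smult (d (\<lambda>i. x i + t * c i) ^ r) (F (\<lambda>i. x i + t * c i))) k"
        by (simp add: p F')
      also have "\<dots> = poly (coeff (D' * q') k) t"
        unfolding div by (simp add: coeff_mult poly_sum D' q')
      finally show "poly (coeff (smult (p ^ r) F') k) t = poly (coeff (D' * q') k) t" .
    qed
    ultimately have "p dvd coeff D' k"
      using lead_coeff_dvd_of_monic_multiple[of D' r F' q' k] lead by simp
    moreover have "b = coeff D' k"
      by (rule poly_eq_poly_eq_iff[THEN iffD1], rule ext) (simp add: b D')
    ultimately show "p dvd b" by simp
  qed (use w in \<open>auto simp: d_def intro: PF.fam_coeff[OF Dm]\<close>)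
  hence "\<forall>k. \<exists>Q. Q \<in> polyfuns M \<and> (\<forall>x. coeff (D x) k = d x * Q x)" by blast
  from choice[OF this] obtain Q where Q: "\<And>k. Q k \<in> polyfuns M" "\<And>k x. coeff (D x) k = d x * Q k x"
    by blast
  \<comment> \<open>The top coefficient is put to 1 by hand: the relation for \<open>Q m\<close>
    gives the value 1 only where \<open>d\<close> is nonzero.\<close>
  define Q' where "Q' = (\<lambda>x. \<Sum>k\<le>m. monom (if k = m then 1 else Q k x) k)"
  have co: "coeff (Q' x) k = (if k = m then 1 else if k \<le> m then Q k x else 0)" for x k
    by (simp add: Q'_def coeff_sum)
  have fin: "Q' \<in> pfam M m"
    unfolding Q'_def
  proof (intro PF.fam_sum)
    fix k assume k: "k \<in> {..m}"
    have "(\<lambda>x. if k = m then 1 else Q k x) \<in> polyfuns M"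
      using Q(1) by (cases "k = m") auto
    from PF.fam_mono[OF PF.fam_monom[OF this, of k], of m] k
    show "(\<lambda>x. monom (if k = m then 1 else Q k x) k) \<in> pfam M m" by simp
  qed
  moreover have "D x = smult (d x) (Q' x)" for x
  proof (rule poly_eqI)
    fix k show "coeff (D x) k = coeff (smult (d x) (Q' x)) k"
      using Q(2)[of x k] PF.fam_degree[OF Dm, of x]
      by (auto simp: co d_def coeff_eq_0)
  qed
  ultimately show ?thesis
    using co by (intro bexI[of _ Q']) (auto simp: d_def)
qed

text \<open>The base point moves on a line from \<open>p\<close> towards a point where both the
  leading coefficient and the norm of \<open>g\<close> are nonzero. At \<open>p\<close> itself
  \<open>D\<close> may be the zero polynomial; the monic \<open>Q\<close> is not, and it has the
  root \<open>p M\<close>, at which the Puiseux series starts.\<close>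

lemma curve_on_hypersurface:
  assumes W: "irreducible_set (Suc M) W" and dense: "\<forall>f\<in>polyfuns M. (\<forall>x\<in>W. f x = 0) \<longrightarrow> (\<forall>x. f x = 0)"
    and F: "F \<in> pfam M n" "\<And>x. coeff (F x) n = 1" "\<forall>x\<in>W. poly (F x) (x M) = 0"
    and p: "p \<in> zariski_hull (Suc M) W" and g: "g \<in> polyfuns (Suc M)" "b \<in> W" "g b \<noteq> 0"
  shows "analytic_curve_to (Suc M) W p g"
proof -
  have "F b \<noteq> 0" using F(2)[of b] by auto
  then obtain m D where D: "minimal_relation M W m D"
    using minimal_relation_exists[OF F(1,3) g(2)] by blast
  define d where "d = (\<lambda>x. coeff (D x) m)"
  have Dm: "D \<in> pfam M m" using D by (simp add: minimal_relation_def)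
  have d: "d \<in> polyfuns M" unfolding d_def by (rule PF.fam_coeff[OF Dm])
  obtain w where w: "w \<in> W" "d w \<noteq> 0" using D by (auto simp: minimal_relation_def d_def)
  obtain Q where Q: "Q \<in> pfam M m" "\<And>x. coeff (Q x) m = 1" "\<And>x. D x = smult (d x) (Q x)"
    using minimal_relation_monic[OF D dense F] unfolding d_def by blast
  have QW: "poly (Q x) (x M) = 0" if x: "x \<in> W" for x
  proof (rule ccontr)
    assume nz: "poly (Q x) (x M) \<noteq> 0"
    obtain z where z: "z \<in> W" "d z \<noteq> 0" "poly (Q z) (z M) \<noteq> 0"
      using irreducible_setD[OF W polyfuns_mono[OF d] pfam_last_variable[OF Q(1)] w x nz] by auto
    have "poly (D z) (z M) = 0" using D z(1) by (auto simp: minimal_relation_def)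
    with z Q(3)[of z] show False by simp
  qed
  have Qp: "poly (Q p) (p M) = 0"
    by (rule zariski_hullD[OF p pfam_last_variable[OF Q(1)] QW])
  obtain s a u where s: "s \<in> polyfuns M" "a \<in> polyfuns (Suc M)" "u \<in> W" "s u \<noteq> 0"
    "\<And>x. x \<in> W \<Longrightarrow> s x = g x * a x"
    using minimal_relation_norm[OF W D g] by blast
  obtain z where z: "d z \<noteq> 0" "s z \<noteq> 0"
    using polyfuns_no_zero_divisors[OF d s(1) w(2) s(4)] by blast
  define y where "y = (\<lambda>\<epsilon> i. p i + \<epsilon> * (z i - p i))"
  have y: "(\<lambda>\<epsilon>. y \<epsilon> i) analytic_on {0}" for i
    unfolding y_def by (intro analytic_intros)
  have y0: "y 0 = p" by (simp add: y_def)
  have "Q p \<noteq> 0" using Q(2)[of p] by auto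
  then obtain \<kappa> \<tau> where \<tau>: "0 < \<kappa>" "\<tau> analytic_on {0}" "\<tau> 0 = p M"
    "\<forall>\<^sub>F \<epsilon> in nhds 0. poly (Q (y (\<epsilon> ^ \<kappa>))) (\<tau> \<epsilon>) = 0"
  proof -
    have "(\<lambda>\<epsilon>. Q (y \<epsilon>)) \<in> germs.fam m" by (rule analytic_along_curve(2)[OF y Q(1)])
    moreover have "Q (y 0) \<noteq> 0" "poly (Q (y 0)) (p M) = 0"
      using \<open>Q p \<noteq> 0\<close> Qp y0 by simp_all
    ultimately show ?thesis using puiseux_root[of "\<lambda>\<epsilon>. Q (y \<epsilon>)" m "p M"] that by blast
  qed
  have ev: "\<forall>\<^sub>F \<epsilon> in at 0. d (y \<epsilon>) \<noteq> 0 \<and> s (y \<epsilon>) \<noteq> 0"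
    unfolding y_def using polyfuns_line_nonzero[OF d z(1), of p] polyfuns_line_nonzero[OF s(1) z(2), of p]
    by (rule eventually_conj)
  show ?thesis
    unfolding analytic_curve_to_def
  proof (intro exI[of _ "\<lambda>\<epsilon>. (y (\<epsilon> ^ \<kappa>))(M := \<tau> \<epsilon>)"] conjI allI impI)
    fix i assume "i < Suc M"
    show "(\<lambda>\<epsilon>. ((y (\<epsilon> ^ \<kappa>))(M := \<tau> \<epsilon>)) i) analytic_on {0}"
      using \<tau>(2) analytic_compose_power[OF y \<tau>(1)] by (cases "i = M") auto
    show "((y (0 ^ \<kappa>))(M := \<tau> 0)) i = p i"
      using \<tau>(1,3) y0 by (simp add: zero_power)
  next
    have "\<forall>\<^sub>F \<epsilon> in at 0. poly (Q (y (\<epsilon> ^ \<kappa>))) (\<tau> \<epsilon>) = 0"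
      using \<tau>(4) by (rule eventually_nhds_imp_at)
    thus "\<forall>\<^sub>F \<epsilon> in at 0. (y (\<epsilon> ^ \<kappa>))(M := \<tau> \<epsilon>) \<in> zariski_hull (Suc M) W \<and> g ((y (\<epsilon> ^ \<kappa>))(M := \<tau> \<epsilon>)) \<noteq> 0"
      using eventually_at_compose_power[OF ev \<tau>(1)]
    proof eventually_elim
      case (elim \<epsilon>)
      have "y (\<epsilon> ^ \<kappa>) \<in> zariski_hull M W"
        using dense by (auto simp: zariski_hull_def)
      moreover have "poly (D (y (\<epsilon> ^ \<kappa>))) (\<tau> \<epsilon>) = 0"
        using elim(1) Q(3)[of "y (\<epsilon> ^ \<kappa>)"] by simp
      ultimately have "(y (\<epsilon> ^ \<kappa>))(M := \<tau> \<epsilon>) \<in> zariski_hull (Suc M) W"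
        using elim(2) by (intro minimal_relation_lift[OF D]) (auto simp: d_def)
      with norm_nonzero_in_zariski_hull[OF s(1,2,5) g(1) this] elim(2) show ?case by simp
    qed
  qed
qed

text \<open>The lift of a curve stays bounded because the last coordinate is integral over the other ones.
  So it has a limit, which lies in the fibre of \<open>p\<close> and is therefore \<open>p\<close> itself.\<close>

lemma curve_lift:
  assumes IH: "\<And>g b. g \<in> polyfuns M \<Longrightarrow> b \<in> W \<Longrightarrow> g b \<noteq> 0 \<Longrightarrow> analytic_curve_to M W p g"
    and W: "irreducible_set (Suc M) W"
    and F: "F \<in> pfam M n" "\<And>x. coeff (F x) n = 1" "\<forall>x\<in>W. poly (F x) (x M) = 0"
    and fibre: "\<And>x. x \<in> zariski_hull (Suc M) W \<Longrightarrow> \<forall>i<M. x i = p i \<Longrightarrow> x M = p M"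
    and g: "g \<in> polyfuns (Suc M)" "b \<in> W" "g b \<noteq> 0"
  shows "analytic_curve_to (Suc M) W p g"
proof -
  have "F b \<noteq> 0" using F(2)[of b] by auto
  then obtain m D where D: "minimal_relation M W m D"
    using minimal_relation_exists[OF F(1,3) g(2)] by blast
  define d where "d = (\<lambda>x. coeff (D x) m)"
  have Dm: "D \<in> pfam M m" and m: "0 < m" using D by (simp_all add: minimal_relation_def)
  have d: "d \<in> polyfuns M" unfolding d_def by (rule PF.fam_coeff[OF Dm])
  obtain w where w: "w \<in> W" "d w \<noteq> 0" using D by (auto simp: minimal_relation_def d_def)
  obtain s a u where s: "s \<in> polyfuns M" "a \<in> polyfuns (Suc M)" "u \<in> W" "s u \<noteq> 0"
    "\<And>x. x \<in> W \<Longrightarrow> s x = g x * a x"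
    using minimal_relation_norm[OF W D g] by blast
  \<comment> \<open>The induction hypothesis is applied to one product with two purposes: where
    \<open>d\<close> is nonzero the roots of \<open>D\<close> lift into the hull, and where
    \<open>s\<close> is nonzero the lift avoids g = 0.\<close>
  obtain z where z: "z \<in> W" "d z * s z \<noteq> 0"
    using irreducible_setD[OF irreducible_set_mono[OF W, of M] d s(1) w s(3,4)] by auto
  obtain y where y: "\<And>i. i < M \<Longrightarrow> (\<lambda>\<epsilon>. y \<epsilon> i) analytic_on {0::complex}" "\<And>i. i < M \<Longrightarrow> y 0 i = p i"
    "\<forall>\<^sub>F \<epsilon> in at 0. y \<epsilon> \<in> zariski_hull M W \<and> d (y \<epsilon>) * s (y \<epsilon>) \<noteq> 0"
  proof -
    have "analytic_curve_to M W p (\<lambda>x. d x * s x)"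
      by (rule IH[where b = z]) (use z PF.mult[OF d s(1)] in auto)
    thus ?thesis unfolding analytic_curve_to_def using that by (elim exE conjE) blast
  qed
  define \<delta> where "\<delta> = (\<lambda>\<epsilon>. d (y \<epsilon>))"
  have \<delta>: "\<delta> analytic_on {0}" unfolding \<delta>_def by (rule analytic_along_curve(1)[OF y(1) d])
  \<comment> \<open>The roots of this polynomial are \<delta> times those of \<open>D\<close>. It is
    monic even where \<delta> vanishes, in particular possibly at \<epsilon> = 0, so Puiseux's
    theorem applies.\<close>
  define A where "A = (\<lambda>\<epsilon>. \<Sum>k\<le>m. monom (if k = m then 1 else coeff (D (y \<epsilon>)) k * \<delta> \<epsilon> ^ (m - 1 - k)) k)"
  have coeff_D: "(\<lambda>\<epsilon>. coeff (D (y \<epsilon>)) k) analytic_on {0}" for k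
    by (rule analytic_along_curve(1)[OF y(1) PF.fam_coeff[OF Dm]])
  have A: "A \<in> germs.fam m"
    unfolding A_def
  proof (intro germs.fam_sum)
    fix k assume k: "k \<in> {..m}"
    have "(\<lambda>\<epsilon>. if k = m then 1 else coeff (D (y \<epsilon>)) k * \<delta> \<epsilon> ^ (m - 1 - k)) \<in> {f. f analytic_on {0}}"
      using coeff_D \<delta> by (cases "k = m") (auto intro!: analytic_intros)
    from germs.fam_mono[OF germs.fam_monom[OF this, of k], of m] k
    show "(\<lambda>\<epsilon>. monom (if k = m then 1 else coeff (D (y \<epsilon>)) k * \<delta> \<epsilon> ^ (m - 1 - k)) k) \<in> germs.fam m" by simp
  qed
  have coeff_A: "coeff (A \<epsilon>) m = 1" for \<epsilon>
    by (simp add: A_def coeff_sum)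
  have A_D: "poly (A \<epsilon>) (\<delta> \<epsilon> * T) = \<delta> \<epsilon> ^ (m - 1) * poly (D (y \<epsilon>)) T" for \<epsilon> T
  proof -
    have "poly (A \<epsilon>) (\<delta> \<epsilon> * T) =
        (\<Sum>k\<le>m. (if k = m then 1 else coeff (D (y \<epsilon>)) k * \<delta> \<epsilon> ^ (m - 1 - k)) * (\<delta> \<epsilon> * T) ^ k)"
      by (simp add: A_def poly_sum poly_monom)
    also have "\<dots> = (\<Sum>k\<le>m. \<delta> \<epsilon> ^ (m - 1) * (coeff (D (y \<epsilon>)) k * T ^ k))"
    proof (rule sum.cong)
      fix k assume k: "k \<in> {..m}"
      show "(if k = m then 1 else coeff (D (y \<epsilon>)) k * \<delta> \<epsilon> ^ (m - 1 - k)) * (\<delta> \<epsilon> * T) ^ k =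
          \<delta> \<epsilon> ^ (m - 1) * (coeff (D (y \<epsilon>)) k * T ^ k)"
      proof (cases "k = m")
        case True
        have "\<delta> \<epsilon> ^ m = \<delta> \<epsilon> ^ (m - 1) * coeff (D (y \<epsilon>)) m"
          using m by (simp add: \<delta>_def d_def power_eq_if)
        with True show ?thesis by (simp add: power_mult_distrib)
      next
        case False
        hence "\<delta> \<epsilon> ^ (m - 1) = \<delta> \<epsilon> ^ (m - 1 - k) * \<delta> \<epsilon> ^ k"
          using k by (simp add: power_add[symmetric])
        with False show ?thesis by (simp add: power_mult_distrib)
      qed
    qed simp
    also have "\<dots> = \<delta> \<epsilon> ^ (m - 1) * poly (D (y \<epsilon>)) T"
      by (simp add: PF.poly_bounded_degree[OF PF.fam_degree[OF Dm]] sum_distrib_left)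
    finally show ?thesis .
  qed
  have "A 0 \<noteq> 0" using coeff_A[of 0] by auto
  \<comment> \<open>Any root will do, since the limit of the lift is determined afterwards by the
    fibre condition.\<close>
  moreover obtain \<alpha> where "poly (A 0) \<alpha> = 0"
  proof -
    have "m \<le> degree (A 0)" using coeff_A[of 0] by (intro le_degree) simp
    thus ?thesis
      using m Fundamental_Theorem_Algebra.fundamental_theorem_of_algebra[of "A 0"] that by (auto simp: constant_degree)
  qed
  ultimately obtain \<kappa> \<tau> where \<tau>: "0 < \<kappa>" "\<tau> analytic_on {0}" "\<forall>\<^sub>F \<epsilon> in nhds 0. poly (A (\<epsilon> ^ \<kappa>)) (\<tau> \<epsilon>) = 0"
    using puiseux_root[OF A] by blast
  define v where "v = (\<lambda>\<epsilon>. \<tau> \<epsilon> / \<delta> (\<epsilon> ^ \<kappa>))"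
  define x where "x = (\<lambda>\<epsilon>. (y (\<epsilon> ^ \<kappa>))(M := v \<epsilon>))"
  have "\<forall>\<^sub>F \<epsilon> in at 0. poly (A (\<epsilon> ^ \<kappa>)) (\<tau> \<epsilon>) = 0"
    using \<tau>(3) by (rule eventually_nhds_imp_at)
  hence good: "\<forall>\<^sub>F \<epsilon> in at 0. \<delta> (\<epsilon> ^ \<kappa>) \<noteq> 0 \<and> x \<epsilon> \<in> zariski_hull (Suc M) W \<and> g (x \<epsilon>) \<noteq> 0"
    using eventually_at_compose_power[OF y(3) \<tau>(1)]
  proof eventually_elim
    case (elim \<epsilon>)
    hence nz: "\<delta> (\<epsilon> ^ \<kappa>) \<noteq> 0" "s (y (\<epsilon> ^ \<kappa>)) \<noteq> 0" by (auto simp: \<delta>_def)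
    have "poly (D (y (\<epsilon> ^ \<kappa>))) (v \<epsilon>) = 0"
      using A_D[of "\<epsilon> ^ \<kappa>" "v \<epsilon>"] elim(1) nz by (simp add: v_def)
    hence hull: "x \<epsilon> \<in> zariski_hull (Suc M) W"
      unfolding x_def using elim nz by (intro minimal_relation_lift[OF D]) (auto simp: \<delta>_def d_def)
    from norm_nonzero_in_zariski_hull[where s = s and a = a, OF s(1,2,5) g(1) this[unfolded x_def] nz(2)] hull nz(1) show ?case
      by (simp add: x_def)
  qed
  obtain B where B: "\<forall>\<^sub>F \<epsilon> in at 0. norm (v \<epsilon>) \<le> B"
  proof -
    define C where "C = (\<lambda>\<epsilon>. 1 + (\<Sum>k<n. norm (coeff (F (y (\<epsilon> ^ \<kappa>))) k)))"
    have coeff_F: "(\<lambda>\<epsilon>. coeff (F (y \<epsilon>)) k) analytic_on {0}" for k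
      by (rule analytic_along_curve(1)[OF y(1) PF.fam_coeff[OF F(1)]])
    have "(C \<longlongrightarrow> C 0) (nhds 0)"
      unfolding C_def
      by (intro tendsto_add tendsto_const tendsto_sum tendsto_norm
            analytic_tendsto[OF analytic_compose_power[OF coeff_F \<tau>(1)]])
    hence "\<forall>\<^sub>F \<epsilon> in nhds 0. C \<epsilon> < C 0 + 1"
      by (rule order_tendstoD) simp
    hence "\<forall>\<^sub>F \<epsilon> in at 0. C \<epsilon> < C 0 + 1"
      by (rule eventually_nhds_imp_at)
    hence "\<forall>\<^sub>F \<epsilon> in at 0. norm (v \<epsilon>) \<le> C 0 + 1"
      using good
    proof eventually_elim
      case (elim \<epsilon>)
      have "poly (F (x \<epsilon>)) (x \<epsilon> M) = 0"
      proof (rule zariski_hullD[OF _ pfam_last_variable[OF F(1)]])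
        show "x \<epsilon> \<in> zariski_hull (Suc M) W" using elim by simp
      qed (use F(3) in simp)
      moreover have "F (x \<epsilon>) = F (y (\<epsilon> ^ \<kappa>))"
        by (rule pfam_cong[OF F(1)]) (simp add: x_def)
      ultimately have "norm (v \<epsilon>) \<le> C \<epsilon>"
        unfolding C_def using F(2) by (intro monic_root_bound PF.fam_degree[OF F(1)]) (auto simp: x_def)
      with elim(1) show ?case by simp
    qed
    thus ?thesis by (rule that)
  qed
  \<comment> \<open>The quotient might have a pole at 0. Boundedness, which stems from the monic
    \<open>F\<close>, makes the singularity removable.\<close>
  obtain v' where v': "v' analytic_on {0}" "\<forall>\<^sub>F \<epsilon> in at 0. v' \<epsilon> = v \<epsilon>"
  proof -
    obtain r1 where r1: "0 < r1" "\<tau> holomorphic_on ball 0 r1"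
      using \<tau>(2) by (auto simp: analytic_at_ball)
    obtain r2 where r2: "0 < r2" "(\<lambda>\<epsilon>. \<delta> (\<epsilon> ^ \<kappa>)) holomorphic_on ball 0 r2"
      using analytic_compose_power[OF \<delta> \<tau>(1)] by (auto simp: analytic_at_ball)
    obtain r3 where r3: "0 < r3" "\<And>\<epsilon>. \<epsilon> \<noteq> 0 \<Longrightarrow> norm \<epsilon> < r3 \<Longrightarrow> \<delta> (\<epsilon> ^ \<kappa>) \<noteq> 0"
      using good unfolding eventually_at by (auto simp: dist_norm)
    define r where "r = min r1 (min r2 r3)"
    have r: "0 < r" "r \<le> r1" "r \<le> r2" "r \<le> r3" using r1 r2 r3 by (auto simp: r_def)
    have "v holomorphic_on ball 0 r - {0}"
      unfolding v_def
      by (intro holomorphic_on_divide holomorphic_on_subset[OF r1(2)] holomorphic_on_subset[OF r2(2)])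
         (use r r3 in auto)
    then obtain v' where "v' holomorphic_on ball 0 r" "\<forall>\<epsilon>\<in>ball 0 r - {0}. v' \<epsilon> = v \<epsilon>"
      using holomorphic_on_extend_bounded[of v "ball 0 r" 0] B r by auto
    thus ?thesis
      using r by (intro that[of v']) (auto simp: analytic_at_ball eventually_at dist_norm)
  qed
  define c where "c = (\<lambda>\<epsilon>. (y (\<epsilon> ^ \<kappa>))(M := v' \<epsilon>))"
  have c: "(\<lambda>\<epsilon>. c \<epsilon> i) analytic_on {0}" if "i < Suc M" for i
    using v'(1) analytic_compose_power[OF y(1) \<tau>(1)] that by (cases "i = M") (auto simp: c_def)
  have hull: "\<forall>\<^sub>F \<epsilon> in at 0. c \<epsilon> \<in> zariski_hull (Suc M) W \<and> g (c \<epsilon>) \<noteq> 0"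
    using good v'(2) by eventually_elim (simp add: c_def x_def)
  have "c 0 \<in> zariski_hull (Suc M) W"
    by (rule curve_limit_in_zariski_hull[OF c]) (use hull in \<open>auto elim: eventually_mono\<close>)
  moreover have cM: "c 0 i = p i" if "i < M" for i
    using that \<tau>(1) y(2) by (simp add: c_def zero_power)
  ultimately have "c 0 M = p M" using fibre[of "c 0"] by simp
  with cM have "\<forall>i<Suc M. c 0 i = p i" by (auto simp: less_Suc_eq)
  with c hull show ?thesis
    unfolding analytic_curve_to_def by (intro exI[of _ c] conjI allI impI) simp_all
qed

section \<open>Generic coordinates and the induction\<close>

definition shear :: "nat \<Rightarrow> (nat \<Rightarrow> complex) \<Rightarrow> (nat \<Rightarrow> complex) \<Rightarrow> nat \<Rightarrow> complex" where
  "shear k c x = (\<lambda>i. if i < k then x i - x k * c i else x i)"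

lemma shear_inverse: "shear k (\<lambda>i. - c i) (shear k c x) = x"
  by (auto simp: shear_def fun_eq_iff)

lemma shear_polyfuns: "k < M \<Longrightarrow> i < M \<Longrightarrow> (\<lambda>x. shear k c x i) \<in> polyfuns M"
  unfolding shear_def by (cases "i < k") (auto intro!: PF.diff PF.mult polyfuns.coord)

text \<open>The core of Noether normalization. Writing a point as a base point with
  \<open>k\<close>-th coordinate 0 plus a multiple of \<open>c\<close> makes \<open>c\<close> the
  direction of the coordinate \<open>k\<close>, and in that direction \<open>f\<close> has a
  constant leading coefficient.\<close>

lemma shear_monic:
  assumes f: "f \<in> polyfuns (Suc k)" and nz: "f z \<noteq> 0"
  shows "\<exists>c e F. F \<in> pfam k e \<and> (\<forall>x. coeff (F x) e = 1) \<and>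
           (\<forall>x. f (shear k (\<lambda>i. - c i) x) = 0 \<longrightarrow> poly (F x) (x k) = 0)"
proof -
  show ?thesis
    using monic_direction[OF f nz]
  proof (elim exE bexE conjE)
    fix c e \<gamma> \<Delta>
    assume c: "c k = 1" "\<gamma> \<noteq> 0" and \<Delta>: "\<Delta> \<in> pfam (Suc k) e"
      "\<forall>x. coeff (\<Delta> x) e = \<gamma>" "\<forall>x t. poly (\<Delta> x) t = f (\<lambda>i. x i + t * c i)"
    \<comment> \<open>The base point of the line is taken in the hyperplane where the coordinate
      \<open>k\<close> is 0, so that this coordinate itself is the parameter on the line.\<close>
    define F where "F = (\<lambda>x. smult (inverse \<gamma>) (\<Delta> (x(k := 0))))"
    have "F \<in> pfam k e"
    proof (rule PF.famI)
      fix i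
      have "(\<lambda>x. coeff (\<Delta> (x(k := 0))) i) \<in> polyfuns k"
      proof (rule PF.polyfuns_substitute[OF PF.fam_coeff[OF \<Delta>(1)]])
        fix j assume "j < Suc k"
        thus "(\<lambda>x. (x(k := 0)) j) \<in> polyfuns k"
          by (cases "j = k") (auto intro: polyfuns.coord)
      qed
      thus "(\<lambda>x. coeff (F x) i) \<in> polyfuns k"
        by (simp add: F_def PF.mult)
      show "degree (F x) \<le> e" for x
        unfolding F_def by (rule order_trans[OF degree_smult_le PF.fam_degree[OF \<Delta>(1)]])
    qed
    moreover have "coeff (F x) e = 1" for x
      using c by (simp add: F_def \<Delta>)
    moreover have "poly (F x) (x k) = 0" if "f (shear k (\<lambda>i. - c i) x) = 0" for x
    proof -
      have "f (\<lambda>i. (x(k := 0)) i + x k * c i) = f (shear k (\<lambda>i. - c i) x)"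
        using c by (intro polyfuns_cong[OF f]) (auto simp: shear_def less_Suc_eq)
      with that show ?thesis by (simp add: F_def \<Delta>)
    qed
    ultimately show ?thesis
      by (intro exI[of _ c] exI[of _ e] exI[of _ F]) blast
  qed
qed

text \<open>The two monic relations make the projection to the first \<open>K\<close> coordinates
  finite, so \<open>Z\<close> contains all last two coordinates that can occur over those of
  \<open>p\<close>. Replacing the coordinate \<open>x K\<close> by x_K + \<eta> x_M yields a
  projection to \<open>M\<close> coordinates to which \<open>curve_lift\<close> applies.\<close>

lemma curve_selection_finite_fibre:
  assumes IH: "\<And>W p g b. irreducible_set M W \<Longrightarrow> p \<in> zariski_hull M W \<Longrightarrow> g \<in> polyfuns M \<Longrightarrow> b \<in> W \<Longrightarrow>
      g b \<noteq> 0 \<Longrightarrow> analytic_curve_to M W p g"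
    and W: "irreducible_set (Suc M) W" "p \<in> zariski_hull (Suc M) W"
    and g: "g \<in> polyfuns (Suc M)" "b \<in> W" "g b \<noteq> 0"
    and M: "M = Suc K"
    and F: "F \<in> pfam M n" "\<And>x. coeff (F x) n = 1" "\<forall>x\<in>W. poly (F x) (x M) = 0"
    and G: "G \<in> pfam K k" "\<And>x. coeff (G x) k = 1" "\<forall>x\<in>W. poly (G x) (x K) = 0"
  shows "analytic_curve_to (Suc M) W p g"
proof -
  define Z where "Z = Sigma {\<alpha>. poly (G p) \<alpha> = 0} (\<lambda>\<alpha>. {\<beta>. poly (F (p(K := \<alpha>))) \<beta> = 0})"
  have "G p \<noteq> 0" using G(2)[of p] by auto
  moreover have "F x \<noteq> 0" for x using F(2)[of x] by auto
  ultimately have "finite Z"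
    unfolding Z_def by (intro finite_SigmaI poly_roots_finite) auto
  hence "finite (insert 0 ((\<lambda>(\<alpha>, \<beta>). (p K - \<alpha>) / (\<beta> - p M)) ` Z))" by simp
  then obtain \<eta> where \<eta>: "\<eta> \<notin> insert 0 ((\<lambda>(\<alpha>, \<beta>). (p K - \<alpha>) / (\<beta> - p M)) ` Z)"
    using ex_new_if_finite[OF infinite_UNIV_char_0] by metis
  txt \<open>By the choice of \<open>\<eta>\<close>, the function \<open>x\<^sub>K + \<eta> x\<^sub>M\<close> separates \<open>p\<close> from the other points with the same
    first \<open>K\<close> coordinates.\<close>
  have \<eta>0: "\<eta> \<noteq> 0" using \<eta> by simp
  have sep: "\<beta> = p M" if "(\<alpha>, \<beta>) \<in> Z" "\<alpha> + \<eta> * \<beta> = p K + \<eta> * p M" for \<alpha> \<beta>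
  proof (rule ccontr)
    assume "\<beta> \<noteq> p M"
    have "\<eta> * (\<beta> - p M) = p K - \<alpha>" using that(2) by (simp add: algebra_simps)
    hence "\<eta> = (p K - \<alpha>) / (\<beta> - p M)"
      using \<open>\<beta> \<noteq> p M\<close> by (simp add: field_simps)
    with \<eta> that(1) show False by force
  qed
  define \<theta> where "\<theta> = (\<lambda>x :: nat \<Rightarrow> complex. x(K := x K + \<eta> * x M))"
  define \<theta>' where "\<theta>' = (\<lambda>x :: nat \<Rightarrow> complex. x(K := x K - \<eta> * x M))"
  have inv: "\<theta>' (\<theta> x) = x" "\<theta> (\<theta>' x) = x" for x
    using M by (auto simp: \<theta>_def \<theta>'_def)
  have \<theta>_poly: "(\<lambda>x. \<theta> x i) \<in> polyfuns (Suc M)" "(\<lambda>x. \<theta>' x i) \<in> polyfuns (Suc M)" if "i < Suc M" for i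
    using that M unfolding \<theta>_def \<theta>'_def fun_upd_def
    by (cases "i = K", auto intro!: PF.add PF.diff PF.mult polyfuns.coord)+
  show ?thesis
  proof (rule curve_transport[where \<theta> = \<theta> and \<theta>' = \<theta>', OF \<theta>_poly inv(1) W g(1)])
    assume W': "irreducible_set (Suc M) (\<theta> ` W)" "\<theta> p \<in> zariski_hull (Suc M) (\<theta> ` W)"
      and g': "(\<lambda>x. g (\<theta>' x)) \<in> polyfuns (Suc M)"
    \<comment> \<open>This is \<open>G\<close> rewritten in the new coordinates, where the old
      coordinate is x_K - \<eta> x_M. Since \<eta> is nonzero, its leading coefficient in x_M is the
      constant (-\<eta>)^k, which is divided out.\<close>
    define H where "H = (\<lambda>x :: nat \<Rightarrow> complex. smult (inverse ((- \<eta>) ^ k)) (pcompose (G x) [:x K, - \<eta>:]))"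
    have GM: "G \<in> pfam M k"
      using G(1) polyfuns_mono[of _ K M] M by (auto simp: PF.fam_def)
    have H: "H \<in> pfam M k"
    proof -
      have "(\<lambda>x. [:x K, - \<eta>:]) \<in> pfam M 1"
        using M by (intro PF.fam_linear) (auto intro: polyfuns.coord)
      from PF.fam_pcompose[OF GM this] show ?thesis
        unfolding H_def by (intro PF.fam_smult) auto
    qed
    have H1: "coeff (H x) k = 1" for x
    proof -
      have "degree (G x) = k"
        using PF.fam_degree[OF G(1), of x] G(2)[of x] le_degree[of "G x" k] by simp
      moreover have "coeff (pcompose (G x) [:x K, - \<eta>:]) (degree (G x)) = lead_coeff (G x) * (- \<eta>) ^ degree (G x)"
        using lead_coeff_comp[of "[:x K, - \<eta>:]" "G x"] \<eta>0 by (simp add: degree_pcompose)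
      ultimately show ?thesis
        using G(2)[of x] \<eta>0 by (simp add: H_def)
    qed
    have HW: "\<forall>x\<in>\<theta> ` W. poly (H x) (x M) = 0"
    proof
      fix x assume "x \<in> \<theta> ` W"
      then obtain y where y: "y \<in> W" "x = \<theta> y" by blast
      have "G x = G y"
        by (rule pfam_cong[OF G(1)]) (simp add: y \<theta>_def)
      with G(3) y M show "poly (H x) (x M) = 0"
        by (simp add: H_def poly_pcompose \<theta>_def)
    qed
    show "analytic_curve_to (Suc M) (\<theta> ` W) (\<theta> p) (\<lambda>x. g (\<theta>' x))"
    proof (rule curve_lift[where g = "\<lambda>x. g (\<theta>' x)" and b = "\<theta> b", OF _ W'(1) H H1 HW _ g'])
      show "analytic_curve_to M (\<theta> ` W) (\<theta> p) g0" if "g0 \<in> polyfuns M" "b0 \<in> \<theta> ` W" "g0 b0 \<noteq> 0" for g0 b0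
      proof (rule IH[where g = g0 and b = b0, OF _ _ that])
        show "irreducible_set M (\<theta> ` W)" by (rule irreducible_set_mono[OF W'(1)]) simp
        show "\<theta> p \<in> zariski_hull M (\<theta> ` W)" using zariski_hull_mono[of M "Suc M"] W'(2) by auto
      qed
      show "\<theta> b \<in> \<theta> ` W" "g (\<theta>' (\<theta> b)) \<noteq> 0" using g by (auto simp: inv)
      fix x assume x: "x \<in> zariski_hull (Suc M) (\<theta> ` W)" "\<forall>i<M. x i = \<theta> p i"
      define y where "y = \<theta>' x"
      have y_hull: "f y = 0" if f: "f \<in> polyfuns (Suc M)" "\<forall>w\<in>W. f w = 0" for f
        unfolding y_def
        by (rule zariski_hullD[OF x(1) PF.polyfuns_substitute[OF f(1)]]) (use \<theta>_poly f(2) inv in auto)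
      have yi: "y i = p i" if "i < K" for i
        using x(2) that M by (simp add: y_def \<theta>'_def \<theta>_def)
      have yK: "y K + \<eta> * y M = p K + \<eta> * p M" and yM: "y M = x M"
        using x(2) M by (auto simp: y_def \<theta>'_def \<theta>_def)
      have "G y = G p" by (rule pfam_cong[OF G(1) yi])
      moreover have "poly (G y) (y K) = 0"
        by (rule y_hull) (use pfam_last_variable[OF G(1)] G(3) M in \<open>auto intro: polyfuns_mono\<close>)
      moreover have "poly (F y) (y M) = 0"
        by (rule y_hull) (use pfam_last_variable[OF F(1)] F(3) in auto)
      moreover have "F y = F (p(K := y K))"
        by (rule pfam_cong[OF F(1)]) (use yi M in \<open>auto simp: less_Suc_eq\<close>)
      ultimately have "(y K, y M) \<in> Z" by (simp add: Z_def)
      from sep[OF this yK] show "x M = \<theta> p M" using yM M by (simp add: \<theta>_def)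
    qed
  qed
qed

lemma curve_selection_monic:
  assumes IH: "\<And>W p g b. irreducible_set M W \<Longrightarrow> p \<in> zariski_hull M W \<Longrightarrow> g \<in> polyfuns M \<Longrightarrow> b \<in> W \<Longrightarrow>
      g b \<noteq> 0 \<Longrightarrow> analytic_curve_to M W p g"
    and W: "irreducible_set (Suc M) W" "p \<in> zariski_hull (Suc M) W"
    and g: "g \<in> polyfuns (Suc M)" "b \<in> W" "g b \<noteq> 0"
    and F: "F \<in> pfam M n" "\<And>x. coeff (F x) n = 1" "\<forall>x\<in>W. poly (F x) (x M) = 0"
  shows "analytic_curve_to (Suc M) W p g"
proof (cases "\<forall>f\<in>polyfuns M. (\<forall>x\<in>W. f x = 0) \<longrightarrow> (\<forall>x. f x = 0)")
  case True
  thus ?thesis by (rule curve_on_hypersurface[where g = g and b = b, OF W(1) _ F W(2) g])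
next
  case False
  then obtain f z where f: "f \<in> polyfuns M" "\<forall>x\<in>W. f x = 0" "f z \<noteq> 0" by blast
  have "M \<noteq> 0"
  proof
    assume "M = 0"
    hence "f z = f b" by (intro polyfuns_cong[OF f(1)]) simp
    with f g(2) show False by simp
  qed
  then obtain K where M: "M = Suc K" by (cases M) auto
  obtain c e G where G: "G \<in> pfam K e" "\<forall>x. coeff (G x) e = 1"
    "\<forall>x. f (shear K (\<lambda>i. - c i) x) = 0 \<longrightarrow> poly (G x) (x K) = 0"
    using shear_monic[OF f(1)[unfolded M] f(3)] by blast
  define \<theta> where "\<theta> = shear K c"
  define \<theta>' where "\<theta>' = shear K (\<lambda>i. - c i)"
  have inv: "\<theta>' (\<theta> x) = x" for x
    by (simp add: \<theta>_def \<theta>'_def shear_inverse)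
  have \<theta>_poly: "(\<lambda>x. \<theta> x i) \<in> polyfuns N" "(\<lambda>x. \<theta>' x i) \<in> polyfuns N" if "i < N" "K < N" for i N
    using that shear_polyfuns by (auto simp: \<theta>_def \<theta>'_def)
  show ?thesis
  proof (rule curve_transport[where \<theta> = \<theta> and \<theta>' = \<theta>', OF _ _ inv W g(1)])
    assume W': "irreducible_set (Suc M) (\<theta> ` W)" "\<theta> p \<in> zariski_hull (Suc M) (\<theta> ` W)"
      and g': "(\<lambda>x. g (\<theta>' x)) \<in> polyfuns (Suc M)"
    \<comment> \<open>The shear affects only coordinates below \<open>K\<close> and leaves x_M
      alone, so the relation for x_M stays monic and only its coefficients are transformed.\<close>
    define F' where "F' = (\<lambda>x. F (\<theta>' x))"
    have F': "F' \<in> pfam M n"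
      unfolding F'_def
    proof (rule PF.famI)
      show "(\<lambda>x. coeff (F (\<theta>' x)) k) \<in> polyfuns M" for k
        by (rule PF.polyfuns_substitute[OF PF.fam_coeff[OF F(1)]]) (use \<theta>_poly(2)[of _ M] M in auto)
    qed (rule PF.fam_degree[OF F(1)])
    show "analytic_curve_to (Suc M) (\<theta> ` W) (\<theta> p) (\<lambda>x. g (\<theta>' x))"
    proof (rule curve_selection_finite_fibre[where g = "\<lambda>x. g (\<theta>' x)" and b = "\<theta> b", OF IH W' g' _ _ M F' _ _ G(1)])
      show "\<theta> b \<in> \<theta> ` W" "g (\<theta>' (\<theta> b)) \<noteq> 0" using g by (auto simp: inv)
      show "coeff (F' x) n = 1" for x by (simp add: F'_def F)
      show "\<forall>x\<in>\<theta> ` W. poly (F' x) (x M) = 0"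
        using F(3) M by (auto simp: F'_def inv) (simp add: \<theta>_def shear_def)
      show "coeff (G x) e = 1" for x using G(2) by simp
      show "\<forall>x\<in>\<theta> ` W. poly (G x) (x K) = 0"
      proof
        fix x assume "x \<in> \<theta> ` W"
        hence "\<theta>' x \<in> W" by (auto simp: inv)
        hence "f (\<theta>' x) = 0" using f(2) by blast
        thus "poly (G x) (x K) = 0" using G(3) unfolding \<theta>'_def by blast
      qed
    qed
  qed (use \<theta>_poly M in auto)
qed

theorem curve_selection:
  assumes "irreducible_set M W" "p \<in> zariski_hull M W" "g \<in> polyfuns M" "b \<in> W" "g b \<noteq> 0"
  shows "analytic_curve_to M W p g"
  using assms
proof (induction M arbitrary: W p g b)
  case 0
  have "g p = g b"
    by (rule polyfuns_cong[OF 0(3)]) simp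
  with 0 show ?case
    unfolding analytic_curve_to_def by (intro exI[of _ "\<lambda>_. p"]) simp
next
  case (Suc M)
  show ?case
  proof (cases "\<forall>f\<in>polyfuns (Suc M). (\<forall>x\<in>W. f x = 0) \<longrightarrow> (\<forall>x. f x = 0)")
    case True
    \<comment> \<open>No equation restricts the curve, so the line from \<open>p\<close> towards
      \<open>b\<close> works.\<close>
    hence "x \<in> zariski_hull (Suc M) W" for x by (auto simp: zariski_hull_def)
    moreover have "(\<lambda>\<epsilon>. p i + \<epsilon> * (b i - p i)) analytic_on {0}" for i
      by (intro analytic_intros)
    ultimately show ?thesis
      using polyfuns_line_nonzero[OF Suc.prems(3,5), of p]
      unfolding analytic_curve_to_def
      by (intro exI[of _ "\<lambda>\<epsilon> i. p i + \<epsilon> * (b i - p i)"]) simp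
  next
    case False
    then obtain f z where f: "f \<in> polyfuns (Suc M)" "\<forall>x\<in>W. f x = 0" "f z \<noteq> 0" by blast
    obtain c e F where F: "F \<in> pfam M e" "\<forall>x. coeff (F x) e = 1"
      "\<forall>x. f (shear M (\<lambda>i. - c i) x) = 0 \<longrightarrow> poly (F x) (x M) = 0"
      using shear_monic[OF f(1,3)] by blast
    define \<theta> where "\<theta> = shear M c"
    define \<theta>' where "\<theta>' = shear M (\<lambda>i. - c i)"
    have inv: "\<theta>' (\<theta> x) = x" for x
      by (simp add: \<theta>_def \<theta>'_def shear_inverse)
    show ?thesis
    proof (rule curve_transport[where \<theta> = \<theta> and \<theta>' = \<theta>', OF _ _ inv Suc.prems(1-3)])
      assume W': "irreducible_set (Suc M) (\<theta> ` W)" "\<theta> p \<in> zariski_hull (Suc M) (\<theta> ` W)"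
        and g': "(\<lambda>x. g (\<theta>' x)) \<in> polyfuns (Suc M)"
      show "analytic_curve_to (Suc M) (\<theta> ` W) (\<theta> p) (\<lambda>x. g (\<theta>' x))"
      proof (rule curve_selection_monic[where g = "\<lambda>x. g (\<theta>' x)" and b = "\<theta> b", OF Suc.IH W' g' _ _ F(1)])
        show "\<theta> b \<in> \<theta> ` W" "g (\<theta>' (\<theta> b)) \<noteq> 0" using Suc.prems by (auto simp: inv)
        show "coeff (F x) e = 1" for x using F(2) by simp
        show "\<forall>x\<in>\<theta> ` W. poly (F x) (x M) = 0"
        proof
          fix x assume "x \<in> \<theta> ` W"
          hence "\<theta>' x \<in> W" by (auto simp: inv)
          hence "f (\<theta>' x) = 0" using f(2) by blast
          thus "poly (F x) (x M) = 0" using F(3) unfolding \<theta>'_def by blast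
        qed
      qed
    qed (use shear_polyfuns in \<open>auto simp: \<theta>_def \<theta>'_def\<close>)
  qed
qed

section \<open>Displacement functions along analytic arcs\<close>

lemma vec_has_derivative:
  fixes c :: "complex \<Rightarrow> complex^'n::finite"
  assumes "\<And>i. ((\<lambda>x. c x $ i) has_field_derivative w $ i) (at x)"
  shows "(c has_derivative (\<lambda>t. t *s w)) (at x)"
proof (rule has_derivative_componentwise_within[THEN iffD2], rule ballI)
  fix b :: "complex^'n" assume "b \<in> Basis"
  then obtain i u where b: "b = axis i u" by (auto simp: Basis_vec_def)
  have "((\<lambda>x. c x $ i) has_derivative (\<lambda>t. t * w $ i)) (at x)"
    using assms[of i] by (simp add: has_field_derivative_def mult_commute_abs)
  hence "((\<lambda>x. (c x $ i) \<bullet> u) has_derivative (\<lambda>t. (t * w $ i) \<bullet> u)) (at x)"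
    by (rule has_derivative_inner_left)
  thus "((\<lambda>x. c x \<bullet> b) has_derivative (\<lambda>t. (t *s w) \<bullet> b)) (at x)"
    by (simp add: b inner_axis)
qed

lemma cdifferentiable_compose:
  assumes "cdifferentiable_on s f S" "\<gamma> x \<in> S" "(\<gamma> has_derivative (\<lambda>t. s t w)) (at x)"
  shows "(\<lambda>x. f (\<gamma> x)) field_differentiable (at x)"
proof -
  obtain f' where f': "(f has_derivative f') (at (\<gamma> x))" "\<forall>c y. f' (s c y) = c * f' y"
    using assms(1,2) unfolding cdifferentiable_on_def by blast
  have "(f \<circ> \<gamma> has_derivative f' \<circ> (\<lambda>t. s t w)) (at x)"
    by (rule diff_chain_at[OF assms(3) f'(1)])
  hence "((\<lambda>x. f (\<gamma> x)) has_field_derivative f' w) (at x)"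
    using f'(2) by (simp add: has_field_derivative_def o_def mult_commute_abs)
  thus ?thesis by (auto simp: field_differentiable_def)
qed

lemma cdifferentiable_continuous: "cdifferentiable_on s f S \<Longrightarrow> x \<in> S \<Longrightarrow> isCont f x"
  by (auto simp: cdifferentiable_on_def dest!: bspec has_derivative_continuous)

lemma eventually_nhds_prod_ball:
  "eventually P (nhds (a, b)) \<longleftrightarrow> (\<exists>\<rho>>0. \<exists>r>0. \<forall>x\<in>ball a \<rho>. \<forall>y\<in>ball b r. P (x, y))"
proof
  assume "eventually P (nhds (a, b))"
  then obtain Q R where Q: "eventually Q (nhds a)" and R: "eventually R (nhds b)"
    and P: "\<And>x y. Q x \<Longrightarrow> R y \<Longrightarrow> P (x, y)"
    unfolding nhds_prod eventually_prod_filter by blast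
  obtain \<rho> where "0 < \<rho>" "\<And>x. dist x a < \<rho> \<Longrightarrow> Q x"
    using Q unfolding eventually_nhds_metric by blast
  moreover obtain r where "0 < r" "\<And>y. dist y b < r \<Longrightarrow> R y"
    using R unfolding eventually_nhds_metric by blast
  ultimately show "\<exists>\<rho>>0. \<exists>r>0. \<forall>x\<in>ball a \<rho>. \<forall>y\<in>ball b r. P (x, y)"
    using P by (intro exI[of _ \<rho>] conjI exI[of _ r]) (auto simp: dist_commute)
next
  assume "\<exists>\<rho>>0. \<exists>r>0. \<forall>x\<in>ball a \<rho>. \<forall>y\<in>ball b r. P (x, y)"
  then obtain \<rho> r where "0 < \<rho>" "0 < r" "\<forall>x\<in>ball a \<rho>. \<forall>y\<in>ball b r. P (x, y)" by blast
  moreover from this have "\<forall>\<^sub>F x in nhds a. x \<in> ball a \<rho>" "\<forall>\<^sub>F y in nhds b. y \<in> ball b r"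
    by (auto intro: eventually_nhds_in_open simp del: mem_ball)
  ultimately show "eventually P (nhds (a, b))"
    unfolding nhds_prod eventually_prod_filter by blast
qed

section \<open>Analytic arcs and lowest order terms of the displacement\<close>

locale arc =
  fixes c :: "complex \<Rightarrow> complex^'n::finite"
  assumes analytic: "\<And>i. (\<lambda>\<epsilon>. c \<epsilon> $ i) analytic_on {0}"
begin

lemma derivative_near_0:
  "\<exists>r>0. \<forall>\<epsilon>\<in>ball 0 r. \<exists>w. (c has_derivative (\<lambda>t. t *s w)) (at \<epsilon>)"
proof -
  obtain r where r: "0 < r" "\<And>i. i \<in> UNIV \<Longrightarrow> (\<lambda>\<epsilon>. c \<epsilon> $ i) holomorphic_on ball 0 r"
    using analytic_ball_common[of UNIV "\<lambda>i \<epsilon>. c \<epsilon> $ i"] analytic by auto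
  have "\<exists>w. (c has_derivative (\<lambda>t. t *s w)) (at \<epsilon>)" if "\<epsilon> \<in> ball 0 r" for \<epsilon>
  proof -
    have "((\<lambda>x. c x $ i) has_field_derivative (\<chi> i. deriv (\<lambda>x. c x $ i) \<epsilon>) $ i) (at \<epsilon>)" for i
      using holomorphic_derivI[OF r(2)[of i] open_ball that] by simp
    from vec_has_derivative[OF this] show ?thesis by blast
  qed
  with r(1) show ?thesis by blast
qed

lemma tendsto_0: "(c \<longlongrightarrow> c 0) (nhds 0)"
proof -
  obtain r where r: "0 < r" "\<And>\<epsilon>. \<epsilon> \<in> ball 0 r \<Longrightarrow> \<exists>w. (c has_derivative (\<lambda>t. t *s w)) (at \<epsilon>)"
    using derivative_near_0 by blast
  have "isCont c 0"
    using r(2)[of 0] r(1) has_derivative_continuous by auto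
  thus ?thesis by (simp add: isCont_def tendsto_nhds_iff)
qed

text \<open>Reduces joint differentiability to facts in one variable: separate holomorphy on fixed
  discs and one bound for both variables, which makes the later Cauchy estimates uniform in
  h.\<close>

lemma displacement_near:
  assumes F: "cdifferentiable_on pair_scale F \<Omega>" "open \<Omega>" "(h\<^sub>0, c 0) \<in> \<Omega>"
  obtains \<rho> r B where "0 < \<rho>" "0 < r"
    "\<And>h \<epsilon>. h \<in> ball h\<^sub>0 \<rho> \<Longrightarrow> \<epsilon> \<in> ball 0 r \<Longrightarrow> norm (F (h, c \<epsilon>)) \<le> B"
    "\<And>\<epsilon>. \<epsilon> \<in> ball 0 r \<Longrightarrow> (\<lambda>h. F (h, c \<epsilon>)) holomorphic_on ball h\<^sub>0 \<rho>"
    "\<And>h. h \<in> ball h\<^sub>0 \<rho> \<Longrightarrow> (\<lambda>\<epsilon>. F (h, c \<epsilon>)) holomorphic_on ball 0 r"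
proof -
  obtain r0 where r0: "0 < r0" "\<And>\<epsilon>. \<epsilon> \<in> ball 0 r0 \<Longrightarrow> \<exists>w. (c has_derivative (\<lambda>t. t *s w)) (at \<epsilon>)"
    using derivative_near_0 by blast
  have "((\<lambda>p. c (snd p)) \<longlongrightarrow> c 0) (nhds h\<^sub>0 \<times>\<^sub>F nhds 0)"
    using tendsto_0 filterlim_snd by (rule filterlim_compose)
  hence lim: "((\<lambda>p. (fst p, c (snd p))) \<longlongrightarrow> (h\<^sub>0, c 0)) (nhds h\<^sub>0 \<times>\<^sub>F nhds 0)"
    by (intro tendsto_Pair filterlim_fst)
  have "(F \<longlongrightarrow> F (h\<^sub>0, c 0)) (nhds (h\<^sub>0, c 0))"
    using cdifferentiable_continuous[OF F(1,3)] by (simp add: isCont_def tendsto_nhds_iff)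
  hence "((\<lambda>p. F (fst p, c (snd p))) \<longlongrightarrow> F (h\<^sub>0, c 0)) (nhds h\<^sub>0 \<times>\<^sub>F nhds 0)"
    using lim by (rule filterlim_compose)
  hence "\<forall>\<^sub>F p in nhds h\<^sub>0 \<times>\<^sub>F nhds 0. norm (F (fst p, c (snd p))) < norm (F (h\<^sub>0, c 0)) + 1"
    by (rule order_tendstoD(2)[OF tendsto_norm]) simp
  moreover have "\<forall>\<^sub>F p in nhds h\<^sub>0 \<times>\<^sub>F nhds 0. (fst p, c (snd p)) \<in> \<Omega>"
    using lim F(2,3) by (rule topological_tendstoD)
  ultimately have "\<forall>\<^sub>F p in nhds h\<^sub>0 \<times>\<^sub>F nhds 0.
      norm (F (fst p, c (snd p))) < norm (F (h\<^sub>0, c 0)) + 1 \<and> (fst p, c (snd p)) \<in> \<Omega>"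
    by (rule eventually_conj)
  then obtain \<rho> r1 where r1: "0 < \<rho>" "0 < r1" and near: "\<forall>h\<in>ball h\<^sub>0 \<rho>. \<forall>\<epsilon>\<in>ball 0 r1.
      norm (F (h, c \<epsilon>)) < norm (F (h\<^sub>0, c 0)) + 1 \<and> (h, c \<epsilon>) \<in> \<Omega>"
    unfolding nhds_prod[symmetric] eventually_nhds_prod_ball by auto
  define r where "r = min r0 r1"
  show ?thesis
  proof (rule that[of \<rho> r "norm (F (h\<^sub>0, c 0)) + 1"])
    show "0 < \<rho>" "0 < r" using r0 r1 by (auto simp: r_def)
    show "norm (F (h, c \<epsilon>)) \<le> norm (F (h\<^sub>0, c 0)) + 1" if "h \<in> ball h\<^sub>0 \<rho>" "\<epsilon> \<in> ball 0 r" for h \<epsilon>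
      using near that by (simp add: r_def less_imp_le)
    show "(\<lambda>h. F (h, c \<epsilon>)) holomorphic_on ball h\<^sub>0 \<rho>" if "\<epsilon> \<in> ball 0 r" for \<epsilon>
      unfolding holomorphic_on_def
    proof
      fix h assume h: "h \<in> ball h\<^sub>0 \<rho>"
      have "(\<lambda>h. F (h, c \<epsilon>)) field_differentiable (at h)"
      proof (rule cdifferentiable_compose[OF F(1), where w = "(1, 0)"])
        show "(h, c \<epsilon>) \<in> \<Omega>" using near that h by (simp add: r_def)
        show "((\<lambda>h. (h, c \<epsilon>)) has_derivative (\<lambda>t. pair_scale t (1, 0))) (at h)"
        proof -
          have "((\<lambda>h. (h, c \<epsilon>)) has_derivative (\<lambda>t. (t, 0))) (at h)"
            by (intro has_derivative_Pair has_derivative_ident has_derivative_const)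
          thus ?thesis by simp
        qed
      qed
      thus "(\<lambda>h. F (h, c \<epsilon>)) field_differentiable (at h within ball h\<^sub>0 \<rho>)"
        by (rule field_differentiable_at_within)
    qed
    show "(\<lambda>\<epsilon>. F (h, c \<epsilon>)) holomorphic_on ball 0 r" if "h \<in> ball h\<^sub>0 \<rho>" for h
      unfolding holomorphic_on_def
    proof
      fix \<epsilon> :: complex assume \<epsilon>: "\<epsilon> \<in> ball 0 r"
      then obtain w where w: "(c has_derivative (\<lambda>t. t *s w)) (at \<epsilon>)"
        using r0(2)[of \<epsilon>] by (auto simp: r_def)
      have "(\<lambda>\<epsilon>. F (h, c \<epsilon>)) field_differentiable (at \<epsilon>)"
      proof (rule cdifferentiable_compose[OF F(1), where w = "(0, w)"])
        show "(h, c \<epsilon>) \<in> \<Omega>" using near that \<epsilon> by (simp add: r_def)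
        show "((\<lambda>\<epsilon>. (h, c \<epsilon>)) has_derivative (\<lambda>t. pair_scale t (0, w))) (at \<epsilon>)"
        proof -
          have "((\<lambda>\<epsilon>. (h, c \<epsilon>)) has_derivative (\<lambda>t. (0, t *s w))) (at \<epsilon>)"
            by (intro has_derivative_Pair has_derivative_const w)
          thus ?thesis by simp
        qed
      qed
      thus "(\<lambda>\<epsilon>. F (h, c \<epsilon>)) field_differentiable (at \<epsilon> within ball 0 r)"
        by (rule field_differentiable_at_within)
    qed
  qed
qed

end

text \<open>Cauchy's inequalities bound the tail by a geometric series of ratio norm z / R, at most
  1/2; this gives the factor 2. The constant depends only on \<open>B\<close>, \<open>R\<close> and
  \<open>s\<close>.\<close>

lemma taylor_remainder:
  assumes holo: "g holomorphic_on ball 0 r" and bound: "\<And>z. z \<in> ball 0 r \<Longrightarrow> norm (g z) \<le> B"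
    and R: "0 < R" "R < r" and low: "\<And>t. t < s \<Longrightarrow> (deriv ^^ t) g 0 = 0" and z: "norm z \<le> R / 2"
  shows "norm (g z - (deriv ^^ s) g 0 / fact s * z ^ s) \<le> 2 * B / R ^ Suc s * norm z ^ Suc s"
proof -
  define a where "a = (\<lambda>n. (deriv ^^ n) g 0 / fact n)"
  define q where "q = norm z / R"
  have q: "0 \<le> q" "q \<le> 1 / 2" using R z by (auto simp: q_def field_simps)
  have B: "0 \<le> B"
    by (rule order_trans[OF norm_ge_zero bound[of 0]]) (use R in simp)
  have "(\<lambda>n. a n * z ^ n) sums g z"
    using holomorphic_power_series[OF holo, of z] z R by (simp add: a_def)
  hence "(\<lambda>n. a (n + Suc s) * z ^ (n + Suc s)) sums (g z - (\<Sum>n<Suc s. a n * z ^ n))"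
    by (rule sums_split_initial_segment)
  moreover have "(\<Sum>n<Suc s. a n * z ^ n) = a s * z ^ s"
    using low by (simp add: a_def)
  ultimately have sums: "(\<lambda>n. a (n + Suc s) * z ^ (n + Suc s)) sums (g z - a s * z ^ s)"
    by simp
  have a_le: "norm (a n * z ^ n) \<le> B * q ^ n" for n
  proof -
    have "norm ((deriv ^^ n) g 0) \<le> fact n * B / R ^ n"
      using R by (intro Cauchy_inequality holomorphic_on_imp_continuous_on holomorphic_on_subset[OF holo] bound) auto
    hence "norm (a n) \<le> B / R ^ n" by (simp add: a_def norm_divide field_simps)
    hence "norm (a n) * norm z ^ n \<le> B / R ^ n * norm z ^ n"
      by (intro mult_right_mono) auto
    thus ?thesis by (simp add: norm_mult norm_power q_def power_divide)
  qed
  have geo: "(\<lambda>n. B * q ^ Suc s * q ^ n) sums (B * q ^ Suc s * (1 / (1 - q)))"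
    using q by (intro sums_mult geometric_sums) auto
  have "norm (g z - a s * z ^ s) \<le> suminf (\<lambda>n. B * q ^ Suc s * q ^ n)"
  proof -
    have "norm (suminf (\<lambda>n. a (n + Suc s) * z ^ (n + Suc s))) \<le> suminf (\<lambda>n. B * q ^ Suc s * q ^ n)"
    proof (rule norm_suminf_le[OF _ sums_summable[OF geo], rotated -1])
      fix n show "norm (a (n + Suc s) * z ^ (n + Suc s)) \<le> B * q ^ Suc s * q ^ n"
        using a_le[of "n + Suc s"] by (simp add: power_add mult_ac)
    qed
    thus ?thesis using sums_unique[OF sums] by simp
  qed
  also have "\<dots> = B * q ^ Suc s * (1 / (1 - q))"
    using sums_unique[OF geo] by simp
  also have "\<dots> \<le> B * q ^ Suc s * 2"
    using q B by (intro mult_left_mono) (auto simp: field_simps)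
  also have "\<dots> = 2 * B / R ^ Suc s * norm z ^ Suc s"
    by (simp add: q_def power_divide)
  finally show ?thesis by (simp add: a_def)
qed

text \<open>A finite limit excludes an order of vanishing below \<open>k\<close>, and for an order
  of at least \<open>k\<close> the quotient tends to the coefficient of degree
  \<open>k\<close>.\<close>

lemma fps_expansion_nth_limit:
  assumes f: "f analytic_on {0}" and lim: "((\<lambda>\<epsilon>. f \<epsilon> / \<epsilon> ^ k) \<longlongrightarrow> L) (at 0)"
  shows "fps_nth (fps_expansion f 0) k = L"
proof (cases "\<forall>\<^sub>F z in nhds 0. f z = 0")
  case True
  hence "fps_expansion f 0 = fps_expansion (\<lambda>_. 0) 0" by (rule fps_expansion_cong)
  moreover have "fps_expansion (\<lambda>_. 0) 0 = 0" by (rule fps_expansion_eqI) auto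
  moreover have "((\<lambda>\<epsilon>. f \<epsilon> / \<epsilon> ^ k) \<longlongrightarrow> 0) (at 0)"
    using eventually_nhds_imp_at[OF True] by (intro tendsto_eventually) (auto elim!: eventually_mono)
  ultimately show ?thesis using lim by (metis fps_zero_nth tendsto_unique trivial_limit_at)
next
  case False
  obtain n g where g: "g analytic_on {0}" "g 0 \<noteq> 0" "\<forall>\<^sub>F z in nhds 0. f z = z ^ n * g z"
    by (rule analytic_order[OF f False])
  have g_lim: "(g \<longlongrightarrow> g 0) (at 0)"
    using analytic_tendsto[OF g(1)] by (simp add: tendsto_nhds_iff)
  have g_fps: "g has_fps_expansion fps_expansion g 0"
    using g(1) by (auto simp: analytic_at)
  have ev: "\<forall>\<^sub>F z in at 0. f z = z ^ n * g z" "\<forall>\<^sub>F z in at (0::complex). z \<noteq> 0"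
    using eventually_nhds_imp_at[OF g(3)] by (simp_all add: eventually_at_filter)
  have "fps_expansion f 0 = fps_expansion (\<lambda>z. z ^ n * g z) 0"
    using g(3) by (rule fps_expansion_cong)
  also have "\<dots> = fps_X ^ n * fps_expansion g 0"
    by (intro fps_expansion_eqI has_fps_expansion_mult has_fps_expansion_fps_X_power g_fps)
  finally have nth: "fps_nth (fps_expansion f 0) k = (if k < n then 0 else fps_nth (fps_expansion g 0) (k - n))"
    by (simp add: fps_X_power_mult_nth)
  consider "k < n" | "k = n" | "n < k" by linarith
  thus ?thesis
  proof cases
    case 1
    have "((\<lambda>\<epsilon>. \<epsilon> ^ (n - k) * g \<epsilon>) \<longlongrightarrow> 0 ^ (n - k) * g 0) (at 0)"
      by (intro tendsto_intros g_lim)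
    moreover have "\<forall>\<^sub>F \<epsilon> in at 0. \<epsilon> ^ (n - k) * g \<epsilon> = f \<epsilon> / \<epsilon> ^ k"
      using ev by eventually_elim (use 1 in \<open>simp add: power_diff field_simps\<close>)
    ultimately have "((\<lambda>\<epsilon>. f \<epsilon> / \<epsilon> ^ k) \<longlongrightarrow> 0 ^ (n - k) * g 0) (at 0)"
      by (rule Lim_transform_eventually)
    hence "L = 0 ^ (n - k) * g 0"
      using lim by (intro tendsto_unique[of "at (0::complex)"]) auto
    thus ?thesis using 1 nth by (simp add: zero_power)
  next
    case 2
    have "\<forall>\<^sub>F \<epsilon> in at 0. g \<epsilon> = f \<epsilon> / \<epsilon> ^ k"
      using ev by eventually_elim (use 2 in \<open>simp add: field_simps\<close>)
    with g_lim have "((\<lambda>\<epsilon>. f \<epsilon> / \<epsilon> ^ k) \<longlongrightarrow> g 0) (at 0)"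
      by (rule Lim_transform_eventually)
    hence "L = g 0"
      using lim by (intro tendsto_unique[of "at (0::complex)"]) auto
    thus ?thesis using 2 nth by (simp add: fps_expansion_def)
  next
    case 3
    have "((\<lambda>\<epsilon>. (f \<epsilon> / \<epsilon> ^ k) * \<epsilon> ^ (k - n)) \<longlongrightarrow> L * 0 ^ (k - n)) (at 0)"
      by (intro tendsto_intros lim)
    moreover have "\<forall>\<^sub>F \<epsilon> in at 0. (f \<epsilon> / \<epsilon> ^ k) * \<epsilon> ^ (k - n) = g \<epsilon>"
      using ev by eventually_elim (use 3 in \<open>simp add: power_diff field_simps\<close>)
    ultimately have "(g \<longlongrightarrow> L * 0 ^ (k - n)) (at 0)"
      by (rule Lim_transform_eventually)
    hence "g 0 = L * 0 ^ (k - n)"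
      using g_lim by (intro tendsto_unique[of "at (0::complex)"]) auto
    with g(2) 3 show ?thesis by (simp add: zero_power)
  qed
qed

context arc
begin

text \<open>The remainder estimate says that F / \<epsilon>^k tends to \<open>M\<close> uniformly in
  h. By Weierstrass \<open>M\<close> is holomorphic and all derivatives in h converge as
  well.\<close>

lemma bifurcation_limits_near:
  assumes holo: "\<And>\<epsilon>. \<epsilon> \<in> ball 0 \<delta> \<Longrightarrow> (\<lambda>h. F (h, c \<epsilon>)) holomorphic_on ball h\<^sub>0 \<rho>'"
    and pos: "0 < \<delta>" "0 < \<rho>" "\<rho> < \<rho>'"
    and bound: "\<And>h \<epsilon>. h \<in> cball h\<^sub>0 \<rho> \<Longrightarrow> \<epsilon> \<in> ball 0 \<delta> \<Longrightarrow> norm (F (h, c \<epsilon>) - \<epsilon> ^ k * M h) \<le> C * norm \<epsilon> ^ Suc k"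
  shows "M holomorphic_on ball h\<^sub>0 \<rho>"
    and "((\<lambda>\<epsilon>. displacement_coeff F h\<^sub>0 i (c \<epsilon>) / \<epsilon> ^ k) \<longlongrightarrow> fps_nth (fps_expansion M h\<^sub>0) i) (at 0)"
proof -
  have ball: "\<forall>\<^sub>F \<epsilon> in at 0. \<epsilon> \<in> ball (0::complex) \<delta>" "\<forall>\<^sub>F \<epsilon> in at (0::complex). \<epsilon> \<noteq> 0"
    using eventually_nhds_imp_at[OF eventually_nhds_in_open[OF open_ball, of 0 "0::complex" \<delta>]] pos
    by (simp_all add: eventually_at_filter)
  have ulim: "uniform_limit (cball h\<^sub>0 \<rho>) (\<lambda>\<epsilon> h. inverse (\<epsilon> ^ k) * F (h, c \<epsilon>)) M (at 0)"
  proof (rule uniform_limitI)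
    fix e :: real assume e: "0 < e"
    have "((\<lambda>\<epsilon>::complex. C * norm \<epsilon>) \<longlongrightarrow> C * norm (0::complex)) (at 0)"
      by (intro tendsto_intros)
    hence "\<forall>\<^sub>F \<epsilon> in at (0::complex). C * norm \<epsilon> < e"
      by (rule order_tendstoD) (use e in simp)
    thus "\<forall>\<^sub>F \<epsilon> in at 0. \<forall>h\<in>cball h\<^sub>0 \<rho>. dist (inverse (\<epsilon> ^ k) * F (h, c \<epsilon>)) (M h) < e"
      using ball
    proof (eventually_elim, intro ballI)
      fix \<epsilon> h :: complex assume *: "C * norm \<epsilon> < e" "\<epsilon> \<in> ball 0 \<delta>" "\<epsilon> \<noteq> 0" "h \<in> cball h\<^sub>0 \<rho>"
      have "inverse (\<epsilon> ^ k) * F (h, c \<epsilon>) - M h = inverse (\<epsilon> ^ k) * (F (h, c \<epsilon>) - \<epsilon> ^ k * M h)"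
        using *(3) by (simp add: field_simps)
      hence "dist (inverse (\<epsilon> ^ k) * F (h, c \<epsilon>)) (M h) =
          inverse (norm \<epsilon> ^ k) * norm (F (h, c \<epsilon>) - \<epsilon> ^ k * M h)"
        by (simp add: dist_norm norm_mult norm_inverse norm_power)
      also have "\<dots> \<le> inverse (norm \<epsilon> ^ k) * (C * norm \<epsilon> ^ Suc k)"
        by (intro mult_left_mono bound *) auto
      also have "\<dots> = C * norm \<epsilon>" using *(3) by simp
      finally show "dist (inverse (\<epsilon> ^ k) * F (h, c \<epsilon>)) (M h) < e" using *(1) by simp
    qed
  qed
  have holo': "(\<lambda>h. inverse (\<epsilon> ^ k) * F (h, c \<epsilon>)) holomorphic_on ball h\<^sub>0 \<rho>'" if "\<epsilon> \<in> ball 0 \<delta>" for \<epsilon>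
    by (intro holomorphic_intros holo that)
  have sub: "cball h\<^sub>0 \<rho> \<subseteq> ball h\<^sub>0 \<rho>'" using pos by auto
  show M: "M holomorphic_on ball h\<^sub>0 \<rho>"
  proof (rule holomorphic_uniform_limit[OF _ ulim])
    show "\<forall>\<^sub>F \<epsilon> in at 0. continuous_on (cball h\<^sub>0 \<rho>) (\<lambda>h. inverse (\<epsilon> ^ k) * F (h, c \<epsilon>)) \<and>
        (\<lambda>h. inverse (\<epsilon> ^ k) * F (h, c \<epsilon>)) holomorphic_on ball h\<^sub>0 \<rho>"
      using ball(1)
    proof eventually_elim
      case (elim \<epsilon>)
      show ?case
        using holomorphic_on_subset[OF holo'[OF elim] sub] holomorphic_on_subset[of _ "cball h\<^sub>0 \<rho>" "ball h\<^sub>0 \<rho>"]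
        by (auto intro: holomorphic_on_imp_continuous_on)
    qed
  qed auto
  have "((\<lambda>\<epsilon>. (deriv ^^ i) (\<lambda>h. inverse (\<epsilon> ^ k) * F (h, c \<epsilon>)) h\<^sub>0) \<longlongrightarrow> (deriv ^^ i) M h\<^sub>0) (at 0)"
  proof (rule higher_deriv_complex_uniform_limit[OF uniform_limit_on_subset[OF ulim ball_subset_cball]])
    show "\<forall>\<^sub>F \<epsilon> in at 0. (\<lambda>h. inverse (\<epsilon> ^ k) * F (h, c \<epsilon>)) holomorphic_on ball h\<^sub>0 \<rho>"
      using ball(1) by eventually_elim (rule holomorphic_on_subset[OF holo' subset_ball], use pos in auto)
  qed (use pos in auto)
  moreover have "\<forall>\<^sub>F \<epsilon> in at 0. (deriv ^^ i) (\<lambda>h. inverse (\<epsilon> ^ k) * F (h, c \<epsilon>)) h\<^sub>0 =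
      inverse (\<epsilon> ^ k) * (deriv ^^ i) (\<lambda>h. F (h, c \<epsilon>)) h\<^sub>0"
    using ball(1) by eventually_elim (use pos in \<open>auto intro!: higher_deriv_cmult[OF holo]\<close>)
  ultimately have "((\<lambda>\<epsilon>. inverse (\<epsilon> ^ k) * (deriv ^^ i) (\<lambda>h. F (h, c \<epsilon>)) h\<^sub>0) \<longlongrightarrow> (deriv ^^ i) M h\<^sub>0) (at 0)"
    by (rule Lim_transform_eventually)
  from tendsto_divide[OF this tendsto_const, of "fact i"]
  show "((\<lambda>\<epsilon>. displacement_coeff F h\<^sub>0 i (c \<epsilon>) / \<epsilon> ^ k) \<longlongrightarrow> fps_nth (fps_expansion M h\<^sub>0) i) (at 0)"
    by (simp add: displacement_coeff_def fps_expansion_def field_simps)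
qed

lemma bifurcation_limits:
  assumes F: "cdifferentiable_on pair_scale F \<Omega>" "open \<Omega>" "(h\<^sub>0, c 0) \<in> \<Omega>"
    and M: "bifurcation_function F h\<^sub>0 c k M"
  shows "((\<lambda>\<epsilon>. displacement_coeff F h\<^sub>0 i (c \<epsilon>) / \<epsilon> ^ k) \<longlongrightarrow> fps_nth (fps_expansion M h\<^sub>0) i) (at 0)"
proof -
  obtain \<rho> r B where *: "0 < \<rho>" "0 < r"
    "\<And>\<epsilon>. \<epsilon> \<in> ball 0 r \<Longrightarrow> (\<lambda>h. F (h, c \<epsilon>)) holomorphic_on ball h\<^sub>0 \<rho>"
    using displacement_near[OF F] by metis
  obtain C where "\<forall>\<^sub>F (h, \<epsilon>) in nhds (h\<^sub>0, 0). norm (F (h, c \<epsilon>) - \<epsilon> ^ k * M h) \<le> C * norm \<epsilon> ^ Suc k"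
    using M by (auto simp: bifurcation_function_def)
  then obtain \<rho>1 \<delta> where near: "0 < \<rho>1" "0 < \<delta>" "\<forall>h\<in>ball h\<^sub>0 \<rho>1. \<forall>\<epsilon>\<in>ball (0::complex) \<delta>.
      norm (F (h, c \<epsilon>) - \<epsilon> ^ k * M h) \<le> C * norm \<epsilon> ^ Suc k"
    unfolding eventually_nhds_prod_ball by auto
  show ?thesis
  proof (rule bifurcation_limits_near(2)[where \<delta> = "min r \<delta>" and \<rho> = "min \<rho> \<rho>1 / 2" and \<rho>' = \<rho> and C = C])
    show "norm (F (h, c \<epsilon>) - \<epsilon> ^ k * M h) \<le> C * norm \<epsilon> ^ Suc k"
      if "h \<in> cball h\<^sub>0 (min \<rho> \<rho>1 / 2)" "\<epsilon> \<in> ball 0 (min r \<delta>)" for h \<epsilon>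
      using that * near(1,2) by (intro near(3)[rule_format]) auto
  qed (use * near(1,2) in auto)
qed

text \<open>The Taylor coefficients \<open>N s\<close> in \<open>\<epsilon>\<close> are locally uniform limits of \<open>F (h, c \<epsilon>) / \<epsilon> ^ s\<close> as long as the
  previous ones vanish. This makes them holomorphic and, by comparing Taylor coefficients in \<open>h\<close>, zero
  for \<open>s < k\<close>.\<close>

lemma bifurcation_exists:
  assumes F: "cdifferentiable_on pair_scale F \<Omega>" "open \<Omega>" "(h\<^sub>0, c 0) \<in> \<Omega>"
    and lim: "\<And>i. ((\<lambda>\<epsilon>. displacement_coeff F h\<^sub>0 i (c \<epsilon>) / \<epsilon> ^ k) \<longlongrightarrow> m i) (at 0)" and nz: "m j \<noteq> 0"
  obtains M where "bifurcation_function F h\<^sub>0 c k M" "\<And>i. fps_nth (fps_expansion M h\<^sub>0) i = m i"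
proof -
  obtain \<rho> r B where near: "0 < \<rho>" "0 < r"
    "\<And>h \<epsilon>. h \<in> ball h\<^sub>0 \<rho> \<Longrightarrow> \<epsilon> \<in> ball 0 r \<Longrightarrow> norm (F (h, c \<epsilon>)) \<le> B"
    "\<And>\<epsilon>. \<epsilon> \<in> ball 0 r \<Longrightarrow> (\<lambda>h. F (h, c \<epsilon>)) holomorphic_on ball h\<^sub>0 \<rho>"
    "\<And>h. h \<in> ball h\<^sub>0 \<rho> \<Longrightarrow> (\<lambda>\<epsilon>. F (h, c \<epsilon>)) holomorphic_on ball 0 r"
    using displacement_near[OF F] by metis
  define N where "N = (\<lambda>s h. (deriv ^^ s) (\<lambda>\<epsilon>. F (h, c \<epsilon>)) 0 / fact s)"
  define R where "R = r / 2"
  have R: "0 < R" "R < r" using near by (auto simp: R_def)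
  define \<rho>1 where "\<rho>1 = \<rho> / 2"
  have \<rho>1: "0 < \<rho>1" "\<rho>1 < \<rho>" using near by (auto simp: \<rho>1_def)
  have rem: "norm (F (h, c \<epsilon>) - \<epsilon> ^ s * N s h) \<le> 2 * B / R ^ Suc s * norm \<epsilon> ^ Suc s"
    if "h \<in> ball h\<^sub>0 \<rho>" "\<epsilon> \<in> ball 0 (R / 2)" "\<And>t. t < s \<Longrightarrow> N t h = 0" for h \<epsilon> s
    using taylor_remainder[OF near(5)[OF that(1)] near(3)[OF that(1)] R, of s \<epsilon>] that(2,3)
    by (simp add: N_def mult.commute)
  have low: "N s h = 0" if "s < k" "h \<in> ball h\<^sub>0 \<rho>1" for s h
    using that
  proof (induction s arbitrary: h rule: less_induct)
    case (less s)
    \<comment> \<open>Halfway between h and the boundary of the disc: the closed disc of this radius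
      contains h and stays inside the region of the induction hypothesis.\<close>
    define \<rho>2 where "\<rho>2 = (dist h\<^sub>0 h + \<rho>1) / 2"
    have "0 < dist h\<^sub>0 h + \<rho>1"
      by (rule add_nonneg_pos[OF zero_le_dist \<rho>1(1)])
    hence \<rho>2: "dist h\<^sub>0 h < \<rho>2" "\<rho>2 < \<rho>1" "0 < \<rho>2"
      using less.prems(2) by (auto simp: \<rho>2_def field_simps)
    have bound: "norm (F (h, c \<epsilon>) - \<epsilon> ^ s * N s h) \<le> 2 * B / R ^ Suc s * norm \<epsilon> ^ Suc s"
      if "h \<in> cball h\<^sub>0 \<rho>2" "\<epsilon> \<in> ball 0 (R / 2)" for h \<epsilon>
    proof (rule rem)
      show "N t h = 0" if "t < s" for t
        using that \<open>h \<in> _\<close> \<rho>2 less.prems by (intro less.IH) auto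
    qed (use that \<rho>2 \<rho>1 in auto)
    have holo: "(\<lambda>h. F (h, c \<epsilon>)) holomorphic_on ball h\<^sub>0 \<rho>" if "\<epsilon> \<in> ball 0 (R / 2)" for \<epsilon>
      using that R by (intro near(4)) auto
    have pos: "0 < R / 2" "0 < \<rho>2" "\<rho>2 < \<rho>" using R \<rho>2 \<rho>1 by auto
    note N = bifurcation_limits_near[OF holo pos bound]
    have "fps_nth (fps_expansion (N s) h\<^sub>0) i = 0" for i
    proof -
      \<comment> \<open>Below order \<open>k\<close> the Taylor coefficients in h divided by
        \<epsilon>^s tend to 0, because a factor \<epsilon>^(k - s) remains.\<close>
      have "((\<lambda>\<epsilon>. displacement_coeff F h\<^sub>0 i (c \<epsilon>) / \<epsilon> ^ k * \<epsilon> ^ (k - s)) \<longlongrightarrow> m i * 0 ^ (k - s)) (at 0)"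
        by (intro tendsto_intros lim)
      moreover have "\<forall>\<^sub>F \<epsilon> in at 0. displacement_coeff F h\<^sub>0 i (c \<epsilon>) / \<epsilon> ^ k * \<epsilon> ^ (k - s) =
          displacement_coeff F h\<^sub>0 i (c \<epsilon>) / \<epsilon> ^ s"
        using less.prems(1) by (auto simp: eventually_at_filter power_diff)
      ultimately have "((\<lambda>\<epsilon>. displacement_coeff F h\<^sub>0 i (c \<epsilon>) / \<epsilon> ^ s) \<longlongrightarrow> m i * 0 ^ (k - s)) (at 0)"
        by (rule Lim_transform_eventually)
      with N(2)[of i] have "fps_nth (fps_expansion (N s) h\<^sub>0) i = m i * 0 ^ (k - s)"
        by (intro tendsto_unique[of "at (0::complex)"]) auto
      thus ?thesis using less.prems(1) by (simp add: zero_power)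
    qed
    hence "(\<lambda>n. (deriv ^^ n) (N s) h\<^sub>0 / fact n * (h - h\<^sub>0) ^ n) = (\<lambda>n. 0)"
      by (auto simp: fps_expansion_def fun_eq_iff)
    moreover have "(\<lambda>n. (deriv ^^ n) (N s) h\<^sub>0 / fact n * (h - h\<^sub>0) ^ n) sums N s h"
      by (rule holomorphic_power_series[OF N(1)]) (use \<rho>2 in auto)
    ultimately show ?case
      using sums_unique2[OF sums_zero] by metis
  qed
  have bound: "norm (F (h, c \<epsilon>) - \<epsilon> ^ k * N k h) \<le> 2 * B / R ^ Suc k * norm \<epsilon> ^ Suc k"
    if "h \<in> ball h\<^sub>0 \<rho>1" "\<epsilon> \<in> ball 0 (R / 2)" for h \<epsilon>
    by (rule rem) (use that low \<rho>1 in auto)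
  have bound': "norm (F (h, c \<epsilon>) - \<epsilon> ^ k * N k h) \<le> 2 * B / R ^ Suc k * norm \<epsilon> ^ Suc k"
    if "h \<in> cball h\<^sub>0 (\<rho>1 / 2)" "\<epsilon> \<in> ball 0 (R / 2)" for h \<epsilon>
    by (rule bound) (use that \<rho>1 in auto)
  have holo: "(\<lambda>h. F (h, c \<epsilon>)) holomorphic_on ball h\<^sub>0 \<rho>" if "\<epsilon> \<in> ball 0 (R / 2)" for \<epsilon>
    using that R by (intro near(4)) auto
  have pos: "0 < R / 2" "0 < \<rho>1 / 2" "\<rho>1 / 2 < \<rho>" using R \<rho>1 by auto
  note N = bifurcation_limits_near(2)[OF holo pos bound']
  have "N k holomorphic_on ball h\<^sub>0 (\<rho>1 / 2)"
    by (rule bifurcation_limits_near(1)[OF holo pos bound'])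
  hence an: "N k analytic_on {h\<^sub>0}" using \<rho>1 by (auto simp: analytic_at_ball intro!: exI[of _ "\<rho>1 / 2"])
  have nth: "fps_nth (fps_expansion (N k) h\<^sub>0) i = m i" for i
    by (rule tendsto_unique[OF _ N lim]) simp
  show ?thesis
  proof (rule that[of "N k"])
    show "bifurcation_function F h\<^sub>0 c k (N k)"
      unfolding bifurcation_function_def
    proof (intro conjI an exI[of _ "2 * B / R ^ Suc k"])
      show "\<not> (\<forall>\<^sub>F h in nhds h\<^sub>0. N k h = 0)"
      proof
        assume "\<forall>\<^sub>F h in nhds h\<^sub>0. N k h = 0"
        hence "fps_expansion (N k) h\<^sub>0 = fps_expansion (\<lambda>_. 0) h\<^sub>0"
          by (rule fps_expansion_cong)
        thus False using nth[of j] nz by (simp add: fps_expansion_def)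
      qed
      show "\<forall>\<^sub>F (h, \<epsilon>) in nhds (h\<^sub>0, 0). norm (F (h, c \<epsilon>) - \<epsilon> ^ k * N k h) \<le> 2 * B / R ^ Suc k * norm \<epsilon> ^ Suc k"
        unfolding eventually_nhds_prod_ball
        using bound R \<rho>1 by (intro exI[of _ \<rho>1] conjI exI[of _ "R / 2"]) auto
    qed
  qed (rule nth)
qed

end

section \<open>Blowups and arcs\<close>

definition monomial_value :: "('i::finite \<Rightarrow>\<^sub>0 nat) \<Rightarrow> ('i \<Rightarrow> complex) \<Rightarrow> complex" where
  "monomial_value m x = (\<Prod>i\<in>UNIV. x i ^ Poly_Mapping.lookup m i)"

lemma monomial_value_add: "monomial_value (m + m') x = monomial_value m x * monomial_value m' x"
  by (simp add: monomial_value_def lookup_add power_add prod.distrib)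

lemma monomial_value_single: "monomial_value (Poly_Mapping.single i k) x = x i ^ k"
proof -
  have "monomial_value (Poly_Mapping.single i k) x = (\<Prod>j\<in>UNIV. if j = i then x i ^ k else 1)"
    unfolding monomial_value_def by (intro prod.cong) (auto simp: lookup_single when_def)
  thus ?thesis by simp
qed

lemma peval_superset:
  fixes p :: "'i::finite cpoly"
  assumes "finite S" "Poly_Mapping.keys p \<subseteq> S"
  shows "peval p x = (\<Sum>m\<in>S. Poly_Mapping.lookup p m * monomial_value m x)"
proof -
  have "(\<Prod>i\<in>Poly_Mapping.keys m. x i ^ Poly_Mapping.lookup m i) = monomial_value m x" for m
    unfolding monomial_value_def by (intro prod.mono_neutral_left) (auto simp: in_keys_iff)
  hence "peval p x = (\<Sum>m\<in>Poly_Mapping.keys p. Poly_Mapping.lookup p m * monomial_value m x)"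
    by (simp add: peval_def)
  also have "\<dots> = (\<Sum>m\<in>S. Poly_Mapping.lookup p m * monomial_value m x)"
    using assms by (intro sum.mono_neutral_left) (auto simp: in_keys_iff)
  finally show ?thesis .
qed

lemma peval_add:
  fixes p q :: "'i::finite cpoly"
  shows "peval (p + q) x = peval p x + peval q x"
proof -
  define S where "S = Poly_Mapping.keys p \<union> Poly_Mapping.keys q"
  have "finite S" "Poly_Mapping.keys p \<subseteq> S" "Poly_Mapping.keys q \<subseteq> S" "Poly_Mapping.keys (p + q) \<subseteq> S"
    using keys_add[of p q] by (auto simp: S_def)
  thus ?thesis
    by (simp add: peval_superset lookup_add distrib_right sum.distrib)
qed

lemma peval_0: "peval 0 x = 0"
  by (simp add: peval_def)

lemma peval_sum:
  fixes p :: "'a \<Rightarrow> 'i::finite cpoly"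
  shows "peval (\<Sum>k\<in>S. p k) x = (\<Sum>k\<in>S. peval (p k) x)"
  by (induction S rule: infinite_finite_induct) (simp_all add: peval_0 peval_add)

lemma peval_single: "peval (Poly_Mapping.single m c) x = c * monomial_value (m :: 'i::finite \<Rightarrow>\<^sub>0 nat) x"
  by (subst peval_superset[of "{m}"]) auto

lemma poly_mapping_sum_single: "(\<Sum>k\<in>Poly_Mapping.keys p. Poly_Mapping.single k (Poly_Mapping.lookup p k)) = p"
proof (rule poly_mapping_eqI)
  fix k
  have "(\<Sum>l\<in>Poly_Mapping.keys p. Poly_Mapping.lookup p l when l = k) =
      (\<Sum>l\<in>Poly_Mapping.keys p. if l = k then Poly_Mapping.lookup p k else 0)"
    by (intro sum.cong) (auto simp: when_def)
  thus "Poly_Mapping.lookup (\<Sum>k\<in>Poly_Mapping.keys p. Poly_Mapping.single k (Poly_Mapping.lookup p k)) k =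
      Poly_Mapping.lookup p k"
    by (simp add: lookup_sum lookup_single in_keys_iff)
qed

lemma peval_mult:
  fixes p q :: "'i::finite cpoly"
  shows "peval (p * q) x = peval p x * peval q x"
proof -
  let ?s = "\<lambda>p :: 'i cpoly. \<lambda>k. Poly_Mapping.single k (Poly_Mapping.lookup p k)"
  have "p * q = (\<Sum>k\<in>Poly_Mapping.keys p. ?s p k) * (\<Sum>l\<in>Poly_Mapping.keys q. ?s q l)"
    by (simp add: poly_mapping_sum_single)
  also have "\<dots> = (\<Sum>k\<in>Poly_Mapping.keys p. \<Sum>l\<in>Poly_Mapping.keys q.
      Poly_Mapping.single (k + l) (Poly_Mapping.lookup p k * Poly_Mapping.lookup q l))"
    by (simp add: sum_product mult_single)
  finally have "peval (p * q) x = (\<Sum>k\<in>Poly_Mapping.keys p. \<Sum>l\<in>Poly_Mapping.keys q.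
      (Poly_Mapping.lookup p k * monomial_value k x) * (Poly_Mapping.lookup q l * monomial_value l x))"
    by (simp add: peval_sum peval_single monomial_value_add mult_ac)
  also have "\<dots> = peval p x * peval q x"
    by (simp add: peval_superset[OF finite_keys order_refl] sum_product)
  finally show ?thesis .
qed

lemma (in function_algebra) peval_in:
  fixes q :: "'i::finite cpoly"
  assumes "\<And>i. (\<lambda>t. x t i) \<in> R"
  shows "(\<lambda>t. peval q (x t)) \<in> R"
proof -
  have "(\<lambda>t. \<Prod>i\<in>I. x t i ^ Poly_Mapping.lookup m i) \<in> R" for m and I :: "'i set"
    by (induction I rule: infinite_finite_induct) (auto intro!: mult power assms)
  thus ?thesis unfolding peval_def by (intro sum mult const)
qed

lemma tendsto_peval:
  assumes "\<And>i. ((\<lambda>t. x t i) \<longlongrightarrow> y i) F"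
  shows "((\<lambda>t. peval p (x t)) \<longlongrightarrow> peval p y) F"
  unfolding peval_def by (intro tendsto_intros assms)

section \<open>Homogenization with respect to the projective variables\<close>

definition homogeneous_right_degree :: "nat \<Rightarrow> ('n + 'm::finite) cpoly \<Rightarrow> bool" where
  "homogeneous_right_degree e p \<longleftrightarrow>
     (\<forall>m\<in>Poly_Mapping.keys p. (\<Sum>j\<in>UNIV. Poly_Mapping.lookup m (Inr j)) = e)"

lemma homogeneous_right_degree_add:
  "homogeneous_right_degree e p \<Longrightarrow> homogeneous_right_degree e q \<Longrightarrow> homogeneous_right_degree e (p + q)"
  using keys_add[of p q] unfolding homogeneous_right_degree_def by blast

lemma homogeneous_right_degree_mult:
  assumes "homogeneous_right_degree e p" "homogeneous_right_degree e' q"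
  shows "homogeneous_right_degree (e + e') (p * q)"
  unfolding homogeneous_right_degree_def
proof
  fix m assume "m \<in> Poly_Mapping.keys (p * q)"
  then obtain a b where "m = a + b" "a \<in> Poly_Mapping.keys p" "b \<in> Poly_Mapping.keys q"
    using keys_mult[of p q] by blast
  with assms show "(\<Sum>j\<in>UNIV. Poly_Mapping.lookup m (Inr j)) = e + e'"
    by (simp add: homogeneous_right_degree_def lookup_add sum.distrib)
qed

lemma homogeneous_right_degree_single:
  "(\<Sum>j\<in>UNIV. Poly_Mapping.lookup m (Inr j)) = e \<Longrightarrow> homogeneous_right_degree e (Poly_Mapping.single m c)"
  by (auto simp: homogeneous_right_degree_def)

lemma sum_lookup_single_Inr:
  "(\<Sum>j\<in>UNIV. Poly_Mapping.lookup (Poly_Mapping.single (Inr (b :: 'm::finite)) e) (Inr j)) = e"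
proof -
  have "(\<Sum>j\<in>UNIV. Poly_Mapping.lookup (Poly_Mapping.single (Inr b) e) (Inr j)) = (\<Sum>j\<in>UNIV. if j = b then e else 0)"
    by (intro sum.cong) (auto simp: lookup_single when_def)
  thus ?thesis by simp
qed

lemma sum_lookup_single_Inl:
  "(\<Sum>j\<in>UNIV. Poly_Mapping.lookup (Poly_Mapping.single (Inl a) e) (Inr (j :: 'm::finite))) = 0"
  by (simp add: lookup_single when_def)

text \<open>Lists the affine and projective coordinates in one sequence along \<theta>, so that
  polynomial functions of finitely many numbered coordinates apply.\<close>

definition point_of :: "(nat \<Rightarrow> 'n + 'm) \<Rightarrow> complex^'n::finite \<Rightarrow> complex^'m::finite \<Rightarrow> nat \<Rightarrow> complex" where
  "point_of \<theta> \<mu> w = (\<lambda>i. case_sum (\<lambda>i. \<mu> $ i) (\<lambda>j. w $ j) (\<theta> i))"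

text \<open>Homogenization in degree \<open>e\<close> relative to the affine chart in which the
  projective coordinate \<open>j\<close> is normalized to 1.\<close>

definition homogenizes ::
    "(nat \<Rightarrow> 'n::finite + 'm::finite) \<Rightarrow> 'm \<Rightarrow> ((nat \<Rightarrow> complex) \<Rightarrow> complex) \<Rightarrow> nat \<Rightarrow> ('n + 'm) cpoly \<Rightarrow> bool" where
  "homogenizes \<theta> j f e p \<longleftrightarrow> homogeneous_right_degree e p \<and>
    (\<forall>\<mu> w. w $ j \<noteq> 0 \<longrightarrow> peval p (case_sum (\<lambda>i. \<mu> $ i) (\<lambda>j. w $ j)) =
       (w $ j) ^ e * f (point_of \<theta> \<mu> (inverse (w $ j) *s w)))"

text \<open>All sufficiently large degrees are provided, since a sum needs both summands in the same
  degree; surplus degree is filled with powers of the coordinate \<open>j\<close>.\<close>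

lemma homogenization:
  fixes \<theta> :: "nat \<Rightarrow> 'n::finite + 'm::finite"
  assumes "f \<in> polyfuns K"
  shows "\<exists>e. \<forall>e'\<ge>e. \<exists>p. homogenizes \<theta> j f e' p"
  using assms
proof (induction rule: polyfuns.induct)
  case (const c)
  have "homogenizes \<theta> j (\<lambda>x. c) e (Poly_Mapping.single (Poly_Mapping.single (Inr j) e) c)" for e
    unfolding homogenizes_def
    by (simp add: peval_single monomial_value_single homogeneous_right_degree_single sum_lookup_single_Inr)
  thus ?case by blast
next
  case (coord i)
  show ?case
  proof (cases "\<theta> i")
    case (Inl a)
    have "homogenizes \<theta> j (\<lambda>x. x i) e
        (Poly_Mapping.single (Poly_Mapping.single (Inl a) 1 + Poly_Mapping.single (Inr j) e) 1)" for e
      unfolding homogenizes_def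
    proof (intro conjI homogeneous_right_degree_single)
      show "(\<Sum>b\<in>UNIV. Poly_Mapping.lookup (Poly_Mapping.single (Inl a) 1 + Poly_Mapping.single (Inr j) e) (Inr b)) = e"
        by (simp only: lookup_add sum.distrib sum_lookup_single_Inr sum_lookup_single_Inl add_0)
    qed (simp add: peval_single monomial_value_add monomial_value_single point_of_def Inl)
    thus ?thesis by blast
  next
    case (Inr b)
    have "homogenizes \<theta> j (\<lambda>x. x i) e
        (Poly_Mapping.single (Poly_Mapping.single (Inr b) 1 + Poly_Mapping.single (Inr j) (e - 1)) 1)"
      if e: "1 \<le> e" for e
      unfolding homogenizes_def
    proof (intro conjI homogeneous_right_degree_single)
      show "(\<Sum>l\<in>UNIV. Poly_Mapping.lookup (Poly_Mapping.single (Inr b) 1 + Poly_Mapping.single (Inr j) (e - 1)) (Inr l)) = e"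
        by (simp only: lookup_add sum.distrib sum_lookup_single_Inr le_add_diff_inverse[OF e])
    qed (use e in \<open>simp add: peval_single monomial_value_add monomial_value_single point_of_def Inr
                     power_diff field_simps\<close>)
    thus ?thesis by blast
  qed
next
  case (add f g)
  then obtain e1 e2 where e1: "\<forall>e'\<ge>e1. \<exists>p. homogenizes \<theta> j f e' p" and e2: "\<forall>e'\<ge>e2. \<exists>p. homogenizes \<theta> j g e' p"
    by (elim exE)
  show ?case
  proof (rule exI[of _ "max e1 e2"], intro allI impI)
    fix e assume "max e1 e2 \<le> e"
    hence "e1 \<le> e" "e2 \<le> e" by auto
    with e1 e2 obtain p q where pq: "homogenizes \<theta> j f e p" "homogenizes \<theta> j g e q" by blast
    hence "homogenizes \<theta> j (\<lambda>x. f x + g x) e (p + q)"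
      by (simp add: homogenizes_def homogeneous_right_degree_add peval_add distrib_left)
    thus "\<exists>p. homogenizes \<theta> j (\<lambda>x. f x + g x) e p" ..
  qed
next
  case (mult f g)
  then obtain e1 e2 where e1: "\<forall>e'\<ge>e1. \<exists>p. homogenizes \<theta> j f e' p" and e2: "\<forall>e'\<ge>e2. \<exists>p. homogenizes \<theta> j g e' p"
    by (elim exE)
  show ?case
  proof (rule exI[of _ "e1 + e2"], intro allI impI)
    fix e assume e: "e1 + e2 \<le> e"
    hence "e1 \<le> e - e2" by simp
    with e1 e2 obtain p q where pq: "homogenizes \<theta> j f (e - e2) p" "homogenizes \<theta> j g e2 q" by blast
    hence "homogeneous_right_degree (e - e2 + e2) (p * q)"
      by (intro homogeneous_right_degree_mult) (auto simp: homogenizes_def)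
    moreover have "(w $ j) ^ e = (w $ j) ^ (e - e2) * (w $ j) ^ e2" for w :: "complex^'m"
      using e by (simp add: power_add[symmetric])
    ultimately have "homogenizes \<theta> j (\<lambda>x. f x * g x) e (p * q)"
      using pq e by (simp add: homogenizes_def peval_mult mult_ac)
    thus "\<exists>p. homogenizes \<theta> j (\<lambda>x. f x * g x) e p" ..
  qed
qed

lemma zariski_closed_single:
  fixes P :: "('n::finite + 'm::finite) cpoly"
  assumes "homogeneous_right_degree e P"
  shows "zariski_closed {(\<mu> :: complex^'n, l). l \<in> projective_space \<and>
    (\<forall>w\<in>l. peval P (case_sum (\<lambda>i. \<mu> $ i) (\<lambda>j. w $ j)) = 0)}"
proof -
  have "homogeneous_right P"
    using assms unfolding homogeneous_right_def homogeneous_right_degree_def by blast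
  thus ?thesis
    unfolding zariski_closed_def by (intro exI[of _ "{P}"]) auto
qed

lemma blowup_subset:
  assumes "zariski_closed Y" "\<And>\<mu>. \<mu> \<notin> zero_set v \<Longrightarrow> (\<mu>, vec.span {\<chi> j. vpeval (v j) \<mu>}) \<in> Y"
  shows "blowup v \<subseteq> Y"
  unfolding blowup_def by (rule hull_minimal) (use assms in auto)

lemma blowup_fibre_vanish:
  fixes v :: "'m::finite \<Rightarrow> 'n::finite cpoly" and P :: "('n + 'm) cpoly"
  assumes l: "l \<in> blowup_fibre v \<mu>\<^sub>0" "w \<in> l" and hom: "homogeneous_right_degree e P"
    and vanish: "\<And>\<mu> s. \<mu> \<notin> zero_set v \<Longrightarrow>
      peval P (case_sum (\<lambda>i. \<mu> $ i) (\<lambda>j. (s *s (\<chi> j. vpeval (v j) \<mu>)) $ j)) = 0"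
  shows "peval P (case_sum (\<lambda>i. \<mu>\<^sub>0 $ i) (\<lambda>j. w $ j)) = 0"
proof -
  have "blowup v \<subseteq> {(\<mu>, l). l \<in> projective_space \<and> (\<forall>w\<in>l. peval P (case_sum (\<lambda>i. \<mu> $ i) (\<lambda>j. w $ j)) = 0)}"
  proof (rule blowup_subset[OF zariski_closed_single[OF hom]])
    fix \<mu> assume \<mu>: "\<mu> \<notin> zero_set v"
    have "(\<chi> j. vpeval (v j) \<mu>) \<noteq> 0"
      using \<mu> by (auto simp: zero_set_def vec_eq_iff)
    hence "vec.span {\<chi> j. vpeval (v j) \<mu>} \<in> projective_space"
      unfolding projective_space_def by blast
    thus "(\<mu>, vec.span {\<chi> j. vpeval (v j) \<mu>}) \<in> {(\<mu>, l). l \<in> projective_space \<and>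
        (\<forall>w\<in>l. peval P (case_sum (\<lambda>i. \<mu> $ i) (\<lambda>j. w $ j)) = 0)}"
      using vanish[OF \<mu>] by (auto simp: vec.span_singleton simp del: vector_smult_component)
  qed
  with l show ?thesis
    by (auto simp: blowup_fibre_def)
qed

lemma (in vector_space) span_scale_singleton:
  assumes "c \<noteq> 0"
  shows "span {scale c x} = span {x}"
proof (rule span_eq[THEN iffD2], intro conjI)
  have "x = scale (inverse c) (scale c x)" using assms by simp
  also have "\<dots> \<in> span {scale c x}" by (intro span_scale span_base) simp
  finally show "{x} \<subseteq> span {scale c x}" by simp
qed (simp add: span_scale span_base)

section \<open>Analytic arcs and the fibre of the blowup\<close>

context arc
begin

text \<open>Division by \<epsilon>^k moves the vector of the v_j only along its own line, so every
  equation of the graph holds for the quotient and passes to the limit.\<close>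

lemma limit_in_blowup_fibre:
  assumes lim: "\<And>j. ((\<lambda>\<epsilon>. vpeval (v j) (c \<epsilon>) / \<epsilon> ^ k) \<longlongrightarrow> w $ j) (at 0)" and nz: "w \<noteq> 0"
  shows "vec.span {w} \<in> blowup_fibre v (c 0)"
proof -
  obtain j where j: "w $ j \<noteq> 0" using nz by (auto simp: vec_eq_iff)
  have "\<forall>\<^sub>F \<epsilon> in at 0. vpeval (v j) (c \<epsilon>) / \<epsilon> ^ k \<noteq> 0"
    using tendsto_imp_eventually_ne[OF lim j] .
  hence ev: "\<forall>\<^sub>F \<epsilon> in at 0. c \<epsilon> \<notin> zero_set v"
    by (rule eventually_mono) (auto simp: zero_set_def)
  have "(c 0, vec.span {w}) \<in> Y"
    if Y: "zariski_closed Y" "\<And>\<mu>. \<mu> \<notin> zero_set v \<Longrightarrow> (\<mu>, vec.span {\<chi> j. vpeval (v j) \<mu>}) \<in> Y" for Y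
  proof -
    obtain S where S: "Y = {(\<mu>, l). l \<in> projective_space \<and>
        (\<forall>p\<in>S. \<forall>w\<in>l. peval p (case_sum (\<lambda>i. \<mu> $ i) (\<lambda>j. w $ j)) = 0)}"
      using Y(1) unfolding zariski_closed_def by blast
    have "peval p (case_sum (\<lambda>i. c 0 $ i) (\<lambda>j. (s *s w) $ j)) = 0" if p: "p \<in> S" for p s
    proof -
      define x where "x = (\<lambda>\<epsilon>. case_sum (\<lambda>i. c \<epsilon> $ i) (\<lambda>j. s * (vpeval (v j) (c \<epsilon>) / \<epsilon> ^ k)))"
      have "((\<lambda>\<epsilon>. x \<epsilon> i) \<longlongrightarrow> case_sum (\<lambda>i. c 0 $ i) (\<lambda>j. (s *s w) $ j) i) (at 0)" for i
      proof (cases i)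
        case (Inl a)
        have "((\<lambda>\<epsilon>. c \<epsilon> $ a) \<longlongrightarrow> c 0 $ a) (at 0)"
          using analytic_tendsto[OF analytic[of a]] by (simp add: tendsto_nhds_iff)
        thus ?thesis by (simp add: x_def Inl)
      next
        case (Inr b)
        have "((\<lambda>\<epsilon>. s * (vpeval (v b) (c \<epsilon>) / \<epsilon> ^ k)) \<longlongrightarrow> s * w $ b) (at 0)"
          by (intro tendsto_mult tendsto_const lim)
        thus ?thesis by (simp add: x_def Inr)
      qed
      hence "((\<lambda>\<epsilon>. peval p (x \<epsilon>)) \<longlongrightarrow> peval p (case_sum (\<lambda>i. c 0 $ i) (\<lambda>j. (s *s w) $ j))) (at 0)"
        by (rule tendsto_peval)
      moreover have "\<forall>\<^sub>F \<epsilon> in at 0. peval p (x \<epsilon>) = 0"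
        using ev
      proof (rule eventually_mono)
        fix \<epsilon> assume "c \<epsilon> \<notin> zero_set v"
        hence "(c \<epsilon>, vec.span {\<chi> j. vpeval (v j) (c \<epsilon>)}) \<in> Y" by (rule Y(2))
        moreover have "(s / \<epsilon> ^ k) *s (\<chi> j. vpeval (v j) (c \<epsilon>)) \<in> vec.span {\<chi> j. vpeval (v j) (c \<epsilon>)}"
          by (auto simp: vec.span_singleton)
        ultimately have "peval p (case_sum (\<lambda>i. c \<epsilon> $ i) (\<lambda>j. ((s / \<epsilon> ^ k) *s (\<chi> j. vpeval (v j) (c \<epsilon>))) $ j)) = 0"
          using p unfolding S by blast
        moreover have "(\<lambda>j. ((s / \<epsilon> ^ k) *s (\<chi> j. vpeval (v j) (c \<epsilon>))) $ j) = (\<lambda>j. s * (vpeval (v j) (c \<epsilon>) / \<epsilon> ^ k))"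
          by auto
        ultimately show "peval p (x \<epsilon>) = 0" by (simp only: x_def)
      qed
      ultimately show ?thesis
        by (intro tendsto_unique[OF _ _ tendsto_eventually, of "at (0::complex)" "\<lambda>\<epsilon>. peval p (x \<epsilon>)"]) simp_all
    qed
    moreover have "vec.span {w} \<in> projective_space"
      using nz unfolding projective_space_def by blast
    ultimately show ?thesis
      unfolding S by (auto simp: vec.span_singleton simp del: vector_smult_component)
  qed
  thus ?thesis
    unfolding blowup_fibre_def blowup_def hull_def by blast
qed

end

interpretation polynomial_functions: function_algebra "{f. \<exists>p. \<forall>t. f t = poly p (t::complex)}"
proof
  show "(\<lambda>x. c) \<in> {f. \<exists>p. \<forall>t. f t = poly p t}" for c :: complex
    by (auto intro: exI[of _ "[:c:]"])
  fix f g :: "complex \<Rightarrow> complex"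
  assume "f \<in> {f. \<exists>p. \<forall>t. f t = poly p t}" "g \<in> {f. \<exists>p. \<forall>t. f t = poly p t}"
  then obtain p q where "\<forall>t. f t = poly p t" "\<forall>t. g t = poly q t" by auto
  thus "(\<lambda>x. f x + g x) \<in> {f. \<exists>p. \<forall>t. f t = poly p t}" "(\<lambda>x. f x * g x) \<in> {f. \<exists>p. \<forall>t. f t = poly p t}"
    by (auto intro: exI[of _ "p + q"] exI[of _ "p * q"])
qed

text \<open>The graph over the set where v_j is nonzero is parametrized by an open part of affine
  space. On the line through two parameters, homogenization clears the denominators v_j, so the two
  functions and v_j itself become nonzero polynomials in t with a common non-root.\<close>

lemma irreducible_chart:
  fixes v :: "'m::finite \<Rightarrow> 'n::finite cpoly" and \<theta> :: "nat \<Rightarrow> 'n + 'm"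
  defines "V \<equiv> (\<lambda>\<mu> :: complex^'n. \<chi> j. vpeval (v j) \<mu>)"
  shows "irreducible_set K {point_of \<theta> \<mu> (inverse (V \<mu> $ j) *s V \<mu>) | \<mu>. V \<mu> $ j \<noteq> 0}"
  unfolding irreducible_set_def
proof (intro ballI impI)
  let ?W = "{point_of \<theta> \<mu> (inverse (V \<mu> $ j) *s V \<mu>) | \<mu>. V \<mu> $ j \<noteq> 0}"
  fix f g
  assume fg: "f \<in> polyfuns K" "g \<in> polyfuns K" and nz: "\<exists>x\<in>?W. f x \<noteq> 0" "\<exists>x\<in>?W. g x \<noteq> 0"
  have hom: "\<exists>e. \<exists>p :: ('n + 'm) cpoly. \<forall>\<mu>. V \<mu> $ j \<noteq> 0 \<longrightarrow> peval p (case_sum (\<lambda>i. \<mu> $ i) (\<lambda>j. V \<mu> $ j)) =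
      (V \<mu> $ j) ^ e * f (point_of \<theta> \<mu> (inverse (V \<mu> $ j) *s V \<mu>))" if "f \<in> polyfuns K" for f
    using homogenization[OF that, of \<theta> j] unfolding homogenizes_def by blast
  obtain a p where p: "\<forall>\<mu>. V \<mu> $ j \<noteq> 0 \<longrightarrow> peval (p :: ('n + 'm) cpoly) (case_sum (\<lambda>i. \<mu> $ i) (\<lambda>j. V \<mu> $ j)) =
      (V \<mu> $ j) ^ a * f (point_of \<theta> \<mu> (inverse (V \<mu> $ j) *s V \<mu>))"
    using hom[OF fg(1)] by (elim exE)
  obtain b q where q: "\<forall>\<mu>. V \<mu> $ j \<noteq> 0 \<longrightarrow> peval (q :: ('n + 'm) cpoly) (case_sum (\<lambda>i. \<mu> $ i) (\<lambda>j. V \<mu> $ j)) =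
      (V \<mu> $ j) ^ b * g (point_of \<theta> \<mu> (inverse (V \<mu> $ j) *s V \<mu>))"
    using hom[OF fg(2)] by (elim exE)
  obtain \<mu>1 where \<mu>1: "V \<mu>1 $ j \<noteq> 0" "f (point_of \<theta> \<mu>1 (inverse (V \<mu>1 $ j) *s V \<mu>1)) \<noteq> 0"
    using nz(1) by auto
  obtain \<mu>2 where \<mu>2: "V \<mu>2 $ j \<noteq> 0" "g (point_of \<theta> \<mu>2 (inverse (V \<mu>2 $ j) *s V \<mu>2)) \<noteq> 0"
    using nz(2) by auto
  define line where "line = (\<lambda>t. \<mu>1 + t *s (\<mu>2 - \<mu>1))"
  have line_poly: "(\<lambda>t. line t $ i) \<in> {f. \<exists>p. \<forall>t. f t = poly p t}" for i
    by (auto simp: line_def algebra_simps intro!: exI[of _ "[:\<mu>1 $ i, \<mu>2 $ i - \<mu>1 $ i:]"])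
  have V_poly: "(\<lambda>t. V (line t) $ j) \<in> {f. \<exists>p. \<forall>t. f t = poly p t}" for j
    unfolding V_def vec_lambda_beta by (rule polynomial_functions.peval_in) (rule line_poly)
  have "(\<lambda>t. peval P (case_sum (\<lambda>i. line t $ i) (\<lambda>j. V (line t) $ j))) \<in> {f. \<exists>p. \<forall>t. f t = poly p t}"
    for P :: "('n + 'm) cpoly"
  proof (rule polynomial_functions.peval_in)
    show "(\<lambda>t. case_sum (\<lambda>i. line t $ i) (\<lambda>j. V (line t) $ j) i) \<in> {f. \<exists>p. \<forall>t. f t = poly p t}" for i
      using line_poly V_poly by (cases i) simp_all
  qed
  hence poly: "\<exists>R. \<forall>t. peval P (case_sum (\<lambda>i. line t $ i) (\<lambda>j. V (line t) $ j)) = poly R t"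
    for P :: "('n + 'm) cpoly" by simp
  obtain p' where p': "\<forall>t. peval p (case_sum (\<lambda>i. line t $ i) (\<lambda>j. V (line t) $ j)) = poly p' t"
    using poly[of p] by (elim exE)
  obtain q' where q': "\<forall>t. peval q (case_sum (\<lambda>i. line t $ i) (\<lambda>j. V (line t) $ j)) = poly q' t"
    using poly[of q] by (elim exE)
  obtain r where r: "\<forall>t. V (line t) $ j = poly r t"
    using V_poly[of j] by auto
  have line01: "line 0 = \<mu>1" "line 1 = \<mu>2" by (simp_all add: line_def vec_eq_iff)
  have "poly p' 0 = (V \<mu>1 $ j) ^ a * f (point_of \<theta> \<mu>1 (inverse (V \<mu>1 $ j) *s V \<mu>1))"
    using spec[OF p', of 0] p[rule_format, OF \<mu>1(1)] by (simp only: line01)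
  hence "poly p' 0 \<noteq> 0" using \<mu>1 by simp
  moreover have "poly q' 1 = (V \<mu>2 $ j) ^ b * g (point_of \<theta> \<mu>2 (inverse (V \<mu>2 $ j) *s V \<mu>2))"
    using spec[OF q', of 1] q[rule_format, OF \<mu>2(1)] by (simp only: line01)
  hence "poly q' 1 \<noteq> 0" using \<mu>2 by simp
  moreover have "poly r 0 \<noteq> 0" using spec[OF r, of 0] \<mu>1 by (simp add: line01)
  ultimately have "p' * q' * r \<noteq> 0" by auto
  then obtain t where t: "poly (p' * q' * r) t \<noteq> 0"
    using poly_all_0_iff_0 by blast
  hence nzt: "V (line t) $ j \<noteq> 0" using r by simp
  have "f (point_of \<theta> (line t) (inverse (V (line t) $ j) *s V (line t))) \<noteq> 0"
    using spec[OF p, of "line t"] spec[OF p', of t] nzt t by auto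
  moreover have "g (point_of \<theta> (line t) (inverse (V (line t) $ j) *s V (line t))) \<noteq> 0"
    using spec[OF q, of "line t"] spec[OF q', of t] nzt t by auto
  ultimately show "\<exists>x\<in>?W. f x \<noteq> 0 \<and> g x \<noteq> 0" using nzt by blast
qed

text \<open>Curve selection in the chart w_j = 1, avoiding v_j = 0. The projective coordinates
  converge along the curve, and there v_i = v_j w_i. So the order of v_j serves as \<open>k\<close>
  for all components.\<close>

theorem arc_through_blowup_fibre:
  fixes v :: "'m::finite \<Rightarrow> 'n::finite cpoly"
  assumes l: "l \<in> blowup_fibre v \<mu>\<^sub>0"
  shows "\<exists>c k w. arc c \<and> c 0 = \<mu>\<^sub>0 \<and> w \<noteq> 0 \<and> l = vec.span {w} \<and>
    (\<forall>j. ((\<lambda>\<epsilon>. vpeval (v j) (c \<epsilon>) / \<epsilon> ^ k) \<longlongrightarrow> w $ j) (at 0))"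
proof -
  define V where "V = (\<lambda>\<mu> :: complex^'n. \<chi> j. vpeval (v j) \<mu>)"
  have "l \<in> projective_space"
  proof -
    have "blowup v \<subseteq> {(\<mu>, l). l \<in> projective_space \<and> (\<forall>w\<in>l. peval (0 :: ('n + 'm) cpoly) (case_sum (\<lambda>i. \<mu> $ i) (\<lambda>j. w $ j)) = 0)}"
    proof (rule blowup_subset[OF zariski_closed_single[of 0]])
      fix \<mu> assume \<mu>: "\<mu> \<notin> zero_set v"
      have "(\<chi> j. vpeval (v j) \<mu>) \<noteq> 0"
        using \<mu> by (auto simp: zero_set_def vec_eq_iff)
      thus "(\<mu>, vec.span {\<chi> j. vpeval (v j) \<mu>}) \<in> {(\<mu>, l). l \<in> projective_space \<and>
          (\<forall>w\<in>l. peval (0 :: ('n + 'm) cpoly) (case_sum (\<lambda>i. \<mu> $ i) (\<lambda>j. w $ j)) = 0)}"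
        unfolding projective_space_def by (auto simp: peval_0)
    qed (simp add: homogeneous_right_degree_def)
    with l show ?thesis by (auto simp: blowup_fibre_def)
  qed
  then obtain w0 where w0: "w0 \<noteq> 0" "l = vec.span {w0}" by (auto simp: projective_space_def)
  then obtain j where j: "w0 $ j \<noteq> 0" by (auto simp: vec_eq_iff)
  define w where "w = inverse (w0 $ j) *s w0"
  have w: "w $ j = 1" "w \<in> l" using j by (auto simp: w_def w0 vec.span_singleton)
  define K where "K = CARD('n + 'm)"
  obtain \<theta> :: "nat \<Rightarrow> 'n + 'm" where \<theta>: "bij_betw \<theta> {..<K} UNIV"
    using ex_bij_betw_nat_finite[of "UNIV :: ('n + 'm) set"] by (auto simp: K_def atLeast0LessThan)
  define \<eta> where "\<eta> = inv_into {..<K} \<theta>"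
  have \<eta>: "\<eta> x < K" "\<theta> (\<eta> x) = x" for x
    using bij_betw_inv_into_right[OF \<theta>, of x] bij_betw_apply[OF bij_betw_inv_into[OF \<theta>], of x] by (auto simp: \<eta>_def)
  have \<eta>_\<theta>: "\<eta> (\<theta> i) = i" if "i < K" for i
    using bij_betw_inv_into_left[OF \<theta>, of i] that by (simp add: \<eta>_def)
  define W where "W = {point_of \<theta> \<mu> (inverse (V \<mu> $ j) *s V \<mu>) | \<mu>. V \<mu> $ j \<noteq> 0}"
  have irr: "irreducible_set K W"
    unfolding W_def V_def by (rule irreducible_chart)
  define lv where "lv = (\<lambda>i (x :: nat \<Rightarrow> complex). vpeval (v i) (\<chi> a. x (\<eta> (Inl a))))"
  have lv: "lv i \<in> polyfuns K" for i
    unfolding lv_def by (rule PF.peval_in) (use \<eta> in \<open>auto intro: polyfuns.coord\<close>)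
  have lv_point: "lv i (point_of \<theta> \<mu> u) = V \<mu> $ i" for i \<mu> u
    by (simp add: lv_def V_def point_of_def \<eta>)
  have coord_point: "point_of \<theta> \<mu> u (\<eta> (Inr b)) = u $ b" for \<mu> u b
    by (simp add: point_of_def \<eta>)
  have hull: "point_of \<theta> \<mu>\<^sub>0 w \<in> zariski_hull K W"
    unfolding zariski_hull_def
  proof (intro CollectI ballI impI)
    fix f assume f: "f \<in> polyfuns K" "\<forall>x\<in>W. f x = 0"
    obtain e and p :: "('n + 'm) cpoly" where p: "homogeneous_right_degree e p"
      "\<forall>\<mu> w. w $ j \<noteq> 0 \<longrightarrow> peval p (case_sum (\<lambda>i. \<mu> $ i) (\<lambda>j. w $ j)) =
         (w $ j) ^ e * f (point_of \<theta> \<mu> (inverse (w $ j) *s w))"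
      using homogenization[OF f(1), of \<theta> j] unfolding homogenizes_def by blast
    \<comment> \<open>Graph points outside the chart impose no condition on \<open>f\<close>. The
      extra factor w_j makes the polynomial vanish there too, and it equals 1 at the chosen
      w.\<close>
    let ?X = "Poly_Mapping.single (Poly_Mapping.single (Inr j) 1) 1 :: ('n + 'm) cpoly"
    have hom: "homogeneous_right_degree (e + 1) (p * ?X)"
      by (intro homogeneous_right_degree_mult p(1) homogeneous_right_degree_single sum_lookup_single_Inr)
    have "peval (p * ?X) (case_sum (\<lambda>i. \<mu>\<^sub>0 $ i) (\<lambda>j. w $ j)) = 0"
    proof (rule blowup_fibre_vanish[OF l w(2) hom])
      fix \<mu> s assume "\<mu> \<notin> zero_set v"
      define u where "u = s *s V \<mu>"
      have "peval p (case_sum (\<lambda>i. \<mu> $ i) (\<lambda>j. u $ j)) * u $ j = 0"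
      proof (cases "u $ j = 0")
        case False
        hence "s \<noteq> 0" "V \<mu> $ j \<noteq> 0" by (auto simp: u_def)
        moreover from this have "inverse (u $ j) *s u = inverse (V \<mu> $ j) *s V \<mu>"
          by (simp add: u_def vec_eq_iff field_simps)
        ultimately have "f (point_of \<theta> \<mu> (inverse (u $ j) *s u)) = 0"
          using f(2) by (auto simp: W_def)
        with p(2) False show ?thesis by simp
      qed simp
      thus "peval (p * ?X) (case_sum (\<lambda>i. \<mu> $ i) (\<lambda>j. (s *s (\<chi> j. vpeval (v j) \<mu>)) $ j)) = 0"
        by (simp add: peval_mult peval_single monomial_value_single u_def V_def)
    qed
    hence "peval p (case_sum (\<lambda>i. \<mu>\<^sub>0 $ i) (\<lambda>j. w $ j)) = 0"
      using w by (simp add: peval_mult peval_single monomial_value_single)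
    moreover have "peval p (case_sum (\<lambda>i. \<mu>\<^sub>0 $ i) (\<lambda>j. w $ j)) = (w $ j) ^ e * f (point_of \<theta> \<mu>\<^sub>0 (inverse (w $ j) *s w))"
      using p(2) w(1) by simp
    moreover have "inverse (w $ j) *s w = w" using w(1) by simp
    ultimately show "f (point_of \<theta> \<mu>\<^sub>0 w) = 0" using w(1) by simp
  qed
  obtain \<mu>1 where \<mu>1: "V \<mu>1 $ j \<noteq> 0"
  proof -
    have "\<exists>\<mu>1. V \<mu>1 $ j \<noteq> 0"
    proof (rule ccontr)
      assume "\<nexists>\<mu>1. V \<mu>1 $ j \<noteq> 0"
      hence "W = {}" by (auto simp: W_def)
      with zariski_hullD[OF hull, of "\<lambda>_. 1"] show False by auto
    qed
    thus ?thesis using that by blast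
  qed
  define b where "b = point_of \<theta> \<mu>1 (inverse (V \<mu>1 $ j) *s V \<mu>1)"
  have "b \<in> W" using \<mu>1 by (auto simp: b_def W_def)
  moreover have "lv j b \<noteq> 0" using \<mu>1 by (simp add: b_def lv_point)
  ultimately have "analytic_curve_to K W (point_of \<theta> \<mu>\<^sub>0 w) (lv j)"
    by (intro curve_selection[where b = b] irr hull lv)
  then obtain x where x: "\<forall>i<K. (\<lambda>\<epsilon>. x \<epsilon> i) analytic_on {0::complex}" "\<forall>i<K. x 0 i = point_of \<theta> \<mu>\<^sub>0 w i"
    "\<forall>\<^sub>F \<epsilon> in at 0. x \<epsilon> \<in> zariski_hull K W \<and> lv j (x \<epsilon>) \<noteq> 0"
    unfolding analytic_curve_to_def by (elim exE conjE) 
  define c where "c = (\<lambda>\<epsilon>. \<chi> a. x \<epsilon> (\<eta> (Inl a)))"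
  have arc: "arc c"
    using x(1) \<eta> by unfold_locales (simp add: c_def)
  have c0: "c 0 = \<mu>\<^sub>0"
    using x(2) \<eta> by (simp add: c_def vec_eq_iff point_of_def)
  have lv_x: "lv i (x \<epsilon>) = vpeval (v i) (c \<epsilon>)" for i \<epsilon>
    by (simp add: lv_def c_def)
  \<comment> \<open>These equations hold on the graph and hence on its hull, to which the curve
    belongs.\<close>
  have rel: "\<forall>\<^sub>F \<epsilon> in at 0. vpeval (v i) (c \<epsilon>) = vpeval (v j) (c \<epsilon>) * x \<epsilon> (\<eta> (Inr i))" for i
    using x(3)
  proof (rule eventually_mono)
    fix \<epsilon> assume "x \<epsilon> \<in> zariski_hull K W \<and> lv j (x \<epsilon>) \<noteq> 0"
    hence "x \<epsilon> \<in> zariski_hull K W" ..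
    hence "lv i (x \<epsilon>) - lv j (x \<epsilon>) * x \<epsilon> (\<eta> (Inr i)) = 0"
    proof (rule zariski_hullD)
      show "(\<lambda>x. lv i x - lv j x * x (\<eta> (Inr i))) \<in> polyfuns K"
        by (intro PF.diff PF.mult lv polyfuns.coord \<eta>)
      fix z assume "z \<in> W"
      then obtain \<mu> where "V \<mu> $ j \<noteq> 0" "z = point_of \<theta> \<mu> (inverse (V \<mu> $ j) *s V \<mu>)"
        by (auto simp: W_def)
      thus "lv i z - lv j z * z (\<eta> (Inr i)) = 0"
        by (simp add: lv_point coord_point field_simps)
    qed
    thus "vpeval (v i) (c \<epsilon>) = vpeval (v j) (c \<epsilon>) * x \<epsilon> (\<eta> (Inr i))" by (simp add: lv_x)
  qed
  have "(\<lambda>\<epsilon>. vpeval (v j) (c \<epsilon>)) analytic_on {0}"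
    using analytic_along_curve(1)[of K x "lv j"] x(1) lv by (simp add: lv_x)
  moreover have "\<not> (\<forall>\<^sub>F \<epsilon> in nhds 0. vpeval (v j) (c \<epsilon>) = 0)"
  proof
    assume "\<forall>\<^sub>F \<epsilon> in nhds 0. vpeval (v j) (c \<epsilon>) = 0"
    hence "\<forall>\<^sub>F \<epsilon> in at 0. vpeval (v j) (c \<epsilon>) = 0" by (rule eventually_nhds_imp_at)
    hence "\<forall>\<^sub>F \<epsilon> in at (0::complex). False"
      using x(3) by eventually_elim (simp add: lv_x)
    thus False by simp
  qed
  ultimately obtain k \<gamma> where \<gamma>: "\<gamma> analytic_on {0}" "\<gamma> 0 \<noteq> 0"
    "\<forall>\<^sub>F z in nhds 0. vpeval (v j) (c z) = z ^ k * \<gamma> z"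
    by (rule analytic_order) 
  have lim: "((\<lambda>\<epsilon>. vpeval (v i) (c \<epsilon>) / \<epsilon> ^ k) \<longlongrightarrow> (\<gamma> 0 *s w) $ i) (at 0)" for i
  proof -
    have xi: "(\<lambda>\<epsilon>. x \<epsilon> (\<eta> (Inr i))) analytic_on {0}" using x(1) \<eta> by simp
    have "((\<lambda>\<epsilon>. \<gamma> \<epsilon> * x \<epsilon> (\<eta> (Inr i))) \<longlongrightarrow> \<gamma> 0 * x 0 (\<eta> (Inr i))) (at 0)"
      using analytic_tendsto[OF \<gamma>(1)] analytic_tendsto[OF xi]
      by (intro tendsto_mult) (simp_all add: tendsto_nhds_iff)
    moreover have "\<gamma> 0 * x 0 (\<eta> (Inr i)) = (\<gamma> 0 *s w) $ i"
      using x(2) \<eta> by (simp add: coord_point)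
    moreover have "\<forall>\<^sub>F \<epsilon> in at 0. \<gamma> \<epsilon> * x \<epsilon> (\<eta> (Inr i)) = vpeval (v i) (c \<epsilon>) / \<epsilon> ^ k"
    proof -
      have "\<forall>\<^sub>F \<epsilon> in at (0::complex). \<epsilon> \<noteq> 0" by (simp add: eventually_at_filter)
      thus ?thesis
        using rel[of i] eventually_nhds_imp_at[OF \<gamma>(3)]
        by eventually_elim simp
    qed
    ultimately show ?thesis using Lim_transform_eventually by simp
  qed
  have "\<gamma> 0 *s w \<noteq> 0"
  proof
    assume "\<gamma> 0 *s w = 0"
    hence "(\<gamma> 0 *s w) $ j = 0 $ j" by (rule arg_cong)
    with \<gamma>(2) w(1) show False by (simp del: vector_mul_eq_0)
  qed
  moreover have "l = vec.span {\<gamma> 0 *s w}"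
  proof -
    have "\<gamma> 0 *s w = (\<gamma> 0 * inverse (w0 $ j)) *s w0" by (simp add: w_def)
    thus ?thesis using \<gamma>(2) j by (simp add: w0(2) vec.span_scale_singleton)
  qed
  ultimately show ?thesis
    using arc c0 lim by (intro exI[of _ c] exI[of _ k] exI[of _ "\<gamma> 0 *s w"]) simp
qed

section \<open>Germs and their Taylor coefficients\<close>

text \<open>Needed for Taylor coefficients, whose linearity is established on analytic germs, while
  the vector space at hand contains all germs.\<close>

lemma (in vector_space_pair) linear_extend_from_subspace:
  assumes S: "vs1.subspace S"
    and add: "\<And>x y. x \<in> S \<Longrightarrow> y \<in> S \<Longrightarrow> f (x + y) = f x + f y"
    and scale: "\<And>c x. x \<in> S \<Longrightarrow> f (s1 c x) = s2 c (f x)"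
  shows "\<exists>g. Vector_Spaces.linear s1 s2 g \<and> (\<forall>x\<in>S. g x = f x)"
proof -
  obtain B where B: "B \<subseteq> S" "vs1.independent B" "S \<subseteq> vs1.span B"
    by (rule vs1.maximal_independent_subset)
  obtain g where g: "Vector_Spaces.linear s1 s2 g" "\<forall>x\<in>B. g x = f x"
    using linear_independent_extend[OF B(2), of f] by (elim exE conjE)
  interpret g: Vector_Spaces.linear s1 s2 g by (rule g(1))
  have "x \<in> S \<and> g x = f x" if "x \<in> vs1.span B" for x
    using that
  proof (induction rule: vs1.span_induct_alt)
    case base
    have 0: "0 \<in> S" by (rule vs1.subspace_0[OF S])
    have "f 0 = 0" using scale[OF 0, of 0] by simp
    with 0 show ?case by (simp add: g.zero)
  next
    case (step c x y)
    have x: "x \<in> S" "s1 c x \<in> S" using step(1) B(1) vs1.subspace_scale[OF S] by auto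
    with step g(2) show ?case
      by (simp add: vs1.subspace_add[OF S] g.add g.scale add scale)
  qed
  with g(1) B(3) show ?thesis by blast
qed

lemma abs_germ_sum: "(\<Sum>i\<in>I. abs_germ (f i)) = abs_germ (\<lambda>z. \<Sum>i\<in>I. f i z)"
  by (induction I rule: infinite_finite_induct) (simp_all add: zero_germ_def plus_germ.abs_eq)

lemma germ_ideal_generator:
  fixes G :: "(complex^'n::finite) germ set"
  assumes g: "g \<in> G"
  shows "g \<in> germ_ideal G"
proof -
  have "(1 :: (complex^'n) germ) \<in> analytic_germs"
  proof -
    have "cdifferentiable_on (*s) (\<lambda>_ :: complex^'n. 1) UNIV"
      unfolding cdifferentiable_on_def by (auto intro!: exI[of _ "\<lambda>_. 0"])
    moreover have "(1 :: (complex^'n) germ) = germ_at 0 (\<lambda>_. 1)"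
      by (simp add: germ_at_def one_germ_def)
    ultimately show ?thesis
      unfolding analytic_germs_def by (intro CollectI exI[of _ "\<lambda>_. 1"] exI[of _ UNIV]) simp
  qed
  with g show ?thesis
    unfolding germ_ideal_def by (intro CollectI exI[of _ "{g}"] exI[of _ "\<lambda>_. 1"]) simp
qed

text \<open>The analytic coefficients are continuous, so only their values at \<mu> enter the limit.
  These values depend neither on the arc nor on \<open>k\<close>, which makes the passage between
  lowest order terms linear.\<close>

lemma germ_ideal_along_arcs:
  fixes f :: "'i \<Rightarrow> complex^'n::finite \<Rightarrow> complex"
  assumes "germ_at \<mu> \<phi> \<in> germ_ideal (range (\<lambda>i. germ_at \<mu> (f i)))"
  shows "\<exists>I a. finite I \<and> (\<forall>c k L. arc c \<longrightarrow> c 0 = \<mu> \<longrightarrow> (\<forall>i\<in>I. ((\<lambda>\<epsilon>. f i (c \<epsilon>) / \<epsilon> ^ k) \<longlongrightarrow> L i) (at 0)) \<longrightarrow>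
    ((\<lambda>\<epsilon>. \<phi> (c \<epsilon>) / \<epsilon> ^ k) \<longlongrightarrow> (\<Sum>i\<in>I. a i * L i)) (at 0))"
proof -
  obtain T a where T: "germ_at \<mu> \<phi> = (\<Sum>g\<in>T. a g * g)" "finite T" "T \<subseteq> range (\<lambda>i. germ_at \<mu> (f i))"
    "\<forall>g\<in>T. a g \<in> analytic_germs"
    using assms unfolding germ_ideal_def by blast
  \<comment> \<open>Different indices may have the same germ; one index is chosen for each germ in
    \<open>T\<close>, so that the sum can be reindexed.\<close>
  obtain I where I: "inj_on (\<lambda>i. germ_at \<mu> (f i)) I" "T = (\<lambda>i. germ_at \<mu> (f i)) ` I"
    using T(3) unfolding subset_image_inj by blast
  have "finite I" using T(2) I by (auto dest: finite_imageD)
  have "\<forall>i\<in>I. \<exists>\<alpha> S. a (germ_at \<mu> (f i)) = germ_at 0 \<alpha> \<and> open S \<and> 0 \<in> S \<and> cdifferentiable_on (*s) \<alpha> S"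
    using T(4) I(2) unfolding analytic_germs_def by blast
  from bchoice[OF this] obtain \<alpha> where "\<forall>i\<in>I. \<exists>S. a (germ_at \<mu> (f i)) = germ_at 0 (\<alpha> i) \<and> open S \<and> 0 \<in> S \<and>
      cdifferentiable_on (*s) (\<alpha> i) S" by blast
  hence \<alpha>: "\<And>i. i \<in> I \<Longrightarrow> a (germ_at \<mu> (f i)) = germ_at 0 (\<alpha> i)" "\<And>i. i \<in> I \<Longrightarrow> isCont (\<alpha> i) 0"
    using cdifferentiable_continuous by blast+
  have "germ_at \<mu> \<phi> = (\<Sum>i\<in>I. a (germ_at \<mu> (f i)) * germ_at \<mu> (f i))"
    by (simp add: T(1) I(2) sum.reindex[OF I(1)])
  also have "\<dots> = (\<Sum>i\<in>I. abs_germ (\<lambda>z. \<alpha> i z * f i (\<mu> + z)))"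
  proof (intro sum.cong refl)
    fix i assume "i \<in> I"
    hence "a (germ_at \<mu> (f i)) * germ_at \<mu> (f i) = germ_at 0 (\<alpha> i) * germ_at \<mu> (f i)"
      by (simp only: \<alpha>(1))
    thus "a (germ_at \<mu> (f i)) * germ_at \<mu> (f i) = abs_germ (\<lambda>z. \<alpha> i z * f i (\<mu> + z))"
      by (simp add: germ_at_def times_germ.abs_eq)
  qed
  finally have "\<forall>\<^sub>F z in nhds 0. \<phi> (\<mu> + z) = (\<Sum>i\<in>I. \<alpha> i z * f i (\<mu> + z))"
    by (simp add: abs_germ_sum germ_at_def germ.abs_eq_iff germ_eq_def)
  note rel = this
  have "((\<lambda>\<epsilon>. \<phi> (c \<epsilon>) / \<epsilon> ^ k) \<longlongrightarrow> (\<Sum>i\<in>I. \<alpha> i 0 * L i)) (at 0)"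
    if c: "arc c" "c 0 = \<mu>" and lim: "\<forall>i\<in>I. ((\<lambda>\<epsilon>. f i (c \<epsilon>) / \<epsilon> ^ k) \<longlongrightarrow> L i) (at 0)" for c k L
  proof -
    have "((\<lambda>\<epsilon>. c \<epsilon> - \<mu>) \<longlongrightarrow> c 0 - \<mu>) (nhds 0)"
      by (intro tendsto_intros arc.tendsto_0[OF c(1)])
    hence shift: "((\<lambda>\<epsilon>. c \<epsilon> - \<mu>) \<longlongrightarrow> 0) (nhds 0)" by (simp add: c(2))
    have "\<forall>\<^sub>F \<epsilon> in nhds 0. \<phi> (\<mu> + (c \<epsilon> - \<mu>)) = (\<Sum>i\<in>I. \<alpha> i (c \<epsilon> - \<mu>) * f i (\<mu> + (c \<epsilon> - \<mu>)))"
      using eventually_compose_filterlim[OF rel shift] .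
    hence ev: "\<forall>\<^sub>F \<epsilon> in at 0. \<phi> (c \<epsilon>) = (\<Sum>i\<in>I. \<alpha> i (c \<epsilon> - \<mu>) * f i (c \<epsilon>))"
      by (intro eventually_nhds_imp_at) simp
    have "((\<lambda>\<epsilon>. \<Sum>i\<in>I. \<alpha> i (c \<epsilon> - \<mu>) * (f i (c \<epsilon>) / \<epsilon> ^ k)) \<longlongrightarrow> (\<Sum>i\<in>I. \<alpha> i 0 * L i)) (at 0)"
    proof (intro tendsto_sum tendsto_mult)
      fix i assume i: "i \<in> I"
      have "(\<alpha> i \<longlongrightarrow> \<alpha> i 0) (nhds 0)"
        using \<alpha>(2)[OF i] by (simp add: isCont_def tendsto_nhds_iff)
      from filterlim_compose[OF this shift] show "((\<lambda>\<epsilon>. \<alpha> i (c \<epsilon> - \<mu>)) \<longlongrightarrow> \<alpha> i 0) (at 0)"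
        by (simp add: tendsto_nhds_iff)
      show "((\<lambda>\<epsilon>. f i (c \<epsilon>) / \<epsilon> ^ k) \<longlongrightarrow> L i) (at 0)" using lim i by blast
    qed
    moreover have "\<forall>\<^sub>F \<epsilon> in at 0. (\<Sum>i\<in>I. \<alpha> i (c \<epsilon> - \<mu>) * (f i (c \<epsilon>) / \<epsilon> ^ k)) = \<phi> (c \<epsilon>) / \<epsilon> ^ k"
      using ev by eventually_elim (simp add: sum_divide_distrib)
    ultimately show ?thesis by (rule Lim_transform_eventually)
  qed
  with \<open>finite I\<close> show ?thesis
    by (intro exI[of _ I] exI[of _ "\<lambda>i. \<alpha> i 0"]) blast
qed

text \<open>Independent of the representative, because the expansion depends only on the germ. For a
  germ that is not analytic the value carries no meaning.\<close>

definition germ_coeff :: "nat \<Rightarrow> complex germ \<Rightarrow> complex" where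
  "germ_coeff i g = fps_nth (fps_expansion (rep_germ g) 0) i"

lemma germ_coeff_germ_at: "germ_coeff i (germ_at x f) = fps_nth (fps_expansion f x) i"
proof -
  have "germ_eq (rep_germ (germ_at x f)) (\<lambda>z. f (x + z))"
    unfolding germ_at_def using germ.abs_eq_iff Quotient3_rep_abs[OF Quotient3_germ]
    by (metis Quotient3_germ Quotient3_rep_abs germ_eq_equivp equivp_def)
  hence "fps_expansion (rep_germ (germ_at x f)) 0 = fps_expansion (\<lambda>z. f (x + z)) 0"
    unfolding germ_eq_def by (rule fps_expansion_cong)
  thus ?thesis
    using higher_deriv_shift_0[of i f x] by (simp add: germ_coeff_def fps_expansion_def o_def)
qed

definition analytic_germs_at :: "complex \<Rightarrow> complex germ set" where
  "analytic_germs_at x = {germ_at x f | f. f analytic_on {x}}"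

lemma germ_at_add: "germ_at x f + germ_at x g = germ_at x (\<lambda>z. f z + g z)"
  by (simp add: germ_at_def plus_germ.abs_eq)

lemma germ_scale_germ_at: "germ_scale a (germ_at x f) = germ_at x (\<lambda>z. a * f z)"
  by (simp add: germ_at_def germ_scale.abs_eq)

lemma germ_coeff_add:
  assumes "g \<in> analytic_germs_at x" "h \<in> analytic_germs_at x"
  shows "germ_coeff i (g + h) = germ_coeff i g + germ_coeff i h"
  using assms higher_deriv_add_at[of _ x _ i]
  by (auto simp: analytic_germs_at_def germ_at_add germ_coeff_germ_at fps_expansion_def add_divide_distrib)

lemma germ_coeff_scale:
  assumes "g \<in> analytic_germs_at x"
  shows "germ_coeff i (germ_scale a g) = a * germ_coeff i g"
  using assms higher_deriv_cmult'[of _ x i a]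
  by (auto simp: analytic_germs_at_def germ_scale_germ_at germ_coeff_germ_at fps_expansion_def)

lemma subspace_analytic_germs_at: "germ.subspace (analytic_germs_at x)"
proof (rule germ.subspaceI)
  have "0 = germ_at x (\<lambda>_. 0)" by (simp add: germ_at_def zero_germ_def)
  thus "0 \<in> analytic_germs_at x" unfolding analytic_germs_at_def by (intro CollectI exI[of _ "\<lambda>_. 0"]) simp
next
  fix g h assume "g \<in> analytic_germs_at x" "h \<in> analytic_germs_at x"
  then obtain f k where "g = germ_at x f" "f analytic_on {x}" "h = germ_at x k" "k analytic_on {x}"
    unfolding analytic_germs_at_def by blast
  thus "g + h \<in> analytic_germs_at x"
    unfolding analytic_germs_at_def
    by (intro CollectI exI[of _ "\<lambda>z. f z + k z"]) (simp add: germ_at_add analytic_on_add)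
next
  fix a g assume "g \<in> analytic_germs_at x"
  then obtain f where "g = germ_at x f" "f analytic_on {x}"
    unfolding analytic_germs_at_def by blast
  thus "germ_scale a g \<in> analytic_germs_at x"
    unfolding analytic_germs_at_def
    by (intro CollectI exI[of _ "\<lambda>z. a * f z"]) (simp add: germ_scale_germ_at analytic_on_mult)
qed

lemma analytic_germ_eq_0:
  assumes "g \<in> analytic_germs_at x" "\<And>i. germ_coeff i g = 0"
  shows "g = 0"
proof -
  obtain f where f: "g = germ_at x f" "f analytic_on {x}"
    using assms(1) by (auto simp: analytic_germs_at_def)
  obtain r where r: "0 < r" "f holomorphic_on ball x r"
    using f(2) by (auto simp: analytic_at_ball)
  have "fps_nth (fps_expansion f x) i = 0" for i
    using assms(2)[of i] by (simp add: f(1) germ_coeff_germ_at)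
  hence "(deriv ^^ i) f x = 0" for i by (simp add: fps_expansion_def)
  hence "f z = 0" if "z \<in> ball x r" for z
    using holomorphic_fun_eq_0_on_ball[OF r(2) that] by blast
  hence "\<forall>\<^sub>F z in nhds 0. f (x + z) = 0"
    using r(1) unfolding eventually_nhds_metric by (intro exI[of _ r]) (auto simp: dist_norm)
  thus ?thesis by (simp add: f(1) germ_at_def zero_germ_def germ.abs_eq_iff germ_eq_def)
qed

section \<open>The correspondence\<close>

locale bautin =
  fixes F :: "complex \<times> (complex^'n::finite) \<Rightarrow> complex" and h\<^sub>0 :: complex and \<mu>\<^sub>0 :: "complex^'n"
    and \<Omega> :: "(complex \<times> (complex^'n)) set" and v :: "'m::finite \<Rightarrow> 'n cpoly"
  assumes open_\<Omega>: "open \<Omega>" "(h\<^sub>0, \<mu>\<^sub>0) \<in> \<Omega>" and F: "cdifferentiable_on pair_scale F \<Omega>"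
    and ideal: "bautin_ideal F h\<^sub>0 \<mu>\<^sub>0 = germ_ideal (range (\<lambda>j. germ_at \<mu>\<^sub>0 (vpeval (v j))))"
begin

lemma coeff_in_terms_of_v:
  "\<exists>a. \<forall>c k L. arc c \<longrightarrow> c 0 = \<mu>\<^sub>0 \<longrightarrow> (\<forall>j. ((\<lambda>\<epsilon>. vpeval (v j) (c \<epsilon>) / \<epsilon> ^ k) \<longlongrightarrow> L j) (at 0)) \<longrightarrow>
    ((\<lambda>\<epsilon>. displacement_coeff F h\<^sub>0 i (c \<epsilon>) / \<epsilon> ^ k) \<longlongrightarrow> (\<Sum>j\<in>UNIV. a j * L j)) (at 0)"
proof -
  have "germ_at \<mu>\<^sub>0 (displacement_coeff F h\<^sub>0 i) \<in> bautin_ideal F h\<^sub>0 \<mu>\<^sub>0"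
    unfolding bautin_ideal_def by (rule germ_ideal_generator) simp
  then obtain I a where Ia: "\<forall>c k L. arc c \<longrightarrow> c 0 = \<mu>\<^sub>0 \<longrightarrow>
      (\<forall>j\<in>I. ((\<lambda>\<epsilon>. vpeval (v j) (c \<epsilon>) / \<epsilon> ^ k) \<longlongrightarrow> L j) (at 0)) \<longrightarrow>
      ((\<lambda>\<epsilon>. displacement_coeff F h\<^sub>0 i (c \<epsilon>) / \<epsilon> ^ k) \<longlongrightarrow> (\<Sum>j\<in>I. a j * L j)) (at 0)"
    using germ_ideal_along_arcs[of \<mu>\<^sub>0 "displacement_coeff F h\<^sub>0 i" "\<lambda>j. vpeval (v j)"] unfolding ideal by blast
  have "(\<Sum>j\<in>I. a j * L j) = (\<Sum>j\<in>UNIV. (if j \<in> I then a j else 0) * L j)" for L :: "'m \<Rightarrow> complex"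
    by (intro sum.mono_neutral_cong_left) auto
  with Ia show ?thesis by (intro exI[of _ "\<lambda>j. if j \<in> I then a j else 0"]) simp
qed

text \<open>The ideal has infinitely many generators F_i, but each v_j is a combination of finitely
  many of them, so finitely many Taylor coefficients determine its lowest order term.\<close>

lemma v_in_terms_of_coeff:
  "\<exists>I b. \<forall>c k L. arc c \<longrightarrow> c 0 = \<mu>\<^sub>0 \<longrightarrow>
    (\<forall>i. ((\<lambda>\<epsilon>. displacement_coeff F h\<^sub>0 i (c \<epsilon>) / \<epsilon> ^ k) \<longlongrightarrow> L i) (at 0)) \<longrightarrow>
    ((\<lambda>\<epsilon>. vpeval (v j) (c \<epsilon>) / \<epsilon> ^ k) \<longlongrightarrow> (\<Sum>i\<in>I. b i * L i)) (at 0)"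
proof -
  have "germ_at \<mu>\<^sub>0 (vpeval (v j)) \<in> bautin_ideal F h\<^sub>0 \<mu>\<^sub>0"
    unfolding ideal by (rule germ_ideal_generator) simp
  from germ_ideal_along_arcs[OF this[unfolded bautin_ideal_def]] show ?thesis by blast
qed

text \<open>\<Psi> is the image map of one linear map \<open>L\<close>, so the clauses on \<Psi>
  reduce to injectivity of \<open>L\<close> on the span and to the identification of the lines
  \<open>L\<close> produces with the points of the fibre.\<close>

theorem correspondence:
  shows "\<exists>(\<Psi> :: complex germ set \<Rightarrow> (complex^'m) set)
            (L :: complex germ \<Rightarrow> complex^'m) (L' :: complex^'m \<Rightarrow> complex germ).
     bij_betw \<Psi> (projectivized_bifurcation_germs F h\<^sub>0 \<mu>\<^sub>0) (blowup_fibre v \<mu>\<^sub>0) \<and>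
     (\<forall>c k M. analytic_arc \<mu>\<^sub>0 c \<and> bifurcation_function F h\<^sub>0 c k M \<longrightarrow>
        \<Psi> (germ.span {germ_at h\<^sub>0 M}) = vec.span {arc_coeff_vector v c k}) \<and>
     Vector_Spaces.linear germ_scale (*s) L \<and> Vector_Spaces.linear (*s) germ_scale L' \<and>
     L ` germ.span (bifurcation_germs F h\<^sub>0 \<mu>\<^sub>0) = vec.span (\<Union>(blowup_fibre v \<mu>\<^sub>0)) \<and>
     (\<forall>g\<in>germ.span (bifurcation_germs F h\<^sub>0 \<mu>\<^sub>0). L' (L g) = g) \<and>
     (\<forall>w\<in>vec.span (\<Union>(blowup_fibre v \<mu>\<^sub>0)). L (L' w) = w) \<and>
     (\<forall>p\<in>projectivized_bifurcation_germs F h\<^sub>0 \<mu>\<^sub>0. \<Psi> p = L ` p) \<and>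
     (\<forall>q\<in>blowup_fibre v \<mu>\<^sub>0.
        inv_into (projectivized_bifurcation_germs F h\<^sub>0 \<mu>\<^sub>0) \<Psi> q = L' ` q)"
proof -
  have "\<forall>i. \<exists>a. \<forall>c k L. arc c \<longrightarrow> c 0 = \<mu>\<^sub>0 \<longrightarrow> (\<forall>j. ((\<lambda>\<epsilon>. vpeval (v j) (c \<epsilon>) / \<epsilon> ^ k) \<longlongrightarrow> L j) (at 0)) \<longrightarrow>
      ((\<lambda>\<epsilon>. displacement_coeff F h\<^sub>0 i (c \<epsilon>) / \<epsilon> ^ k) \<longlongrightarrow> (\<Sum>j\<in>UNIV. a j * L j)) (at 0)"
    using coeff_in_terms_of_v by blast
  from choice[OF this] obtain A where A: "\<forall>i c k L. arc c \<longrightarrow> c 0 = \<mu>\<^sub>0 \<longrightarrow>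
      (\<forall>j. ((\<lambda>\<epsilon>. vpeval (v j) (c \<epsilon>) / \<epsilon> ^ k) \<longlongrightarrow> L j) (at 0)) \<longrightarrow>
      ((\<lambda>\<epsilon>. displacement_coeff F h\<^sub>0 i (c \<epsilon>) / \<epsilon> ^ k) \<longlongrightarrow> (\<Sum>j\<in>UNIV. A i j * L j)) (at 0)"
    by (elim exE)
  have "\<forall>j. \<exists>Ib. \<forall>c k L. arc c \<longrightarrow> c 0 = \<mu>\<^sub>0 \<longrightarrow>
      (\<forall>i. ((\<lambda>\<epsilon>. displacement_coeff F h\<^sub>0 i (c \<epsilon>) / \<epsilon> ^ k) \<longlongrightarrow> L i) (at 0)) \<longrightarrow>
      ((\<lambda>\<epsilon>. vpeval (v j) (c \<epsilon>) / \<epsilon> ^ k) \<longlongrightarrow> (\<Sum>i\<in>fst Ib. snd Ib i * L i)) (at 0)"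
  proof
    fix j
    obtain I b where "\<forall>c k L. arc c \<longrightarrow> c 0 = \<mu>\<^sub>0 \<longrightarrow>
        (\<forall>i. ((\<lambda>\<epsilon>. displacement_coeff F h\<^sub>0 i (c \<epsilon>) / \<epsilon> ^ k) \<longlongrightarrow> L i) (at 0)) \<longrightarrow>
        ((\<lambda>\<epsilon>. vpeval (v j) (c \<epsilon>) / \<epsilon> ^ k) \<longlongrightarrow> (\<Sum>i\<in>I. b i * L i)) (at 0)"
      using v_in_terms_of_coeff[of j] by (elim exE)
    thus "\<exists>Ib. \<forall>c k L. arc c \<longrightarrow> c 0 = \<mu>\<^sub>0 \<longrightarrow>
        (\<forall>i. ((\<lambda>\<epsilon>. displacement_coeff F h\<^sub>0 i (c \<epsilon>) / \<epsilon> ^ k) \<longlongrightarrow> L i) (at 0)) \<longrightarrow>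
        ((\<lambda>\<epsilon>. vpeval (v j) (c \<epsilon>) / \<epsilon> ^ k) \<longlongrightarrow> (\<Sum>i\<in>fst Ib. snd Ib i * L i)) (at 0)"
      by (intro exI[of _ "(I, b)"]) simp
  qed
  from choice[OF this] obtain B where B: "\<forall>j c k L. arc c \<longrightarrow> c 0 = \<mu>\<^sub>0 \<longrightarrow>
      (\<forall>i. ((\<lambda>\<epsilon>. displacement_coeff F h\<^sub>0 i (c \<epsilon>) / \<epsilon> ^ k) \<longlongrightarrow> L i) (at 0)) \<longrightarrow>
      ((\<lambda>\<epsilon>. vpeval (v j) (c \<epsilon>) / \<epsilon> ^ k) \<longlongrightarrow> (\<Sum>i\<in>fst (B j). snd (B j) i * L i)) (at 0)"
    by (elim exE)
  txt \<open>On germs of bifurcation functions \<open>B\<close> gives the isomorphism, while \<open>A\<close> recovers the Taylor coefficients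
    from the image.\<close>
  define BG where "BG = bifurcation_germs F h\<^sub>0 \<mu>\<^sub>0"
  define E where "E = blowup_fibre v \<mu>\<^sub>0"
  define L0 where "L0 = (\<lambda>g. \<chi> j. \<Sum>i\<in>fst (B j). snd (B j) i * germ_coeff i g)"
  interpret lin: vector_space_pair "germ_scale :: complex \<Rightarrow> complex germ \<Rightarrow> complex germ"
    "(*s) :: complex \<Rightarrow> complex^'m \<Rightarrow> complex^'m" ..
  \<comment> \<open>The formula \<open>L0\<close> is linear on analytic germs; the map
    \<open>L\<close> is linear on all germs and agrees with it there.\<close>
  have "\<exists>L. Vector_Spaces.linear germ_scale (*s) L \<and> (\<forall>g\<in>analytic_germs_at h\<^sub>0. L g = L0 g)"
  proof (rule lin.linear_extend_from_subspace[OF subspace_analytic_germs_at])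
    fix g h assume "g \<in> analytic_germs_at h\<^sub>0" "h \<in> analytic_germs_at h\<^sub>0"
    thus "L0 (g + h) = L0 g + L0 h"
      by (simp add: L0_def vec_eq_iff germ_coeff_add distrib_left sum.distrib)
  next
    fix a g assume "g \<in> analytic_germs_at h\<^sub>0"
    thus "L0 (germ_scale a g) = a *s L0 g"
      by (simp add: L0_def vec_eq_iff germ_coeff_scale sum_distrib_left mult.left_commute)
  qed
  then obtain L where L: "Vector_Spaces.linear germ_scale (*s) L" "\<forall>g\<in>analytic_germs_at h\<^sub>0. L g = L0 g"
    by (elim exE conjE)
  interpret L: Vector_Spaces.linear germ_scale "(*s)" L by (rule L(1))
  have arcD: "arc c" "c 0 = \<mu>\<^sub>0" "analytic_arc \<mu>\<^sub>0 c \<Longrightarrow> (h\<^sub>0, c 0) \<in> \<Omega>" if "analytic_arc \<mu>\<^sub>0 c" for c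
    using that open_\<Omega> by (auto simp: analytic_arc_def arc_def)
  have bif: "germ_at h\<^sub>0 M \<in> analytic_germs_at h\<^sub>0"
      "\<And>j. ((\<lambda>\<epsilon>. vpeval (v j) (c \<epsilon>) / \<epsilon> ^ k) \<longlongrightarrow> L (germ_at h\<^sub>0 M) $ j) (at 0)"
      "\<And>i. germ_coeff i (germ_at h\<^sub>0 M) = (\<Sum>j\<in>UNIV. A i j * L (germ_at h\<^sub>0 M) $ j)"
      "L (germ_at h\<^sub>0 M) = arc_coeff_vector v c k"
      "germ_at h\<^sub>0 M \<noteq> 0"
    if c: "analytic_arc \<mu>\<^sub>0 c" and M: "bifurcation_function F h\<^sub>0 c k M" for c k M
  proof -
    interpret arc c by (rule arcD(1)[OF c])
    have c0: "c 0 = \<mu>\<^sub>0" by (rule arcD(2)[OF c])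
    show an: "germ_at h\<^sub>0 M \<in> analytic_germs_at h\<^sub>0"
      using M unfolding bifurcation_function_def analytic_germs_at_def by blast
    have lim: "((\<lambda>\<epsilon>. displacement_coeff F h\<^sub>0 i (c \<epsilon>) / \<epsilon> ^ k) \<longlongrightarrow> germ_coeff i (germ_at h\<^sub>0 M)) (at 0)" for i
      unfolding germ_coeff_germ_at
      by (rule bifurcation_limits[OF F open_\<Omega>(1) _ M]) (simp add: c0 open_\<Omega>)
    show v_lim: "((\<lambda>\<epsilon>. vpeval (v j) (c \<epsilon>) / \<epsilon> ^ k) \<longlongrightarrow> L (germ_at h\<^sub>0 M) $ j) (at 0)" for j
    proof -
      have "L (germ_at h\<^sub>0 M) $ j = (\<Sum>i\<in>fst (B j). snd (B j) i * germ_coeff i (germ_at h\<^sub>0 M))"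
        using L(2) an by (simp add: L0_def)
      with B lim arcD(1)[OF c] c0 show ?thesis by simp
    qed
    have A_lim: "((\<lambda>\<epsilon>. displacement_coeff F h\<^sub>0 i (c \<epsilon>) / \<epsilon> ^ k) \<longlongrightarrow> (\<Sum>j\<in>UNIV. A i j * L (germ_at h\<^sub>0 M) $ j)) (at 0)" for i
      using A v_lim arcD(1)[OF c] c0 by simp
    show "germ_coeff i (germ_at h\<^sub>0 M) = (\<Sum>j\<in>UNIV. A i j * L (germ_at h\<^sub>0 M) $ j)" for i
      by (rule tendsto_unique[OF _ lim A_lim]) simp
    show "L (germ_at h\<^sub>0 M) = arc_coeff_vector v c k"
    proof (rule vec_eq_iff[THEN iffD2], rule allI)
      fix j
      have "(\<lambda>\<epsilon>. vpeval (v j) (c \<epsilon>)) \<in> {f. f analytic_on {0}}"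
        by (rule germs.peval_in) (simp add: analytic)
      thus "L (germ_at h\<^sub>0 M) $ j = arc_coeff_vector v c k $ j"
        using fps_expansion_nth_limit[OF _ v_lim[of j]] by (simp add: arc_coeff_vector_def)
    qed
    show "germ_at h\<^sub>0 M \<noteq> 0"
    proof
      assume "germ_at h\<^sub>0 M = 0"
      hence "\<forall>\<^sub>F z in nhds 0. M (h\<^sub>0 + z) = 0"
        by (simp add: germ_at_def zero_germ_def germ.abs_eq_iff germ_eq_def)
      hence "\<forall>\<^sub>F h in nhds h\<^sub>0. M h = 0"
        unfolding eventually_nhds_metric
        by (auto simp: dist_norm) (metis add_diff_cancel_left' diff_add_cancel add.commute)
      with M show False by (simp add: bifurcation_function_def)
    qed
  qed
  have BG_AG: "germ.span BG \<subseteq> analytic_germs_at h\<^sub>0"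
    by (rule germ.span_minimal[OF _ subspace_analytic_germs_at])
       (use bif(1) in \<open>auto simp: BG_def bifurcation_germs_def\<close>)
  \<comment> \<open>Bifurcation germs need not be closed under addition. Both sides are linear on
    analytic germs, so the relation extends to the span; there it shows that \<open>L g\<close>
    determines all Taylor coefficients, hence g.\<close>
  have coeff_L: "germ_coeff i g = (\<Sum>j\<in>UNIV. A i j * L g $ j)" if "g \<in> germ.span BG" for i g
  proof -
    have "g \<in> analytic_germs_at h\<^sub>0 \<and> germ_coeff i g = (\<Sum>j\<in>UNIV. A i j * L g $ j)"
      using that
    proof (induction rule: germ.span_induct_alt)
      case base
      have 0: "0 \<in> analytic_germs_at h\<^sub>0" by (rule germ.subspace_0[OF subspace_analytic_germs_at])
      from germ_coeff_scale[OF this, of i 0] 0 show ?case by (simp add: L.zero)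
    next
      case (step a g h)
      have g: "g \<in> analytic_germs_at h\<^sub>0" using step(1) BG_AG germ.span_base by blast
      have ag: "germ_scale a g \<in> analytic_germs_at h\<^sub>0"
        by (rule germ.subspace_scale[OF subspace_analytic_germs_at g])
      have "germ_coeff i g = (\<Sum>j\<in>UNIV. A i j * L g $ j)"
        using step(1) bif(3) by (auto simp: BG_def bifurcation_germs_def)
      with step(2) show ?case
        by (simp add: germ.subspace_add[OF subspace_analytic_germs_at ag] germ_coeff_add[OF ag]
              germ_coeff_scale[OF g] L.add L.scale sum.distrib distrib_left sum_distrib_left mult.left_commute)
    qed
    thus ?thesis ..
  qed
  have inj: "inj_on L (germ.span BG)"
  proof (rule inj_onI)
    fix g h assume gh: "g \<in> germ.span BG" "h \<in> germ.span BG" "L g = L h"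
    have d: "g - h \<in> germ.span BG" by (rule germ.span_diff[OF gh(1,2)])
    have "germ_coeff i (g - h) = 0" for i
      using coeff_L[OF d] gh(3) by (simp add: L.diff)
    hence "g - h = 0" using d BG_AG by (intro analytic_germ_eq_0[of _ h\<^sub>0]) auto
    thus "g = h" by simp
  qed
  obtain L' where L': "Vector_Spaces.linear (*s) germ_scale L'" "\<forall>g\<in>germ.span BG. L' (L g) = g"
    using lin.linear_exists_left_inverse_on[OF L(1) germ.subspace_span inj] by blast
  have image_span: "L ` germ.span S = vec.span (L ` S)" for S
    by (rule L.span_image[symmetric])
  have image_line: "L ` germ.span {g} = vec.span {L g}" for g
    using image_span[of "{g}"] by simp
  have L_E: "vec.span {L g} \<in> E" if g: "g \<in> BG" for g
  proof -
    obtain c k M where M: "analytic_arc \<mu>\<^sub>0 c" "bifurcation_function F h\<^sub>0 c k M" "g = germ_at h\<^sub>0 M"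
      using g unfolding BG_def bifurcation_germs_def by blast
    have "L g \<noteq> 0"
    proof
      assume "L g = 0"
      hence "L g = L 0" by (simp add: L.zero)
      hence "g = 0" by (rule inj_onD[OF inj _ germ.span_base[OF g] germ.span_zero])
      with bif(5)[OF M(1,2)] M(3) show False by simp
    qed
    thus ?thesis
      using arc.limit_in_blowup_fibre[OF arcD(1)[OF M(1)] bif(2)[OF M(1,2)]] arcD(2)[OF M(1)]
      by (simp add: E_def M(3))
  qed
  have E_L: "\<exists>g\<in>BG. l = vec.span {L g}" if l: "l \<in> E" for l
  proof -
    obtain c k w where c: "arc c" "c 0 = \<mu>\<^sub>0" "w \<noteq> 0" "l = vec.span {w}"
      and w: "\<forall>j. ((\<lambda>\<epsilon>. vpeval (v j) (c \<epsilon>) / \<epsilon> ^ k) \<longlongrightarrow> w $ j) (at 0)"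
      using arc_through_blowup_fibre[of l v \<mu>\<^sub>0] l unfolding E_def by blast
    define m where "m = (\<lambda>i. \<Sum>j\<in>UNIV. A i j * w $ j)"
    have m: "((\<lambda>\<epsilon>. displacement_coeff F h\<^sub>0 i (c \<epsilon>) / \<epsilon> ^ k) \<longlongrightarrow> m i) (at 0)" for i
      unfolding m_def using A c w by blast
    \<comment> \<open>Passing from w to m by \<open>A\<close> and back by \<open>B\<close> returns
      w. As w is nonzero, some m_i is too, so the arc has a bifurcation function of order exactly
      \<open>k\<close>.\<close>
    have w_m: "w $ j = (\<Sum>i\<in>fst (B j). snd (B j) i * m i)" for j
    proof -
      have "((\<lambda>\<epsilon>. vpeval (v j) (c \<epsilon>) / \<epsilon> ^ k) \<longlongrightarrow> (\<Sum>i\<in>fst (B j). snd (B j) i * m i)) (at 0)"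
        using B c m by blast
      with w show ?thesis by (intro tendsto_unique[of "at (0::complex)"]) auto
    qed
    obtain i where "m i \<noteq> 0"
    proof -
      obtain j where "w $ j \<noteq> 0" using c(3) by (auto simp: vec_eq_iff)
      hence "\<exists>i. m i \<noteq> 0" using w_m[of j] by (auto intro: ccontr)
      thus ?thesis using that by blast
    qed
    then obtain M where M: "bifurcation_function F h\<^sub>0 c k M" "\<And>i. fps_nth (fps_expansion M h\<^sub>0) i = m i"
      using arc.bifurcation_exists[OF c(1) F open_\<Omega>(1) _ m] open_\<Omega>(2) c(2) by metis
    have arc: "analytic_arc \<mu>\<^sub>0 c" using c by (simp add: analytic_arc_def arc_def)
    have "L (germ_at h\<^sub>0 M) = L0 (germ_at h\<^sub>0 M)"
      using L(2) bif(1)[OF arc M(1)] by simp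
    also have "\<dots> = w"
      by (simp add: L0_def vec_eq_iff germ_coeff_germ_at M(2) w_m)
    finally have "l = vec.span {L (germ_at h\<^sub>0 M)}" using c by simp
    moreover have "germ_at h\<^sub>0 M \<in> BG"
      using arc M(1) unfolding BG_def bifurcation_germs_def by blast
    ultimately show ?thesis by blast
  qed
  define PBG where "PBG = projectivized_bifurcation_germs F h\<^sub>0 \<mu>\<^sub>0"
  have PBG: "PBG = (\<lambda>g. germ.span {g}) ` BG"
    by (simp add: PBG_def BG_def projectivized_bifurcation_germs_def)
  have sub: "p \<subseteq> germ.span BG" if "p \<in> PBG" for p
    using that by (auto simp: PBG intro: germ.span_mono[THEN subsetD, rotated])
  have bij: "bij_betw ((`) L) PBG E"
  proof (rule bij_betwI')
    show "(L ` p = L ` q) = (p = q)" if "p \<in> PBG" "q \<in> PBG" for p q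
      using inj_on_image_eq_iff[OF inj sub[OF that(1)] sub[OF that(2)]] .
    show "L ` p \<in> E" if "p \<in> PBG" for p
      using that L_E by (auto simp: PBG image_line)
    show "\<exists>p\<in>PBG. q = L ` p" if "q \<in> E" for q
      using E_L[OF that] by (auto simp: PBG image_line)
  qed
  have span_E: "L ` germ.span BG = vec.span (\<Union>E)"
  proof -
    have "vec.span (L ` BG) = vec.span (\<Union>E)"
    proof (rule vec.span_eq[THEN iffD2], intro conjI subsetI)
      fix x assume "x \<in> L ` BG"
      then obtain g where "g \<in> BG" "x = L g" by blast
      hence "x \<in> \<Union>E" using L_E[of g] vec.span_base[of x "{L g}"] by auto
      thus "x \<in> vec.span (\<Union>E)" by (rule vec.span_base)
    next
      fix x assume "x \<in> \<Union>E"
      then obtain g where "g \<in> BG" "x \<in> vec.span {L g}" using E_L by blast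
      moreover have "vec.span {L g} \<subseteq> vec.span (L ` BG)"
        using \<open>g \<in> BG\<close> by (intro vec.span_mono) auto
      ultimately show "x \<in> vec.span (L ` BG)" by blast
    qed
    thus ?thesis by (simp add: image_span)
  qed
  have inv: "inv_into PBG ((`) L) q = L' ` q" if q: "q \<in> E" for q
  proof -
    obtain p where p: "p \<in> PBG" "q = L ` p"
      using bij_betw_imp_surj_on[OF bij] q by blast
    have "inv_into PBG ((`) L) q = p"
      using inv_into_f_f[OF bij_betw_imp_inj_on[OF bij] p(1)] p(2) by simp
    also have "p = L' ` q"
      unfolding p(2) image_image using L'(2) sub[OF p(1)] by (auto simp: image_iff subset_iff)
    finally show ?thesis .
  qed
  have right: "L (L' w) = w" if w: "w \<in> vec.span (\<Union>E)" for w
  proof -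
    obtain g where "g \<in> germ.span BG" "w = L g" using w span_E by blast
    thus ?thesis using L'(2) by simp
  qed
  have lines: "\<forall>c k M. analytic_arc \<mu>\<^sub>0 c \<and> bifurcation_function F h\<^sub>0 c k M \<longrightarrow>
      L ` germ.span {germ_at h\<^sub>0 M} = vec.span {arc_coeff_vector v c k}"
  proof (intro allI impI, elim conjE)
    fix c k M assume "analytic_arc \<mu>\<^sub>0 c" "bifurcation_function F h\<^sub>0 c k M"
    from bif(4)[OF this] show "L ` germ.span {germ_at h\<^sub>0 M} = vec.span {arc_coeff_vector v c k}"
      by (simp only: image_line)
  qed
  show ?thesis
    unfolding PBG_def[symmetric] BG_def[symmetric] E_def[symmetric]
    by (intro exI[of _ "(`) L"] exI[of _ L] exI[of _ L'] conjI)
       (use bij lines L(1) L' span_E right inv in simp_all)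
qed

end

theorem corollary2:
  fixes d :: nat
    and \<iota> :: "bool \<times> nat \<times> nat \<Rightarrow> 'n::finite"
    and v :: "'N::finite \<Rightarrow> 'n cpoly"
    and \<mu>\<^sub>0 :: "complex^'n"
    and U :: "(complex^'n) set"
    and A :: "(complex \<times> complex) set"
    and J :: "real set"
    and D :: "complex set"
    and \<sigma> :: "complex \<Rightarrow> complex \<times> complex"
    and h\<^sub>0 :: complex
    and \<Omega> :: "(complex \<times> (complex^'n)) set"
    and P F :: "complex \<times> (complex^'n) \<Rightarrow> complex"
  assumes "bij_betw \<iota> (coefficient_labels d) UNIV"
    and "period_annulus (poly_vector_field d \<iota> \<mu>\<^sub>0) A"
    and "cross_section (poly_vector_field d \<iota> \<mu>\<^sub>0) A J D \<sigma>"
    and "h\<^sub>0 \<in> of_real ` J"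
    and "first_return_map (poly_vector_field d \<iota>) J D \<sigma> h\<^sub>0 \<mu>\<^sub>0 \<Omega> P"
    and "F = displacement P"
    and "open U" and "\<mu>\<^sub>0 \<in> U" and "{h\<^sub>0} \<times> U \<subseteq> \<Omega>"
    and "\<And>\<mu>. \<mu> \<in> U \<Longrightarrow> bautin_ideal F h\<^sub>0 \<mu> = germ_ideal (range (\<lambda>j. germ_at \<mu> (vpeval (v j))))"
  shows "\<exists>(\<Psi> :: complex germ set \<Rightarrow> (complex^'N) set)
            (L :: complex germ \<Rightarrow> complex^'N) (L' :: complex^'N \<Rightarrow> complex germ).
     bij_betw \<Psi> (projectivized_bifurcation_germs F h\<^sub>0 \<mu>\<^sub>0) (blowup_fibre v \<mu>\<^sub>0) \<and>
     (\<forall>c k M. analytic_arc \<mu>\<^sub>0 c \<and> bifurcation_function F h\<^sub>0 c k M \<longrightarrow>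
        \<Psi> (germ.span {germ_at h\<^sub>0 M}) = vec.span {arc_coeff_vector v c k}) \<and>
     Vector_Spaces.linear germ_scale (*s) L \<and> Vector_Spaces.linear (*s) germ_scale L' \<and>
     L ` germ.span (bifurcation_germs F h\<^sub>0 \<mu>\<^sub>0) = vec.span (\<Union>(blowup_fibre v \<mu>\<^sub>0)) \<and>
     (\<forall>g\<in>germ.span (bifurcation_germs F h\<^sub>0 \<mu>\<^sub>0). L' (L g) = g) \<and>
     (\<forall>w\<in>vec.span (\<Union>(blowup_fibre v \<mu>\<^sub>0)). L (L' w) = w) \<and>
     (\<forall>p\<in>projectivized_bifurcation_germs F h\<^sub>0 \<mu>\<^sub>0. \<Psi> p = L ` p) \<and>
     (\<forall>q\<in>blowup_fibre v \<mu>\<^sub>0.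
        inv_into (projectivized_bifurcation_germs F h\<^sub>0 \<mu>\<^sub>0) \<Psi> q = L' ` q)"
proof -
  have P: "open \<Omega>" "(h\<^sub>0, \<mu>\<^sub>0) \<in> \<Omega>" "cdifferentiable_on pair_scale P \<Omega>"
    using assms(5) by (simp_all add: first_return_map_def)
  have "cdifferentiable_on pair_scale F \<Omega>"
    unfolding cdifferentiable_on_def
  proof
    fix x assume "x \<in> \<Omega>"
    then obtain P' where P': "(P has_derivative P') (at x)" "\<forall>c y. P' (pair_scale c y) = c * P' y"
      using P(3) unfolding cdifferentiable_on_def by blast
    have "F = (\<lambda>x. P x - fst x)"
      by (auto simp: assms(6) displacement_def)
    hence "(F has_derivative (\<lambda>y. P' y - fst y)) (at x)"
      using has_derivative_diff[OF P'(1) has_derivative_fst[OF has_derivative_ident]] by simp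
    moreover have "\<forall>c y. P' (pair_scale c y) - fst (pair_scale c y) = c * (P' y - fst y)"
      using P'(2) by (simp add: right_diff_distrib)
    ultimately show "\<exists>f'. (F has_derivative f') (at x) \<and> (\<forall>c y. f' (pair_scale c y) = c * f' y)"
      by blast
  qed
  with P(1,2) assms(8,10) interpret bautin F h\<^sub>0 \<mu>\<^sub>0 \<Omega> v
    by unfold_locales simp_all
  show ?thesis by (rule correspondence)
qed

end
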